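(* Let $F$ be a pairwise disjoint family of at least $6$ nonempty open convex sets in $\mathbb{R}^3$. Suppose that for every subfamily $F'\subset F$ of size $5$, $T_1(F')\neq\varnothing$, and that for every subfamily $F'\subset F$ of size $4$, $T_1(F')$ is connected. Then $T_1(F)\neq\varnothing$.
   Context: Let $G(n,d)$ be the Grassmannian of $n$-dimensional linear subspaces of $\mathbb{R}^d$, and let $M(n,d)$ be the space of all affine $n$-planes in $\mathbb{R}^d$, topologized as an open subset of $G(n+1,d+1)$ (identify $\mathbb{R}^d$ with the affine hyperplane $\mathbb{R}^d\times\{1\}\subset\mathbb{R}^{d+1}$ and send an affine $n$-plane to its linear span). For a family $F$ of nonempty convex sets in $\mathbb{R}^d$ and $0\le n<d$, $T_n(F)\subset M(n,d)$ is the subspace of all affine $n$-planes that intersect every member of $F$; thus $T_1(F)$ here is the space of lines in $\mathbb{R}^3$ meeting all members of $F$. A space $U$ is called connected if $H_0(U)=0$, where $H_*$ is reduced singular homology with coefficients in a fixed nonzero abelian group.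
   Formalization: The family F is taken to be finite; for infinite families the claim fails, e.g. for the sets {k<x<k+1, y>k²}, k=0,1,2,…, all of whose 4- and 5-member subfamilies satisfy the hypotheses but which have no common transversal line. *)

theory Defs
  imports "HOL-Analysis.Analysis" "HOL-Homology.Homology"
begin

section \<open>The space of affine planes\<close>

definition quotient_topology :: "'a topology \<Rightarrow> ('a \<Rightarrow> 'b) \<Rightarrow> 'b topology" where
  "quotient_topology X f =
     topology (\<lambda>U. U \<subseteq> f ` topspace X \<and> openin X {x \<in> topspace X. f x \<in> U})"

definition frame_space :: "nat \<Rightarrow> (nat \<Rightarrow> 'a::euclidean_space) topology" where
  "frame_space k =
     subtopology (product_topology (\<lambda>_. euclidean) {..<k})
       {v. inj_on v {..<k} \<and> independent (v ` {..<k})}"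

text \<open>The Grassmannian of \<open>k\<close>-dimensional linear subspaces, as a quotient of the space of
  linearly independent \<open>k\<close>-tuples.\<close>

definition grassmannian :: "nat \<Rightarrow> 'a::euclidean_space set topology" where
  "grassmannian k = quotient_topology (frame_space k) (\<lambda>v. span (v ` {..<k}))"

text \<open>The type \<open>'a \<times> real\<close> is the Euclidean space of one dimension more. An affine plane is
  identified with the span of its copy in \<open>UNIV \<times> {1}\<close>; \<open>embedding_map_cone_span\<close> and
  \<open>openin_cone_span_image\<close> below show that this is a homeomorphism onto an open subspace of the
  Grassmannian.\<close>

definition cone_span :: "'a::euclidean_space set \<Rightarrow> ('a \<times> real) set" where
  "cone_span L = span ((\<lambda>x. (x, 1)) ` L)"

definition affine_planes :: "nat \<Rightarrow> 'a::euclidean_space set set" where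
  "affine_planes n = {L. affine L \<and> aff_dim L = int n}"

definition affine_plane_space :: "nat \<Rightarrow> 'a::euclidean_space set topology" where
  "affine_plane_space n =
     pullback_topology (affine_planes n) cone_span (grassmannian (Suc n))"

definition transversals :: "nat \<Rightarrow> 'a::euclidean_space set set \<Rightarrow> 'a set set" where
  "transversals n F = {L \<in> affine_planes n. \<forall>A\<in>F. L \<inter> A \<noteq> {}}"

definition transversal_space :: "nat \<Rightarrow> 'a::euclidean_space set set \<Rightarrow> 'a set topology" where
  "transversal_space n F = subtopology (affine_plane_space n) (transversals n F)"

lemma openin_quotient_topology:
  "openin (quotient_topology X f) U \<longleftrightarrow>
     U \<subseteq> f ` topspace X \<and> openin X {x \<in> topspace X. f x \<in> U}"
proof -
  have "istopology (\<lambda>U. U \<subseteq> f ` topspace X \<and> openin X {x \<in> topspace X. f x \<in> U})"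
    unfolding istopology_def
  proof (intro conjI allI impI)
    fix S T
    assume "S \<subseteq> f ` topspace X \<and> openin X {x \<in> topspace X. f x \<in> S}"
      and "T \<subseteq> f ` topspace X \<and> openin X {x \<in> topspace X. f x \<in> T}"
    moreover have "{x \<in> topspace X. f x \<in> S \<inter> T} =
        {x \<in> topspace X. f x \<in> S} \<inter> {x \<in> topspace X. f x \<in> T}" by auto
    ultimately show "openin X {x \<in> topspace X. f x \<in> S \<inter> T}" "S \<inter> T \<subseteq> f ` topspace X"
      by auto
  next
    fix K
    assume *: "\<forall>S\<in>K. S \<subseteq> f ` topspace X \<and> openin X {x \<in> topspace X. f x \<in> S}"
    have "{x \<in> topspace X. f x \<in> \<Union>K} = (\<Union>S\<in>K. {x \<in> topspace X. f x \<in> S})" by auto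
    then show "openin X {x \<in> topspace X. f x \<in> \<Union>K}" using * by auto
    show "\<Union>K \<subseteq> f ` topspace X" using * by auto
  qed
  then show ?thesis
    by (simp add: quotient_topology_def topology_inverse')
qed

lemma topspace_quotient_topology: "topspace (quotient_topology X f) = f ` topspace X"
proof
  show "topspace (quotient_topology X f) \<subseteq> f ` topspace X"
    by (metis openin_quotient_topology openin_topspace)
  have "{x \<in> topspace X. f x \<in> f ` topspace X} = topspace X" by auto
  then show "f ` topspace X \<subseteq> topspace (quotient_topology X f)"
    by (intro openin_subset) (simp add: openin_quotient_topology)
qed

lemma quotient_map_quotient_topology: "quotient_map X (quotient_topology X f) f"
  by (auto simp: quotient_map_def topspace_quotient_topology openin_quotient_topology)

lemma topspace_frame_space:
  "topspace (frame_space k) =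
     {v \<in> extensional {..<k}. inj_on v {..<k} \<and> independent (v ` {..<k})}"
  by (auto simp: frame_space_def PiE_def)

lemma topspace_grassmannian: "topspace (grassmannian k) = {V. subspace V \<and> dim V = k}"
proof (intro equalityI subsetI)
  fix V :: "'a set" assume "V \<in> topspace (grassmannian k)"
  then obtain v :: "nat \<Rightarrow> 'a" where "inj_on v {..<k}" "independent (v ` {..<k})" "V = span (v ` {..<k})"
    by (auto simp: grassmannian_def topspace_quotient_topology topspace_frame_space)
  then show "V \<in> {V. subspace V \<and> dim V = k}"
    by (simp add: dim_eq_card_independent card_image)
next
  fix V :: "'a set" assume "V \<in> {V. subspace V \<and> dim V = k}"
  then have V: "subspace V" "dim V = k" by auto
  obtain B where B: "B \<subseteq> V" "independent B" "V \<subseteq> span B" "card B = k"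
    using basis_exists[of V] V(2) by blast
  have "finite B" using B(2) independent_imp_finite by blast
  then obtain h where h: "bij_betw h {..<k} B"
    using ex_bij_betw_nat_finite[of B] B(4) by (auto simp: lessThan_atLeast0)
  define v where "v = restrict h {..<k}"
  have vi: "v ` {..<k} = B" "inj_on v {..<k}"
    using h by (auto simp: v_def bij_betw_def inj_on_def)
  have "span B = V" using B V by (metis span_subspace)
  then show "V \<in> topspace (grassmannian k)"
    unfolding grassmannian_def topspace_quotient_topology topspace_frame_space
    using vi B(2) by (intro image_eqI[of _ _ v]) (auto simp: v_def)
qed

lemma cone_span_slice:
  assumes "affine L"
  shows "{x. (x, 1) \<in> cone_span L} = L"
proof (intro equalityI subsetI)
  fix x assume "x \<in> L" then show "x \<in> {x. (x, 1) \<in> cone_span L}"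
    by (auto simp: cone_span_def span_base)
next
  fix x assume "x \<in> {x. (x, 1) \<in> cone_span L}"
  then obtain t r where t: "finite t" "t \<subseteq> (\<lambda>x. (x, 1::real)) ` L" "(x, 1) = (\<Sum>a\<in>t. r a *\<^sub>R a)"
    by (auto simp: cone_span_def span_explicit)
  obtain s where s: "s \<subseteq> L" "finite s" "t = (\<lambda>x. (x, 1::real)) ` s"
    using t(1,2) by (metis finite_subset_image)
  have "(x, 1) = (\<Sum>a\<in>s. r (a, 1) *\<^sub>R (a, 1::real))"
    using t(3) unfolding s(3) by (subst (asm) sum.reindex) (auto simp: inj_on_def)
  then have "x = (\<Sum>a\<in>s. r (a, 1) *\<^sub>R a)" "1 = (\<Sum>a\<in>s. r (a, 1))"
    by (auto simp: prod_eq_iff fst_sum snd_sum)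
  moreover then have "s \<noteq> {}" by auto
  ultimately show "x \<in> L" using assms s
    by (auto simp: affine)
qed

lemma inj_on_cone_span: "inj_on cone_span (affine_planes n)"
proof (rule inj_onI)
  fix L M :: "'a set"
  assume "L \<in> affine_planes n" "M \<in> affine_planes n" and eq: "cone_span L = cone_span M"
  then have "affine L" "affine M" by (auto simp: affine_planes_def)
  then have "L = {x. (x, 1) \<in> cone_span L}" by (simp only: cone_span_slice)
  also have "\<dots> = M" using \<open>affine M\<close> by (simp only: eq cone_span_slice)
  finally show "L = M" .
qed

lemma dim_cone_span:
  fixes L :: "'a::euclidean_space set"
  assumes "L \<in> affine_planes n"
  shows "dim (cone_span L) = Suc n"
proof -
  have L: "affine L" "aff_dim L = int n" using assms by (auto simp: affine_planes_def)
  obtain B where B: "B \<subseteq> L" "\<not> affine_dependent B" "affine hull L = affine hull B"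
     "int (card B) = aff_dim L + 1"
    using aff_dim_basis_exists[of L] affine_basis_exists[of L]
    by (metis aff_dim_affine_hull aff_dim_unique add_diff_cancel_right' diff_add_cancel affine_independent_iff_card)
  have cB: "card B = Suc n" using B(4) L by auto
  let ?h = "\<lambda>x::'a. (x, 1::real)"
  have fin: "finite B" using cB card.infinite by fastforce
  have inj: "inj_on ?h S" for S by (auto simp: inj_on_def)
  have ind: "independent (?h ` B)"
  proof
    assume "dependent (?h ` B)"
    then obtain u where u: "\<exists>v\<in>?h ` B. u v \<noteq> 0" "(\<Sum>v\<in>?h ` B. u v *\<^sub>R v) = 0"
      using fin dependent_finite[of "?h ` B"] by auto
    have "(\<Sum>a\<in>B. u (a,1) *\<^sub>R (a, 1::real)) = 0"
      using u(2) by (subst (asm) sum.reindex) (auto simp: inj)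
    then have "(\<Sum>a\<in>B. u (a,1) *\<^sub>R a) = 0" "(\<Sum>a\<in>B. u (a,1)) = 0"
      by (auto simp: prod_eq_iff fst_sum snd_sum)
    then have "affine_dependent B"
      using u(1) fin by (auto simp: affine_dependent_explicit_finite intro!: exI[of _ "\<lambda>a. u (a,1)"])
    with B(2) show False by simp
  qed
  have "?h ` L \<subseteq> span (?h ` B)"
  proof
    fix z assume "z \<in> ?h ` L"
    then obtain x where x: "x \<in> affine hull B" "z = (x, 1)"
      using B(3) hull_inc by fastforce
    then obtain u where u: "sum u B = 1" "(\<Sum>v\<in>B. u v *\<^sub>R v) = x"
      using fin by (auto simp: affine_hull_finite)
    have "z = (\<Sum>v\<in>B. u v *\<^sub>R (v, 1::real))"
      using u x by (auto simp: prod_eq_iff fst_sum snd_sum)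
    moreover have "(\<Sum>v\<in>B. u v *\<^sub>R (v, 1::real)) \<in> span (?h ` B)"
      by (intro span_sum span_scale span_base imageI)
    ultimately show "z \<in> span (?h ` B)" by simp
  qed
  then have "span (?h ` L) = span (?h ` B)"
    using B(1) by (metis image_mono span_eq span_superset subset_trans)
  then show ?thesis
    using dim_eq_card_independent[OF ind] card_image[OF inj] cB
    by (metis cone_span_def dim_span)
qed

lemma topspace_affine_plane_space: "topspace (affine_plane_space n) = affine_planes n"
  by (auto simp: affine_plane_space_def topspace_pullback_topology topspace_grassmannian
      dim_cone_span) (simp add: cone_span_def)

section \<open>Reduced singular homology with coefficients\<close>

text \<open>\<open>HOL-Homology\<close> treats integer coefficients only. Here a chain with coefficients in \<open>'g\<close> is
  a finitely supported \<open>'g\<close>-valued function on the singular simplices of the library.\<close>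

type_synonym ('a, 'g) coeff_chain = "((nat \<Rightarrow> real) \<Rightarrow> 'a) \<Rightarrow>\<^sub>0 'g"

definition coeff_chains :: "nat \<Rightarrow> 'a topology \<Rightarrow> ('a, 'g::ab_group_add) coeff_chain set" where
  "coeff_chains p X = {c. Poly_Mapping.keys c \<subseteq> singular_simplex_set p X}"

definition coeff_boundary ::
  "nat \<Rightarrow> ('a, 'g::ab_group_add) coeff_chain \<Rightarrow> ('a, 'g) coeff_chain" where
  "coeff_boundary p c =
     (\<Sum>f\<in>Poly_Mapping.keys c. \<Sum>k\<le>p.
        Poly_Mapping.single (singular_face p k f)
          (if even k then Poly_Mapping.lookup c f else - Poly_Mapping.lookup c f))"

definition augmentation :: "('a, 'g::ab_group_add) coeff_chain \<Rightarrow> 'g" where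
  "augmentation c = (\<Sum>f\<in>Poly_Mapping.keys c. Poly_Mapping.lookup c f)"

text \<open>Homology of the augmented chain complex: in degree 0 the cycles are the kernel of the
  augmentation, and the degree-0 group of the empty space is trivial.\<close>

definition reduced_cycles :: "nat \<Rightarrow> 'a topology \<Rightarrow> ('a, 'g::ab_group_add) coeff_chain set" where
  "reduced_cycles p X =
     {c \<in> coeff_chains p X. if p = 0 then augmentation c = 0 else coeff_boundary p c = 0}"

definition coeff_boundaries :: "nat \<Rightarrow> 'a topology \<Rightarrow> ('a, 'g::ab_group_add) coeff_chain set" where
  "coeff_boundaries p X = coeff_boundary (Suc p) ` coeff_chains (Suc p) X"

definition reduced_cycle_group ::
  "nat \<Rightarrow> 'a topology \<Rightarrow> ('a, 'g::ab_group_add) coeff_chain monoid" where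
  "reduced_cycle_group p X = \<lparr>carrier = reduced_cycles p X, mult = (+), one = 0\<rparr>"

definition reduced_coeff_homology_group ::
  "nat \<Rightarrow> 'a topology \<Rightarrow> ('a, 'g::ab_group_add) coeff_chain set monoid" where
  "reduced_coeff_homology_group p X = reduced_cycle_group p X Mod coeff_boundaries p X"

definition homologically_connected :: "'g::ab_group_add itself \<Rightarrow> 'a topology \<Rightarrow> bool" where
  "homologically_connected _ X \<longleftrightarrow>
     trivial_group
       (reduced_coeff_homology_group 0 X :: ('a, 'g) coeff_chain set monoid)"

lemma coeff_boundary_superset:
  assumes "finite S" "Poly_Mapping.keys c \<subseteq> S"
  shows "coeff_boundary p c = (\<Sum>f\<in>S. \<Sum>k\<le>p.
        Poly_Mapping.single (singular_face p k f)
          (if even k then Poly_Mapping.lookup c f else - Poly_Mapping.lookup c f))"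
  unfolding coeff_boundary_def
  by (rule sum.mono_neutral_left) (use assms in \<open>auto simp: in_keys_iff intro!: sum.neutral\<close>)

lemma augmentation_superset:
  assumes "finite S" "Poly_Mapping.keys c \<subseteq> S"
  shows "augmentation c = (\<Sum>f\<in>S. Poly_Mapping.lookup c f)"
  unfolding augmentation_def
  by (rule sum.mono_neutral_left) (use assms in \<open>auto simp: in_keys_iff\<close>)

lemma coeff_boundary_add: "coeff_boundary p (a + b) = coeff_boundary p a + coeff_boundary p b"
proof -
  let ?S = "Poly_Mapping.keys a \<union> Poly_Mapping.keys b"
  have "Poly_Mapping.keys (a + b) \<subseteq> ?S" by (rule keys_add)
  then show ?thesis
    by (subst (1 2 3) coeff_boundary_superset[of ?S])
       (auto simp: lookup_add single_add[symmetric] sum.distrib[symmetric] intro!: sum.cong)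
qed

lemma augmentation_add: "augmentation (a + b) = augmentation a + augmentation b"
proof -
  let ?S = "Poly_Mapping.keys a \<union> Poly_Mapping.keys b"
  have "Poly_Mapping.keys (a + b) \<subseteq> ?S" by (rule keys_add)
  then show ?thesis
    by (subst (1 2 3) augmentation_superset[of ?S])
       (auto simp: lookup_add sum.distrib[symmetric] intro!: sum.cong)
qed


lemma cone_span_image:
  "cone_span ` affine_planes n =
     {V. subspace V \<and> dim V = Suc n \<and> (\<exists>v\<in>V. snd v \<noteq> (0::real))}"
proof (intro equalityI subsetI)
  fix V :: "('a \<times> real) set" assume "V \<in> cone_span ` affine_planes n"
  then obtain L where L: "L \<in> affine_planes n" "V = cone_span L" by auto
  then have "L \<noteq> {}" by (auto simp: affine_planes_def)
  then obtain x where "x \<in> L" by auto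
  then have "(x, 1) \<in> V" by (auto simp: L cone_span_def span_base)
  moreover have "subspace V" by (simp add: L cone_span_def)
  ultimately show "V \<in> {V. subspace V \<and> dim V = Suc n \<and> (\<exists>v\<in>V. snd v \<noteq> 0)}"
    using dim_cone_span[OF L(1)] L(2) by force
next
  fix V :: "('a \<times> real) set"
  assume "V \<in> {V. subspace V \<and> dim V = Suc n \<and> (\<exists>v\<in>V. snd v \<noteq> 0)}"
  then obtain v where V: "subspace V" "dim V = Suc n" "v \<in> V" "snd v \<noteq> 0" by auto
  define L where "L = {x. (x, 1::real) \<in> V}"
  have aff: "affine L" unfolding affine_def L_def
  proof clarsimp
    fix x y :: 'a and a b :: real
    assume *: "(x, 1) \<in> V" "(y, 1) \<in> V" "a + b = 1"
    have "a *\<^sub>R (x, 1::real) + b *\<^sub>R (y, 1) \<in> V"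
      using V(1) * by (intro subspace_add subspace_scale)
    then show "(a *\<^sub>R x + b *\<^sub>R y, 1) \<in> V" using *(3) by simp
  qed
  define w where "w = (1 / snd v) *\<^sub>R v"
  have w: "w \<in> V" "snd w = 1" using V by (auto simp: w_def subspace_scale)
  have sub: "cone_span L \<subseteq> V"
    unfolding cone_span_def using V(1) by (intro span_minimal) (auto simp: L_def)
  have base: "u \<in> cone_span L" if "u \<in> V" "snd u = 1" for u
    using that unfolding cone_span_def L_def by (intro span_base) (cases u, auto)
  have "V \<subseteq> cone_span L"
  proof
    fix u assume u: "u \<in> V"
    have "u + (1 - snd u) *\<^sub>R w \<in> cone_span L"
      using u w V(1) by (intro base) (auto intro: subspace_add subspace_scale)
    moreover have "(1 - snd u) *\<^sub>R w \<in> cone_span L"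
      using base[OF w] unfolding cone_span_def by (rule span_scale)
    ultimately have "(u + (1 - snd u) *\<^sub>R w) - (1 - snd u) *\<^sub>R w \<in> cone_span L"
      unfolding cone_span_def by (rule span_diff)
    then show "u \<in> cone_span L" by simp
  qed
  with sub have eq: "cone_span L = V" by auto
  have "fst w \<in> L" using w by (cases w) (auto simp: L_def)
  then have "aff_dim L \<ge> 0" by (smt (verit) aff_dim_empty aff_dim_geq empty_iff)
  then obtain m where "aff_dim L = int m" using nonneg_int_cases by blast
  then have L: "L \<in> affine_planes m" by (simp add: affine_planes_def aff)
  then have "m = n" using dim_cone_span[OF L] eq V(2) by simp
  then show "V \<in> cone_span ` affine_planes n" using L eq by auto
qed

lemma openin_cone_span_image:
  "openin (grassmannian (Suc n)) (cone_span ` affine_planes n :: ('a::euclidean_space \<times> real) set set)"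
proof -
  let ?W = "cone_span ` affine_planes n :: ('a \<times> real) set set"
  let ?X = "frame_space (Suc n) :: (nat \<Rightarrow> 'a \<times> real) topology"
  have iff: "span (v ` {..<Suc n}) \<in> ?W \<longleftrightarrow> (\<exists>i<Suc n. snd (v i) \<noteq> 0)"
    if "v \<in> topspace ?X" for v
  proof -
    have ind: "inj_on v {..<Suc n}" "independent (v ` {..<Suc n})"
      using that by (auto simp: topspace_frame_space)
    have "dim (span (v ` {..<Suc n})) = Suc n"
      using ind by (simp add: dim_eq_card_independent card_image)
    moreover have "(\<exists>u\<in>span (v ` {..<Suc n}). snd u \<noteq> 0) \<longleftrightarrow> (\<exists>i<Suc n. snd (v i) \<noteq> 0)"
    proof
      assume "\<exists>i<Suc n. snd (v i) \<noteq> 0"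
      then show "\<exists>u\<in>span (v ` {..<Suc n}). snd u \<noteq> 0" by (meson image_eqI lessThan_iff span_base)
    next
      assume l: "\<exists>u\<in>span (v ` {..<Suc n}). snd u \<noteq> 0"
      show "\<exists>i<Suc n. snd (v i) \<noteq> 0"
      proof (rule ccontr)
        assume "\<not> ?thesis"
        then have "v ` {..<Suc n} \<subseteq> {u. snd u = 0}" by auto
        moreover have "subspace {u :: 'a \<times> real. snd u = 0}" by (auto simp: subspace_def)
        ultimately have "span (v ` {..<Suc n}) \<subseteq> {u. snd u = 0}" by (rule span_minimal)
        then show False using l by auto
      qed
    qed
    ultimately show ?thesis by (auto simp: cone_span_image)
  qed
  have "openin ?X {v \<in> topspace ?X. v i \<in> {u. snd u \<noteq> 0}}" if "i < Suc n" for i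
  proof (rule openin_continuous_map_preimage)
    show "continuous_map ?X euclidean (\<lambda>v. v i)"
      unfolding frame_space_def using that
      by (intro continuous_map_from_subtopology continuous_map_product_projection) auto
    show "openin euclidean {u :: 'a \<times> real. snd u \<noteq> 0}"
      by (simp add: open_Collect_neq continuous_on_snd)
  qed
  then have "openin ?X (\<Union>i<Suc n. {v \<in> topspace ?X. v i \<in> {u. snd u \<noteq> 0}})" by auto
  also have "(\<Union>i<Suc n. {v \<in> topspace ?X. v i \<in> {u. snd u \<noteq> 0}}) =
      {v \<in> topspace ?X. \<exists>i<Suc n. snd (v i) \<noteq> 0}"
    by auto
  also have "\<dots> = {v \<in> topspace ?X. span (v ` {..<Suc n}) \<in> ?W}"
    using iff by (intro Collect_cong conj_cong refl) simp
  finally have "openin ?X {v \<in> topspace ?X. span (v ` {..<Suc n}) \<in> ?W}" .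
  moreover have "?W \<subseteq> topspace (grassmannian (Suc n))"
    by (auto simp: topspace_grassmannian cone_span_image)
  ultimately show ?thesis
    by (simp add: grassmannian_def openin_quotient_topology topspace_quotient_topology)
qed

lemma embedding_map_cone_span:
  "embedding_map (affine_plane_space n) (grassmannian (Suc n))
     (cone_span :: 'a::euclidean_space set \<Rightarrow> _)"
proof -
  have "open_map (affine_plane_space n) (grassmannian (Suc n)) (cone_span :: 'a set \<Rightarrow> _)"
    unfolding open_map_def
  proof (intro allI impI)
    fix S :: "'a set set" assume "openin (affine_plane_space n) S"
    then obtain U where U: "openin (grassmannian (Suc n)) U" "S = cone_span -` U \<inter> affine_planes n"
      by (auto simp: affine_plane_space_def openin_pullback_topology)
    have "cone_span ` S = U \<inter> cone_span ` affine_planes n" using U(2) by auto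
    then show "openin (grassmannian (Suc n)) (cone_span ` S)"
      using openin_Int[OF U(1) openin_cone_span_image] by simp
  qed
  moreover have "continuous_map (affine_plane_space n) (grassmannian (Suc n)) (cone_span :: 'a set \<Rightarrow> _)"
    unfolding continuous_map
  proof (intro conjI allI impI)
    show "cone_span ` topspace (affine_plane_space n) \<subseteq> topspace (grassmannian (Suc n) :: ('a \<times> real) set topology)"
      by (auto simp: affine_plane_space_def topspace_pullback_topology)
  next
    fix U :: "('a \<times> real) set set" assume "openin (grassmannian (Suc n)) U"
    moreover have "{L \<in> topspace (affine_plane_space n). cone_span L \<in> U} = cone_span -` U \<inter> affine_planes n"
      by (auto simp: topspace_affine_plane_space)
    ultimately show "openin (affine_plane_space n) {L \<in> topspace (affine_plane_space n). cone_span L \<in> U}"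
      by (auto simp: affine_plane_space_def openin_pullback_topology)
  qed
  ultimately show ?thesis
    by (intro injective_open_imp_embedding_map) (auto simp: topspace_affine_plane_space inj_on_cone_span)
qed

lemma coeff_boundary_zero: "coeff_boundary p 0 = 0"
  by (simp add: coeff_boundary_def)

lemma augmentation_zero: "augmentation 0 = 0"
  by (simp add: augmentation_def)

lemma coeff_boundary_minus: "coeff_boundary p (- a) = - coeff_boundary p a"
  using coeff_boundary_add[of p a "- a"] by (simp add: coeff_boundary_zero eq_neg_iff_add_eq_0 add.commute)

lemma augmentation_minus: "augmentation (- a) = - augmentation a"
  using augmentation_add[of a "- a"] by (simp add: augmentation_zero eq_neg_iff_add_eq_0 add.commute)

lemma coeff_chains_closed:
  "0 \<in> coeff_chains p X"
  "a \<in> coeff_chains p X \<Longrightarrow> b \<in> coeff_chains p X \<Longrightarrow> a + b \<in> coeff_chains p X"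
  "a \<in> coeff_chains p X \<Longrightarrow> - a \<in> coeff_chains p X"
  using keys_add[of a b] by (auto simp: coeff_chains_def in_keys_iff subset_iff)

lemma comm_group_reduced_cycle_group: "comm_group (reduced_cycle_group p X)"
proof (rule comm_groupI)
  fix x assume "x \<in> carrier (reduced_cycle_group p X)"
  then show "\<exists>y\<in>carrier (reduced_cycle_group p X). y \<otimes>\<^bsub>reduced_cycle_group p X\<^esub> x = \<one>\<^bsub>reduced_cycle_group p X\<^esub>"
    by (intro bexI[of _ "- x"])
       (auto simp: reduced_cycle_group_def reduced_cycles_def coeff_chains_closed
          augmentation_minus coeff_boundary_minus split: if_splits)
qed (auto simp: reduced_cycle_group_def reduced_cycles_def coeff_chains_closed augmentation_add
       coeff_boundary_add augmentation_zero coeff_boundary_zero add.assoc add.commute split: if_splits)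

lemma augmentation_single: "augmentation (Poly_Mapping.single f g) = g"
  by (subst augmentation_superset[of "{f}"]) auto

lemma augmentation_sum: "augmentation (sum h I) = (\<Sum>i\<in>I. augmentation (h i))"
  by (induction I rule: infinite_finite_induct) (auto simp: augmentation_add augmentation_zero)

lemma augmentation_coeff_boundary: "augmentation (coeff_boundary (Suc 0) c) = 0"
  by (simp add: coeff_boundary_def augmentation_sum augmentation_add augmentation_single)

lemma coeff_boundary_in_chains:
  assumes "c \<in> coeff_chains (Suc p) X" shows "coeff_boundary (Suc p) c \<in> coeff_chains p X"
proof -
  have sumc: "(\<And>i. i \<in> I \<Longrightarrow> h i \<in> coeff_chains p X) \<Longrightarrow> sum h I \<in> coeff_chains p X"
    for h :: "'i \<Rightarrow> ('a, 'b) coeff_chain" and I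
    by (induction I rule: infinite_finite_induct) (auto simp: coeff_chains_closed)
  have s: "Poly_Mapping.single (singular_face (Suc p) k f) g \<in> coeff_chains p X"
    if "k \<le> Suc p" "f \<in> Poly_Mapping.keys c" for k f and g :: 'b
    using that assms singular_simplex_singular_face[of "Suc p" X f k]
    by (auto simp: coeff_chains_def split: if_splits)
  show ?thesis
    unfolding coeff_boundary_def by (intro sumc s) auto
qed

lemma coeff_boundary_single:
  "coeff_boundary p (Poly_Mapping.single f g) =
     (\<Sum>k\<le>p. Poly_Mapping.single (singular_face p k f) (if even k then g else - g))"
  by (subst coeff_boundary_superset[of "{f}"]) (auto cong: if_cong)

lemma coeff_boundary_sum: "coeff_boundary p (sum h I) = (\<Sum>i\<in>I. coeff_boundary p (h i))"
  by (induction I rule: infinite_finite_induct) (auto simp: coeff_boundary_add coeff_boundary_zero)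

lemma singular_face_singular_face:
  assumes "0 < p" "i \<le> j" "j \<le> p"
  shows "singular_face p i (singular_face (Suc p) (Suc j) f) =
         singular_face p j (singular_face (Suc p) i f)"
proof (rule ext)
  fix t
  show "singular_face p i (singular_face (Suc p) (Suc j) f) t =
        singular_face p j (singular_face (Suc p) i f) t"
  proof (cases "t \<in> standard_simplex (p - Suc 0)")
    case True
    have "simplical_face i t \<in> standard_simplex p" "simplical_face j t \<in> standard_simplex p"
      using True assms by (auto intro!: simplical_face_in_standard_simplex)
    moreover have "simplical_face (Suc j) (simplical_face i t) = simplical_face i (simplical_face j t)"
      using True assms unfolding standard_simplex_def simplical_face_def by fastforce
    ultimately show ?thesis by (simp add: singular_face_def)
  qed (simp add: singular_face_def)
qed

lemma coeff_boundary_boundary: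
  assumes "0 < p"
  shows "coeff_boundary p (coeff_boundary (Suc p) c) = 0"
proof -
  have "(\<Sum>k\<le>Suc p. \<Sum>i\<le>p. Poly_Mapping.single (singular_face p i (singular_face (Suc p) k f))
          (if even (k + i) then g else - g)) = 0" (is "(\<Sum>k\<le>Suc p. \<Sum>i\<le>p. ?T k i) = 0")
    for f :: "(nat \<Rightarrow> real) \<Rightarrow> 'a" and g :: 'b
  proof -
    let ?D = "{(i, j). i \<le> j \<and> j \<le> p}"
    have eql: "{..Suc p} \<times> {..p} \<inter> {(x, y). y < x} = (\<lambda>(i, j). (Suc j, i)) ` ?D"
    proof -
      have "(k, i) \<in> (\<lambda>(i, j). (Suc j, i)) ` ?D" if "k \<le> Suc p" "i < k" for k i
        using that by (intro image_eqI[of _ _ "(i, k - 1)"]) auto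
      then show ?thesis by auto
    qed
    have eqr: "{..Suc p} \<times> {..p} - {(x, y). y < x} = ?D" by auto
    have inj: "inj_on (\<lambda>(i, j). (Suc j, i)) ?D" by (auto simp: inj_on_def)
    have neg: "?T (Suc j) i = - ?T i j" if "i \<le> j" "j \<le> p" for i j
      using singular_face_singular_face[OF assms that, of f]
      by (auto simp: single_uminus add.commute)
    have "(\<Sum>k\<le>Suc p. \<Sum>i\<le>p. ?T k i) = (\<Sum>(k, i)\<in>{..Suc p} \<times> {..p}. ?T k i)"
      by (rule sum.cartesian_product)
    also have "\<dots> = (\<Sum>(k, i)\<in>{..Suc p} \<times> {..p} \<inter> {(x, y). y < x}. ?T k i) +
                    (\<Sum>(k, i)\<in>{..Suc p} \<times> {..p} - {(x, y). y < x}. ?T k i)"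
      by (rule sum.Int_Diff) simp
    also have "\<dots> = (\<Sum>(i, j)\<in>?D. ?T (Suc j) i) + (\<Sum>(i, j)\<in>?D. ?T i j)"
      unfolding eql eqr by (subst sum.reindex[OF inj]) (auto simp: case_prod_unfold o_def intro!: sum.cong)
    also have "(\<Sum>(i, j)\<in>?D. ?T (Suc j) i) = (\<Sum>(i, j)\<in>?D. - ?T i j)"
      by (intro sum.cong refl) (clarify, rule neg)
    also have "\<dots> + (\<Sum>(i, j)\<in>?D. ?T i j) = 0"
      by (simp add: case_prod_unfold sum_negf)
    finally show ?thesis .
  qed
  note * = this
  have **: "coeff_boundary p (Poly_Mapping.single (singular_face (Suc p) k f) (if even k then g else - g)) =
      (\<Sum>i\<le>p. Poly_Mapping.single (singular_face p i (singular_face (Suc p) k f))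
          (if even (k + i) then g else - g))" for k f and g :: 'b
    unfolding coeff_boundary_single by (intro sum.cong refl) auto
  have "coeff_boundary p (coeff_boundary (Suc p) c) =
      (\<Sum>f\<in>Poly_Mapping.keys c. \<Sum>k\<le>Suc p. coeff_boundary p
        (Poly_Mapping.single (singular_face (Suc p) k f)
          (if even k then Poly_Mapping.lookup c f else - Poly_Mapping.lookup c f)))"
    unfolding coeff_boundary_def[of "Suc p"] coeff_boundary_sum ..
  also have "\<dots> = (\<Sum>f\<in>Poly_Mapping.keys c. 0)"
    unfolding ** by (rule sum.cong[OF refl], rule *)
  finally show ?thesis by simp
qed

lemma subgroup_coeff_boundaries:
  "subgroup (coeff_boundaries p X) (reduced_cycle_group p X :: ('a, 'g::ab_group_add) coeff_chain monoid)"
proof -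
  interpret comm_group "reduced_cycle_group p X :: ('a, 'g) coeff_chain monoid" by (rule comm_group_reduced_cycle_group)
  let ?Z = "reduced_cycle_group p X :: ('a, 'g) coeff_chain monoid"
  let ?B = "coeff_boundaries p X :: ('a, 'g) coeff_chain set"
  have sub: "coeff_boundaries p X \<subseteq> (reduced_cycles p X :: ('a, 'g) coeff_chain set)"
    by (auto simp: coeff_boundaries_def reduced_cycles_def augmentation_coeff_boundary
        coeff_boundary_boundary coeff_boundary_in_chains)
  show ?thesis
  proof (rule subgroupI)
    show "?B \<noteq> {}"
      using coeff_chains_closed(1) by (auto simp: coeff_boundaries_def)
    show "?B \<subseteq> carrier ?Z"
      using sub by (simp add: reduced_cycle_group_def)
  next
    fix a :: "('a, 'g) coeff_chain" assume a: "a \<in> coeff_boundaries p X"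
    then obtain c where c: "c \<in> coeff_chains (Suc p) X" "a = coeff_boundary (Suc p) c"
      by (auto simp: coeff_boundaries_def)
    then have ma: "- a \<in> coeff_boundaries p X"
      unfolding coeff_boundaries_def
      by (intro image_eqI[of _ _ "- c"]) (simp_all add: coeff_boundary_minus coeff_chains_closed)
    have "inv\<^bsub>?Z\<^esub> a = - a"
      by (rule inv_equality) (use a ma sub in \<open>auto simp: reduced_cycle_group_def\<close>)
    with ma show "inv\<^bsub>?Z\<^esub> a \<in> ?B" by simp
  next
    fix a b :: "('a, 'g) coeff_chain" assume "a \<in> coeff_boundaries p X" "b \<in> coeff_boundaries p X"
    then obtain c d where "c \<in> coeff_chains (Suc p) X" "a = coeff_boundary (Suc p) c"
        "d \<in> coeff_chains (Suc p) X" "b = coeff_boundary (Suc p) d"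
      by (auto simp: coeff_boundaries_def)
    then have "a + b \<in> coeff_boundaries p X"
      unfolding coeff_boundaries_def
      by (intro image_eqI[of _ _ "c + d"]) (simp_all add: coeff_boundary_add coeff_chains_closed)
    then show "a \<otimes>\<^bsub>?Z\<^esub> b \<in> ?B"
      by (simp add: reduced_cycle_group_def)
  qed
qed

lemma group_reduced_coeff_homology_group: "group (reduced_coeff_homology_group p X)"
  unfolding reduced_coeff_homology_group_def
  by (intro normal.factorgroup_is_group comm_group.normal_iff_subgroup[THEN iffD2]
      comm_group_reduced_cycle_group subgroup_coeff_boundaries)

lemma trivial_reduced_coeff_homology_group_iff:
  "trivial_group (reduced_coeff_homology_group p X :: ('a, 'g::ab_group_add) coeff_chain set monoid) \<longleftrightarrow>
     (reduced_cycles p X :: ('a, 'g) coeff_chain set) \<subseteq> coeff_boundaries p X"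
proof -
  let ?Z = "reduced_cycle_group p X :: ('a, 'g) coeff_chain monoid"
  let ?B = "coeff_boundaries p X :: ('a, 'g) coeff_chain set"
  interpret comm_group ?Z by (rule comm_group_reduced_cycle_group)
  have B: "subgroup ?B ?Z" by (rule subgroup_coeff_boundaries)
  have Z: "carrier ?Z = reduced_cycles p X" by (simp add: reduced_cycle_group_def)
  have "trivial_group (reduced_coeff_homology_group p X :: ('a, 'g) coeff_chain set monoid) \<longleftrightarrow>
        rcosets\<^bsub>?Z\<^esub> ?B = {?B}"
    using group_reduced_coeff_homology_group[where 'b='g, of p X]
    by (simp add: trivial_group_def reduced_coeff_homology_group_def FactGroup_def)
  also have "\<dots> \<longleftrightarrow> carrier ?Z \<subseteq> ?B"
  proof
    assume "rcosets\<^bsub>?Z\<^esub> ?B = {?B}"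
    then show "carrier ?Z \<subseteq> ?B"
      using rcosets_part_G[OF B] by auto
  next
    assume sub: "carrier ?Z \<subseteq> ?B"
    then have "?B #>\<^bsub>?Z\<^esub> a = ?B" if "a \<in> carrier ?Z" for a
      using that coset_join2[OF that B] by auto
    moreover have "\<one>\<^bsub>?Z\<^esub> \<in> carrier ?Z" by simp
    ultimately show "rcosets\<^bsub>?Z\<^esub> ?B = {?B}"
      unfolding RCOSETS_def by blast
  qed
  finally show ?thesis by (simp add: Z)
qed

end

theory Submission
  imports Defs "HOL-Complex_Analysis.Riemann_Mapping"
begin

text \<open>
  Connectedness of the transversal spaces of four sets makes the order in which a line meets the sets
  consistent over the whole family, so lines can be oriented coherently and are described by their
  directions. For a subfamily \<open>H\<close> let \<open>E H\<close> be the open cone of directions of oriented lines meeting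
  all of \<open>H\<close>. For two sets \<open>E H\<close> is convex; for three sets it is contractible, since both the
  points of the middle set and the directions through such a point form convex sets; for more sets it is
  contractible as soon as it is connected, being an intersection of simply connected plane regions by
  Helly's theorem in the plane of lines of a given direction.

  By induction on \<open>card H\<close> all the \<open>E H\<close> with at least four sets are nonempty and connected.
  If \<open>E H\<close> were empty, then, the \<open>E H'\<close> of the proper subfamilies being absolute retracts, one could build
  a map from the boundary \<open>S\<^sup>4\<close> of a 5-simplex to the space of oriented lines that sends each face to lines
  meeting all sets outside the face. The gap functions of the sets map the image back to
  \<open>\<real>\<^sup>5 - {0}\<close>, and the composition is homotopic to the antipodal map. But the space of oriented lines
  is a hypersurface in \<open>\<real>\<^sup>5\<close> no compact part of which separates, so by Borsuk's separation theorem every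
  such map is nullhomotopic. If \<open>E H\<close> were disconnected, the same argument applies to the suspension of
  the boundary of a 4-simplex whose poles go to the two parts.
\<close>

text \<open>Oriented lines of 3-space form a 4-dimensional space, placed here in 5-space, so the
  topological argument needs a 4-sphere: the boundary of a simplex on six vertices, or the
  suspension of one on five. Hence lines for five sets and connectedness for four are the data to
  start from. In a larger family the members not chosen as vertices are demanded of every line.

  Four and five also serve the orientation: connectedness for four sets fixes whether lines meet two
  pairs in the same sense, and two quadruples with three common members are compared on a line
  meeting the at most five members of their union.

  The spheres are first built in the space of directions. For a given direction the admissible base
  points form a convex set, so a continuous choice of directions lifts to lines by a partition of
  unity. Contractibility of a direction cone for at least four sets is a planar matter: no loop in a
  plane section of it winds around a missing direction, because a larger contractible cone already
  misses that direction; only connectedness remains, and the induction provides it.\<close>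

section \<open>Extension and selection of continuous maps\<close>

text \<open>Values that are admissible on a whole neighbourhood are averaged by a partition of
  unity. At \<open>x\<close> only those \<open>W\<close> carry weight that contain \<open>x\<close>,
  so all averaged values lie in \<open>C x\<close>, and convexity keeps the mean there.\<close>

lemma convex_valued_selection:
  fixes S :: "'a::euclidean_space set" and C :: "'a \<Rightarrow> 'b::euclidean_space set"
  assumes cvx: "\<And>x. x \<in> S \<Longrightarrow> convex (C x)"
    and loc: "\<And>x. x \<in> S \<Longrightarrow> \<exists>y U. open U \<and> x \<in> U \<and> (\<forall>x'\<in>S \<inter> U. y \<in> C x')"
  obtains f where "continuous_on S f" "\<And>x. x \<in> S \<Longrightarrow> f x \<in> C x"
proof -
  define \<U> where "\<U> = {U. open U \<and> (\<exists>y. \<forall>x\<in>S \<inter> U. y \<in> C x)}"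
  have cov: "S \<subseteq> \<Union>\<U>" using loc unfolding \<U>_def by blast
  obtain \<W> where \<W>: "S \<subseteq> \<Union>\<W>" "\<And>U. U \<in> \<W> \<Longrightarrow> open U \<and> (\<exists>T. T \<in> \<U> \<and> U \<subseteq> T)"
    and lf: "\<And>x. x \<in> S \<Longrightarrow> \<exists>V. open V \<and> x \<in> V \<and> finite {U. U \<in> \<W> \<and> U \<inter> V \<noteq> {}}"
    using paracompact[OF cov] unfolding \<U>_def by (smt (verit) mem_Collect_eq)
  have "\<exists>y. \<forall>x\<in>S \<inter> W. y \<in> C x" if "W \<in> \<W>" for W
    using \<W>(2)[OF that] unfolding \<U>_def by blast
  then obtain a where a: "\<And>W x. W \<in> \<W> \<Longrightarrow> x \<in> S \<Longrightarrow> x \<in> W \<Longrightarrow> a W \<in> C x"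
    by (metis IntI)
  obtain p :: "['a set, 'a] \<Rightarrow> real"
    where p: "\<And>U. U \<in> \<W> \<Longrightarrow> continuous_on S (p U) \<and> (\<forall>x \<in> S. 0 \<le> p U x)"
      and p0: "\<And>x U. \<lbrakk>U \<in> \<W>; x \<in> S; x \<notin> U\<rbrakk> \<Longrightarrow> p U x = 0"
      and p1: "\<And>x. x \<in> S \<Longrightarrow> supp_sum (\<lambda>W. p W x) \<W> = 1"
      and pf: "\<And>x. x \<in> S \<Longrightarrow> \<exists>V. open V \<and> x \<in> V \<and> finite {U \<in> \<W>. \<exists>x\<in>V. p U x \<noteq> 0}"
    using subordinate_partition_of_unity[of S \<W>] \<W> lf by (smt (verit) Collect_cong)
  define f where "f x = (\<Sum>W\<in>{W \<in> \<W>. p W x \<noteq> 0}. p W x *\<^sub>R a W)" for x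
  have fin: "finite {W \<in> \<W>. p W x \<noteq> 0}" if x: "x \<in> S" for x
  proof -
    obtain V where "x \<in> V" "finite {U \<in> \<W>. \<exists>x\<in>V. p U x \<noteq> 0}" using pf[OF x] by blast
    then show ?thesis by (auto elim: finite_subset[rotated])
  qed
  show ?thesis
  proof
    show "f x \<in> C x" if x: "x \<in> S" for x
      unfolding f_def
    proof (rule convex_sum[OF fin[OF x] cvx[OF x]])
      show "sum (\<lambda>W. p W x) {W \<in> \<W>. p W x \<noteq> 0} = 1"
        using p1[OF x] by (simp add: supp_sum_def support_on_def)
      show "a W \<in> C x" if "W \<in> {W \<in> \<W>. p W x \<noteq> 0}" for W
        using that a p0 x by blast
    qed (use p x in auto)
    show "continuous_on S f"
      unfolding continuous_on_eq_continuous_within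
    proof
      fix x assume x: "x \<in> S"
      obtain V where V: "open V" "x \<in> V" and fV: "finite {U \<in> \<W>. \<exists>x\<in>V. p U x \<noteq> 0}"
        using pf[OF x] by blast
      let ?\<F> = "{U \<in> \<W>. \<exists>x\<in>V. p U x \<noteq> 0}"
      have "continuous_on (S \<inter> V) (\<lambda>x. \<Sum>W\<in>?\<F>. p W x *\<^sub>R a W)"
        using p by (intro continuous_intros) (auto intro: continuous_on_subset)
      moreover have "(\<Sum>W\<in>?\<F>. p W x *\<^sub>R a W) = f x" if "x \<in> S \<inter> V" for x
        unfolding f_def using that fV by (intro sum.mono_neutral_right) auto
      ultimately have "continuous_on (S \<inter> V) f" by (rule continuous_on_eq)
      then have "continuous (at x within S \<inter> V) f"
        using x V by (simp add: continuous_on_eq_continuous_within)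
      moreover have "at x within S \<inter> V = at x within S"
        using V by (intro at_within_nhd[of x V]) auto
      ultimately show "continuous (at x within S) f" by simp
    qed
  qed
qed

text \<open>Extension skeleton by skeleton: \<open>W m\<close> holds the points with at most
  \<open>m\<close> inactive members. The sets \<open>Z H\<close> added next meet one another only
  inside \<open>W m\<close>, so the separate extensions into the absolute retracts
  \<open>Y H\<close> fit together. Where all of \<open>G\<close> is active the values come from
  \<open>d0\<close>, since only proper subsets have an absolute retract as target.\<close>

lemma skeletal_extension:
  fixes X :: "'a::euclidean_space set" and Y :: "'i set \<Rightarrow> 'b::euclidean_space set"
  assumes fin: "finite G" and X: "closed X"
    and act: "\<And>x. x \<in> X \<Longrightarrow> act x \<subseteq> G \<and> act x \<noteq> {}"
    and cl: "\<And>i. i \<in> G \<Longrightarrow> closed {x \<in> X. i \<in> act x}"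
    and AR: "\<And>H. H \<subseteq> G \<Longrightarrow> H \<noteq> {} \<Longrightarrow> H \<noteq> G \<Longrightarrow> AR (Y H)"
    and anti: "\<And>H H'. H \<noteq> {} \<Longrightarrow> H \<subseteq> H' \<Longrightarrow> H' \<subseteq> G \<Longrightarrow> Y H' \<subseteq> Y H"
    and d0: "continuous_on {x \<in> X. act x = G} d0" "\<And>x. x \<in> X \<Longrightarrow> act x = G \<Longrightarrow> d0 x \<in> Y G"
  obtains d where "continuous_on X d" "\<And>x. x \<in> X \<Longrightarrow> d x \<in> Y (act x)"
    "\<And>x. x \<in> X \<Longrightarrow> act x = G \<Longrightarrow> d x = d0 x"
proof -
  define Z where "Z H = {x \<in> X. H \<subseteq> act x}" for H
  define W where "W m = {x \<in> X. card G \<le> card (act x) + m}" for m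
  have clZ: "closed (Z H)" if "H \<subseteq> G" for H
  proof -
    have "Z H = X \<inter> (\<Inter>i\<in>H. {x \<in> X. i \<in> act x})" by (auto simp: Z_def)
    then show ?thesis using X cl that by (auto intro!: closed_Int closed_INT)
  qed
  have finact: "finite (act x)" if "x \<in> X" for x using act[OF that] fin finite_subset by blast
  have WZ: "W m = (\<Union>H\<in>{H. H \<subseteq> G \<and> card G \<le> card H + m}. Z H)" for m
    using act finact by (auto simp: W_def Z_def intro: order_trans[OF _ add_right_mono[OF card_mono]])
  have clW: "closed (W m)" for m
    unfolding WZ using fin by (intro closed_UN) (auto simp: clZ)
  have "\<exists>d. continuous_on (W m) d \<and> (\<forall>x\<in>W m. d x \<in> Y (act x)) \<and> (\<forall>x\<in>X. act x = G \<longrightarrow> d x = d0 x)" for m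
  proof (induction m)
    case 0
    have "act x = G" if "x \<in> X" "card G \<le> card (act x)" for x
      using act card_seteq[OF fin] that by blast
    then have "W 0 = {x \<in> X. act x = G}" by (auto simp: W_def)
    then show ?case using d0 by auto
  next
    case (Suc m)
    then obtain d where d: "continuous_on (W m) d" "\<And>x. x \<in> W m \<Longrightarrow> d x \<in> Y (act x)"
       "\<And>x. x \<in> X \<Longrightarrow> act x = G \<Longrightarrow> d x = d0 x" by blast
    show ?case
    \<comment> \<open>As \<open>act x\<close> is nonempty, \<open>card G \<le> Suc m\<close> means
      that \<open>W m\<close> is already all of \<open>X\<close>. Otherwise the members of \<H> are
      nonempty and proper, as \<open>AR\<close> demands.\<close>
    proof (cases "card G \<le> Suc m")
      case True
      have "1 \<le> card (act x)" if "x \<in> X" for x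
        using act[OF that] finact[OF that] by (simp add: card_gt_0_iff Suc_leI)
      then have "W m = X" "W (Suc m) = X" using True by (fastforce simp: W_def)+
      then show ?thesis using d by metis
    next
      case False
      define \<H> where "\<H> = {H. H \<subseteq> G \<and> Suc (card H + m) = card G}"
      have fin\<H>: "finite \<H>" using fin by (auto simp: \<H>_def)
      have \<H>: "H \<subseteq> G" "H \<noteq> {}" "H \<noteq> G" if "H \<in> \<H>" for H
      proof -
        have H: "H \<subseteq> G" "Suc (card H + m) = card G" using that by (simp_all add: \<H>_def)
        show "H \<subseteq> G" by (rule H(1))
        show "H \<noteq> {}" using H(2) False by force
        show "H \<noteq> G" using H(2) by force
      qed
      have "\<exists>e. continuous_on (Z H) e \<and> e ` Z H \<subseteq> Y H \<and> (\<forall>x\<in>Z H \<inter> W m. e x = d x)"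
        if H: "H \<in> \<H>" for H
      proof -
        have "continuous_on (Z H \<inter> W m) d" using d(1) by (rule continuous_on_subset) auto
        moreover have "d ` (Z H \<inter> W m) \<subseteq> Y H"
        proof clarify
          fix x assume x: "x \<in> Z H" "x \<in> W m"
          then show "d x \<in> Y H"
            using d(2)[of x] anti[of H "act x"] \<H>[OF H] act[of x] by (auto simp: Z_def)
        qed
        moreover have "closedin (top_of_set (Z H)) (Z H \<inter> W m)"
          using clW by (simp add: closedin_closed_Int)
        ultimately show ?thesis
          using AR_imp_absolute_extensor[OF AR[OF \<H>[OF H]], of "Z H \<inter> W m" d "Z H"]
          by (metis image_subset_iff)
      qed
      then obtain e where e: "\<And>H. H \<in> \<H> \<Longrightarrow> continuous_on (Z H) (e H)"
        "\<And>H. H \<in> \<H> \<Longrightarrow> e H ` Z H \<subseteq> Y H" "\<And>H x. H \<in> \<H> \<Longrightarrow> x \<in> Z H \<Longrightarrow> x \<in> W m \<Longrightarrow> e H x = d x"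
        by (metis Int_iff)
      define d' where "d' x = (if x \<in> W m then d x else e (act x) x)" for x
      have eq: "act x = H" if "H \<in> \<H>" "x \<in> Z H" "x \<notin> W m" for H x
      proof -
        have "card (act x) \<le> card H" using that by (auto simp: \<H>_def Z_def W_def)
        then show ?thesis using that finact[of x] card_seteq[of "act x" H] by (auto simp: Z_def)
      qed
      have d'e: "d' x = e H x" if "H \<in> \<H>" "x \<in> Z H" for H x
        using eq[OF that] e(3)[OF that] by (auto simp: d'_def)
      have WS: "W (Suc m) = W m \<union> (\<Union>H\<in>\<H>. Z H)"
      proof (intro equalityI subsetI)
        fix x assume x: "x \<in> W (Suc m)"
        show "x \<in> W m \<union> (\<Union>H\<in>\<H>. Z H)"
        proof (cases "x \<in> W m")
          case False
          then have "act x \<in> \<H>" using x act by (auto simp: \<H>_def W_def)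
          then show ?thesis using x by (auto simp: Z_def W_def)
        qed simp
      next
        fix x assume "x \<in> W m \<union> (\<Union>H\<in>\<H>. Z H)"
        then show "x \<in> W (Suc m)"
        proof
          assume "x \<in> (\<Union>H\<in>\<H>. Z H)"
          then obtain H where H: "H \<in> \<H>" "x \<in> X" "H \<subseteq> act x" by (auto simp: Z_def)
          then have "card H \<le> card (act x)" using finact by (simp add: card_mono)
          then show ?thesis using H by (auto simp: \<H>_def W_def)
        qed (auto simp: W_def)
      qed
      have "continuous_on (\<Union>H\<in>\<H>. Z H) d'"
      proof (rule continuous_on_closed_Union[OF fin\<H>])
        show "closed (Z H)" if "H \<in> \<H>" for H using clZ \<H> that by blast
        show "continuous_on (Z H) d'" if "H \<in> \<H>" for H
          using e(1)[OF that] d'e[OF that] by (simp cong: continuous_on_cong)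
      qed
      moreover have "continuous_on (W m) d'"
        using d(1) by (simp add: d'_def cong: continuous_on_cong)
      moreover have "closed (\<Union>H\<in>\<H>. Z H)" using clZ \<H> fin\<H> by (intro closed_UN) auto
      ultimately have "continuous_on (W (Suc m)) d'"
        unfolding WS using clW by (intro continuous_on_closed_Un) auto
      moreover have "d' x \<in> Y (act x)" if x: "x \<in> W (Suc m)" for x
      proof (cases "x \<in> W m")
        case True then show ?thesis using d by (simp add: d'_def)
      next
        case False
        then obtain H where H: "H \<in> \<H>" "x \<in> Z H" using x WS by blast
        then show ?thesis using d'e[OF H] e(2)[OF H(1)] eq[OF H False] by auto
      qed
      moreover have "d' x = d0 x" if "x \<in> X" "act x = G" for x
        using that d(3) by (auto simp: d'_def W_def)
      ultimately show ?thesis by blast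
    qed
  qed
  from this[of "card G"] obtain d where d: "continuous_on (W (card G)) d"
      "\<forall>x\<in>W (card G). d x \<in> Y (act x)" "\<forall>x\<in>X. act x = G \<longrightarrow> d x = d0 x" by blast
  moreover have "W (card G) = X" by (auto simp: W_def)
  ultimately show ?thesis using that by auto
qed

text \<open>Borsuk's theorem concerns maps from \<open>K\<close> into the unit sphere of the space
  around \<open>K\<close>. The isometry \<open>T\<close> carries the target space there, and
  normalising deforms the punctured space to its sphere.\<close>

lemma nullhomotopic_into_punctured_space:
  fixes K :: "'a::euclidean_space set" and \<phi> :: "'a \<Rightarrow> 'b::euclidean_space"
  assumes K: "compact K" "\<And>c. c \<in> components (- K) \<Longrightarrow> \<not> bounded c"
    and dim: "DIM('a) = DIM('b)"
    and \<phi>: "continuous_on K \<phi>" "\<And>x. x \<in> K \<Longrightarrow> \<phi> x \<noteq> 0"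
  shows "\<exists>c. homotopic_with_canon (\<lambda>x. True) K (- {0}) \<phi> (\<lambda>x. c)"
proof -
  obtain T :: "'b \<Rightarrow> 'a" and T' where T: "linear T" "linear T'" "\<And>x. norm (T x) = norm x"
      "\<And>x. norm (T' x) = norm x" "\<And>x. T' (T x) = x" "\<And>x. T (T' x) = x"
    using isomorphisms_UNIV_UNIV[where 'M='b and 'N='a] dim by metis
  define g where "g x = (1 / norm (\<phi> x)) *\<^sub>R T (\<phi> x)" for x
  have contT: "continuous_on UNIV T" "continuous_on UNIV T'"
    using T by (auto intro: linear_continuous_on linear_conv_bounded_linear[THEN iffD1])
  have g: "continuous_on K g" "g \<in> K \<rightarrow> sphere 0 1"
    unfolding g_def using \<phi> T
    by (auto intro!: continuous_intros continuous_on_compose2[OF contT(1)])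
  then obtain c where c: "homotopic_with_canon (\<lambda>x. True) K (sphere 0 1) g (\<lambda>x. c)"
    using Borsuk_separation_theorem_gen[OF K(1)] K(2) by blast
  have T'0: "T' x \<noteq> 0" if "x \<noteq> 0" for x using T(4)[of x] that by (metis norm_eq_zero)
  have "homotopic_with_canon (\<lambda>x. True) K (- {0}) (T' \<circ> g) (T' \<circ> (\<lambda>x. c))"
  proof (rule homotopic_with_compose_continuous_left[OF c])
    show "continuous_on (sphere 0 1) T'" by (rule continuous_on_subset[OF contT(2)]) simp
    have "T' x \<noteq> 0" if "x \<in> sphere 0 1" for x
    proof (rule T'0)
      show "x \<noteq> 0" using that by auto
    qed
    then show "T' \<in> sphere 0 1 \<rightarrow> - {0}" by blast
  qed
  moreover have "homotopic_with_canon (\<lambda>x. True) K (- {0}) \<phi> (T' \<circ> g)"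
  proof (rule homotopic_with_linear[OF \<phi>(1)])
    show "continuous_on K (T' \<circ> g)"
      using g by (intro continuous_on_compose continuous_on_subset[OF contT(2)]) auto
    fix x assume x: "x \<in> K"
    have eq: "T' (g x) = (1 / norm (\<phi> x)) *\<^sub>R \<phi> x" by (simp add: g_def linear_scale[OF T(2)] T)
    have "(1 - u) *\<^sub>R \<phi> x + u *\<^sub>R (T' (g x)) = ((1 - u) + u / norm (\<phi> x)) *\<^sub>R \<phi> x" for u
      by (simp add: eq scaleR_add_left)
    moreover have "(1 - u) + u / norm (\<phi> x) > 0" if "0 \<le> u" "u \<le> 1" for u
    proof (cases "u = 1")
      case False
      then have "1 - u > 0" using that by simp
      then show ?thesis using that by (simp add: add_pos_nonneg)
    qed (use \<phi>(2)[OF x] in simp)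
    ultimately show "closed_segment (\<phi> x) ((T' \<circ> g) x) \<subseteq> - {0}"
      using \<phi>(2)[OF x] by (fastforce simp: closed_segment_def)
  qed
  ultimately have "homotopic_with_canon (\<lambda>x. True) K (- {0}) \<phi> (T' \<circ> (\<lambda>x. c))"
    by (rule homotopic_with_trans[rotated])
  then show ?thesis by (auto simp: comp_def)
qed

text \<open>On the image of \<open>f\<close> the map \<phi> is nullhomotopic, so \<open>B\<close>
  would be nullhomotopic too. Undoing \<open>B\<close> linearly and normalising turns this into a
  contraction of the sphere. An arbitrary injective linear \<open>B\<close> is allowed because the
  two applications end in different maps.\<close>

lemma no_sphere_factorization:
  fixes f :: "'b::euclidean_space \<Rightarrow> 'a::euclidean_space" and \<phi> :: "'a \<Rightarrow> 'b"
  assumes f: "continuous_on (sphere 0 1) f"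
    and unb: "\<And>c. c \<in> components (- f ` sphere 0 1) \<Longrightarrow> \<not> bounded c"
    and dim: "DIM('a) = DIM('b)"
    and \<phi>: "continuous_on (f ` sphere 0 1) \<phi>" "\<And>x. x \<in> sphere 0 1 \<Longrightarrow> \<phi> (f x) \<noteq> 0"
    and B: "linear B" "inj B"
  shows "\<not> homotopic_with_canon (\<lambda>x. True) (sphere 0 1) (- {0}) (\<lambda>x. \<phi> (f x)) B"
proof
  assume hom: "homotopic_with_canon (\<lambda>x. True) (sphere 0 1) (- {0}) (\<lambda>x. \<phi> (f x)) B"
  have "\<exists>c. homotopic_with_canon (\<lambda>x. True) (f ` sphere 0 1) (- {0}) \<phi> (\<lambda>x. c)"
    using f \<phi> by (intro nullhomotopic_into_punctured_space[OF _ unb dim])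
      (auto simp del: mem_sphere intro: compact_continuous_image)
  then obtain c where "homotopic_with_canon (\<lambda>x. True) (f ` sphere 0 1) (- {0}) \<phi> (\<lambda>x. c)" ..
  then have "homotopic_with_canon (\<lambda>x. True) (sphere 0 1) (- {0}) (\<phi> \<circ> f) ((\<lambda>x. c) \<circ> f)"
    using f by (intro homotopic_with_compose_continuous_right[of "\<lambda>x. True"]) auto
  then have Bc: "homotopic_with_canon (\<lambda>x. True) (sphere 0 1) (- {0}) B (\<lambda>x. c)"
    using hom by (simp add: comp_def) (meson homotopic_with_sym homotopic_with_trans)
  obtain B' where B': "linear B'" "\<And>x. B' (B x) = x" "\<And>x. B (B' x) = x"
    using linear_injective_isomorphism[OF B] by metis
  have B'0: "B' x \<noteq> 0" if "x \<noteq> 0" for x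
    using B'(3)[of x] that linear_0[OF B(1)] by auto
  have contB': "continuous_on S B'" for S
    using B'(1) by (simp add: linear_continuous_on linear_conv_bounded_linear[symmetric])
  define r where "r x = (1 / norm (B' x)) *\<^sub>R B' x" for x
  have "continuous_on (- {0}) r" "r \<in> - {0} \<rightarrow> sphere 0 1"
    unfolding r_def by (auto intro!: continuous_intros contB' simp: B'0)
  then have "homotopic_with_canon (\<lambda>x. True) (sphere 0 1) (sphere 0 1) (r \<circ> B) (r \<circ> (\<lambda>x. c))"
    by (rule homotopic_with_compose_continuous_left[OF Bc])
  then have "homotopic_with_canon (\<lambda>x. True) (sphere 0 1) (sphere (0::'b) 1) id (\<lambda>x. r c)"
    by (rule homotopic_with_eq) (auto simp: r_def B')
  then have "contractible (sphere (0::'b) 1)" unfolding contractible_def by blast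
  then show False by (simp add: contractible_sphere)
qed

section \<open>Oriented lines as points of a hypersurface\<close>

definition hits :: "'a::real_vector \<Rightarrow> 'a \<Rightarrow> 'a set \<Rightarrow> bool" where
  "hits z d A \<longleftrightarrow> (\<exists>t. z + t *\<^sub>R d \<in> A)"

text \<open>A point \<open>q = (v, w)\<close> of \<open>\<real>\<^sup>3 \<times> \<real>\<^sup>2\<close> with \<open>v \<noteq> 0\<close> encodes the line with direction \<open>v\<close> through
  \<open>foot q\<close>; the length of \<open>v\<close> carries the first coordinate of that point. Requiring the foot to be
  orthogonal to the direction makes the encoding unique and cuts out a hypersurface.\<close>

definition foot :: "(real^3) \<times> (real^2) \<Rightarrow> real^3" where
  "foot q = ln (norm (fst q)) *\<^sub>R axis 1 1 + (snd q $ 1) *\<^sub>R axis 2 1 + (snd q $ 2) *\<^sub>R axis 3 1"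

definition line_code :: "real^3 \<Rightarrow> real^3 \<Rightarrow> (real^3) \<times> (real^2)" where
  "line_code d z = ((exp (z $ 1) / norm d) *\<^sub>R d, vector [z $ 2, z $ 3])"

definition normal_codes :: "((real^3) \<times> (real^2)) set" where
  "normal_codes = {q. fst q \<noteq> 0 \<and> fst q \<bullet> foot q = 0}"

lemma foot_nth: "foot q $ 1 = ln (norm (fst q))" "foot q $ 2 = snd q $ 1" "foot q $ 3 = snd q $ 2"
  by (simp_all add: foot_def axis_def)

lemma foot_line_code: "d \<noteq> 0 \<Longrightarrow> foot (line_code d z) = z"
  by (auto simp: vec_eq_iff forall_3 foot_nth line_code_def vector_2)

lemma continuous_on_vector_2 [continuous_intros]:
  fixes f g :: "'a::topological_space \<Rightarrow> real"
  assumes "continuous_on S f" "continuous_on S g"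
  shows "continuous_on S (\<lambda>x. vector [f x, g x] :: real^2)"
proof -
  have "vector [f x, g x] = f x *\<^sub>R axis 1 1 + g x *\<^sub>R (axis 2 1 :: real^2)" for x
    by (simp add: vec_eq_iff forall_2 axis_def vector_2)
  then show ?thesis using assms by (auto intro!: continuous_intros)
qed

lemma unbounded_components_compl_normal_codes:
  assumes K: "compact K" "K \<subseteq> normal_codes" and c: "c \<in> components (- K)"
  shows "\<not> bounded c"
proof
  assume bdd: "bounded c"
  txt \<open>Off the hypersurface, moving the foot along the line, away from the origin, leads to infinity. This
    needs a point of \<open>c\<close> with \<open>v $ 2 \<noteq> 0\<close>: for \<open>v\<close> along the first axis the motion may end at \<open>v = 0\<close>.\<close>
  have "open c" using open_components[OF _ c] K(1) by (simp add: compact_imp_closed open_Compl)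
  moreover obtain q0 where q0: "q0 \<in> c" using in_components_nonempty[OF c] by blast
  ultimately obtain e where e: "e > 0" "ball q0 e \<subseteq> c" using open_contains_ball by blast
  \<comment> \<open>\<delta> makes the second coordinate of the direction nonzero; \<tau> then moves
    the foot along the second axis, off the hypersurface. Each is at most \<open>e / 4\<close>, so
    the new point stays in the ball around \<open>q0\<close>.\<close>
  define \<delta> where "\<delta> = (if fst q0 $ 2 = 0 then e / 4 else 0)"
  define v where "v = fst q0 + \<delta> *\<^sub>R axis 2 1"
  have v2: "v $ 2 \<noteq> 0" using e(1) by (auto simp: v_def \<delta>_def axis_def)
  then have v0: "v \<noteq> 0" by auto
  define \<tau> where "\<tau> = (if v \<bullet> foot (v, snd q0) = 0 then e / 4 else 0)"
  define w where "w = snd q0 + \<tau> *\<^sub>R axis 1 1"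
  define q where "q = (v, w)"
  have "foot q = foot (v, snd q0) + \<tau> *\<^sub>R axis 2 1"
    by (simp add: vec_eq_iff forall_3 foot_nth q_def w_def axis_def)
  then have "v \<bullet> foot q = v \<bullet> foot (v, snd q0) + \<tau> * v $ 2"
    by (simp add: inner_add_right inner_axis)
  then have ne: "v \<bullet> foot q \<noteq> 0" using v2 e(1) by (auto simp: \<tau>_def)
  have "dist q0 q \<le> dist (fst q0) v + dist (snd q0) w"
    by (simp add: q_def dist_prod_def sqrt_sum_squares_le_sum)
  also have "\<dots> = \<bar>\<delta>\<bar> + \<bar>\<tau>\<bar>" by (simp add: v_def w_def dist_norm norm_axis_1)
  also have "\<dots> < e" using e(1) by (auto simp: \<delta>_def \<tau>_def)
  finally have qc: "q \<in> c" using e by (auto simp: dist_commute)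
  define d where "d = (1 / norm v) *\<^sub>R v"
  define \<sigma> :: real where "\<sigma> = sgn (v \<bullet> foot q)"
  \<comment> \<open>\<open>g s\<close> encodes the base point
    \<open>foot q + (\<sigma> * s) *\<^sub>R d\<close>: a shift of its first coordinate is an
    exponential factor on \<open>v\<close>. The sign \<sigma> prevents
    \<open>fst (g s) \<bullet> foot (g s)\<close> from vanishing for any
    \<open>s \<ge> 0\<close>.\<close>
  define g where "g s = (exp (\<sigma> * s * d $ 1) *\<^sub>R v, w + vector [\<sigma> * s * d $ 2, \<sigma> * s * d $ 3])" for s
  have g0: "g 0 = q"
    by (simp add: g_def q_def vec_eq_iff forall_2 vector_2)
  have footg: "foot (g s) = foot q + (\<sigma> * s) *\<^sub>R d" for s
    using v0 by (simp add: vec_eq_iff forall_3 foot_nth g_def q_def ln_mult vector_2)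
  have vd: "v \<bullet> d = norm v"
    using v0 by (simp add: d_def power2_norm_eq_inner[symmetric] power2_eq_square)
  have "g s \<notin> normal_codes" if "s \<ge> 0" for s
  proof -
    have "fst (g s) \<bullet> foot (g s) = exp (\<sigma> * s * d $ 1) * (v \<bullet> foot q + \<sigma> * (s * norm v))"
      unfolding footg by (simp add: g_def inner_add_right vd algebra_simps)
    moreover have "v \<bullet> foot q + \<sigma> * (s * norm v) \<noteq> 0"
    proof -
      have "\<sigma> * (v \<bullet> foot q + \<sigma> * (s * norm v)) = \<bar>v \<bullet> foot q\<bar> + s * norm v"
        using ne by (auto simp: \<sigma>_def sgn_if algebra_simps)
      moreover have "\<dots> > 0" using ne that by (simp add: add_pos_nonneg)
      ultimately show ?thesis by auto
    qed
    ultimately show ?thesis by (simp add: normal_codes_def)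
  qed
  then have sub: "g ` {0..} \<subseteq> - K" using K(2) by auto
  have "connected (g ` {0..})"
    unfolding g_def by (intro connected_continuous_image continuous_intros) auto
  then have "g ` {0..} \<subseteq> c"
    using components_maximal[OF c _ sub] qc g0 by (metis IntI atLeast_iff empty_iff image_eqI order_refl)
  then have "bounded (g ` {0..})" using bdd bounded_subset by blast
  then obtain B where B: "\<And>s. s \<ge> 0 \<Longrightarrow> norm (g s) \<le> B" unfolding bounded_iff by auto
  have d2: "\<sigma> * d $ 2 \<noteq> 0" using ne v2 v0 by (simp add: \<sigma>_def d_def sgn_eq_0_iff)
  \<comment> \<open>Chosen so that the shift \<open>\<sigma> * s * d $ 2\<close> has absolute value
    \<open>B + \<bar>w $ 1\<bar> + 1\<close>, which carries that coordinate beyond the bound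
    \<open>B\<close>.\<close>
  define s where "s = (B + \<bar>w $ 1\<bar> + 1) / \<bar>\<sigma> * d $ 2\<bar>"
  have "B \<ge> 0" using order_trans[OF norm_ge_zero B[of 0]] by simp
  then have s: "s \<ge> 0" by (simp add: s_def)
  have "\<bar>w $ 1 + \<sigma> * s * d $ 2\<bar> = \<bar>snd (g s) $ 1\<bar>" by (simp add: g_def vector_2)
  also have "\<dots> \<le> norm (snd (g s))" by (rule component_le_norm_cart)
  also have "\<dots> \<le> norm (g s)" by (metis norm_snd_le prod.collapse)
  also have "\<dots> \<le> B" using B s by blast
  finally have "\<bar>s * (\<sigma> * d $ 2)\<bar> \<le> B + \<bar>w $ 1\<bar>" by (simp add: algebra_simps)
  moreover have "\<bar>s * (\<sigma> * d $ 2)\<bar> = B + \<bar>w $ 1\<bar> + 1"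
    using d2 s \<open>B \<ge> 0\<close> by (simp add: abs_mult s_def)
  ultimately show False by simp
qed

section \<open>Continuous families of lines with prescribed directions\<close>

lemma convex_hits: "convex A \<Longrightarrow> convex {z. hits z d A}"
proof (rule convexI, clarsimp simp: hits_def)
  fix x y t s and u v :: real
  assume A: "convex A" and *: "x + t *\<^sub>R d \<in> A" "y + s *\<^sub>R d \<in> A" "0 \<le> u" "0 \<le> v" "u + v = 1"
  have "u *\<^sub>R (x + t *\<^sub>R d) + v *\<^sub>R (y + s *\<^sub>R d) \<in> A" using A * by (simp add: convexD)
  then show "\<exists>r. u *\<^sub>R x + v *\<^sub>R y + r *\<^sub>R d \<in> A"
    by (intro exI[of _ "u * t + v * s"]) (simp add: algebra_simps)
qed

lemma hits_scale: "c \<noteq> 0 \<Longrightarrow> hits z (c *\<^sub>R d) A \<longleftrightarrow> hits z d A"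
  unfolding hits_def
  by (metis (no_types) divide_self_if mult.commute scaleR_scaleR times_divide_eq_right mult_1)

lemma hits_shift: "hits (z + s *\<^sub>R d) d A \<longleftrightarrow> hits z d A"
  unfolding hits_def
  by (metis (no_types) add.assoc add_diff_cancel_left' diff_add_cancel scaleR_add_left add.commute)

text \<open>The base points admissible for a given direction form an intersection of convex sets.
  One of them stays admissible nearby: active sets are open, and inactive ones remain inactive. The
  selected point then slides along its line until it is orthogonal to the direction. Only positive
  multiples of \<open>d x\<close> occur, so the orientation survives.\<close>

lemma continuous_line_selection:
  fixes d :: "'c::euclidean_space \<Rightarrow> real^3" and act :: "'c \<Rightarrow> (real^3) set set"
  assumes d: "continuous_on S d" "\<And>x. x \<in> S \<Longrightarrow> d x \<noteq> 0"
    and G: "finite G" "\<And>A. A \<in> G \<Longrightarrow> open A \<and> convex A"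
    and act: "\<And>x. x \<in> S \<Longrightarrow> act x \<subseteq> G"
    and cl: "\<And>A. A \<in> G \<Longrightarrow> closed {x \<in> S. A \<in> act x}"
    and ex: "\<And>x. x \<in> S \<Longrightarrow> \<exists>z. \<forall>A\<in>act x. hits z (d x) A"
  obtains f where "continuous_on S f" "f ` S \<subseteq> normal_codes"
    "\<And>x. x \<in> S \<Longrightarrow> \<exists>c>0. fst (f x) = c *\<^sub>R d x"
    "\<And>x A. x \<in> S \<Longrightarrow> A \<in> act x \<Longrightarrow> hits (foot (f x)) (fst (f x)) A"
proof -
  have "\<exists>z. continuous_on S z \<and> (\<forall>x\<in>S. z x \<in> {z. \<forall>A\<in>act x. hits z (d x) A})"
  proof (rule convex_valued_selection[of S "\<lambda>x. {z. \<forall>A\<in>act x. hits z (d x) A}"])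
    fix x assume x: "x \<in> S"
    have "{z. \<forall>A\<in>act x. hits z (d x) A} = (\<Inter>A\<in>act x. {z. hits z (d x) A})" by auto
    then show "convex {z. \<forall>A\<in>act x. hits z (d x) A}"
      using act[OF x] G by (auto intro!: convex_INT convex_hits)
    obtain z where z: "\<And>A. A \<in> act x \<Longrightarrow> hits z (d x) A" using ex[OF x] by blast
    have "\<exists>U. open U \<and> x \<in> U \<and> (\<forall>y\<in>S \<inter> U. A \<in> act y \<longrightarrow> hits z (d y) A)" if A: "A \<in> G" for A
    proof (cases "A \<in> act x")
      case True
      then obtain t where t: "z + t *\<^sub>R d x \<in> A" using z by (auto simp: hits_def)
      have "openin (top_of_set S) (S \<inter> (\<lambda>x. z + t *\<^sub>R d x) -` A)"
        using d(1) G(2)[OF A] by (intro continuous_openin_preimage_gen continuous_intros) auto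
      then obtain U where "open U" "S \<inter> (\<lambda>x. z + t *\<^sub>R d x) -` A = S \<inter> U"
        by (auto simp: openin_open)
      then show ?thesis using t x by (intro exI[of _ U]) (auto simp: hits_def)
    next
      case False
      then show ?thesis using cl[OF A] by (intro exI[of _ "- {x \<in> S. A \<in> act x}"]) auto
    qed
    then obtain U where U: "\<And>A. A \<in> G \<Longrightarrow> open (U A) \<and> x \<in> U A"
      "\<And>A y. A \<in> G \<Longrightarrow> y \<in> S \<Longrightarrow> y \<in> U A \<Longrightarrow> A \<in> act y \<Longrightarrow> hits z (d y) A"
      by (metis IntI)
    show "\<exists>z U. open U \<and> x \<in> U \<and> (\<forall>y\<in>S \<inter> U. z \<in> {z. \<forall>A\<in>act y. hits z (d y) A})"
      using U G(1) subsetD[OF act]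
      by (intro exI[of _ z] exI[of _ "\<Inter>A\<in>G. U A"]) (auto intro!: open_INT)
  qed auto
  then obtain z where z: "continuous_on S z" "\<And>x A. x \<in> S \<Longrightarrow> A \<in> act x \<Longrightarrow> hits (z x) (d x) A"
    by blast
  define n where "n x = z x - ((z x \<bullet> d x) / (d x \<bullet> d x)) *\<^sub>R d x" for x
  define f where "f x = line_code (d x) (n x)" for x
  have fd: "fst (f x) = (exp (n x $ 1) / norm (d x)) *\<^sub>R d x" for x
    by (simp add: f_def line_code_def)
  have foot: "foot (f x) = n x" if "x \<in> S" for x
    using d(2)[OF that] by (simp add: f_def foot_line_code)
  show ?thesis
  proof
    have "continuous_on S n"
      unfolding n_def using d z(1) by (auto intro!: continuous_intros)
    then show "continuous_on S f"
      unfolding f_def line_code_def using d by (auto intro!: continuous_intros)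
    show pos: "\<exists>c>0. fst (f x) = c *\<^sub>R d x" if "x \<in> S" for x
      using d(2)[OF that] by (intro exI[of _ "exp (n x $ 1) / norm (d x)"]) (simp add: fd)
    have "d x \<bullet> n x = 0" if "x \<in> S" for x
      using d(2)[OF that] by (simp add: n_def inner_diff_right inner_commute)
    then show "f ` S \<subseteq> normal_codes"
      using d(2) by (auto simp: normal_codes_def foot fd)
    show "hits (foot (f x)) (fst (f x)) A" if x: "x \<in> S" "A \<in> act x" for x A
    proof -
      have "hits (n x) (d x) A"
        using z(2)[OF x] hits_shift[of "z x" "- ((z x \<bullet> d x) / (d x \<bullet> d x))" "d x" A]
        by (simp add: n_def)
      then show ?thesis
        using d(2)[OF x(1)] unfolding foot[OF x(1)] fd by (subst hits_scale) auto
    qed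
  qed
qed

lemma open_line_codes_hitting:
  assumes "finite H" "\<And>A. A \<in> H \<Longrightarrow> open A"
  shows "open {q. fst q \<noteq> 0 \<and> (\<forall>A\<in>H. hits (foot q) (fst q) A)}"
proof -
  have o: "open {q. fst q \<noteq> 0 \<and> hits (foot q) (fst q) A}" if "open A" for A
  proof -
    have "open ({q::(real^3)\<times>(real^2). fst q \<noteq> 0} \<inter> (\<lambda>q. foot q + t *\<^sub>R fst q) -` A)" for t
      using that unfolding foot_def
      by (intro continuous_open_preimage) (auto intro!: continuous_intros open_Collect_neq)
    then have "open (\<Union>t. {q::(real^3)\<times>(real^2). fst q \<noteq> 0} \<inter> (\<lambda>q. foot q + t *\<^sub>R fst q) -` A)"
      by blast
    also have "(\<Union>t. {q::(real^3)\<times>(real^2). fst q \<noteq> 0} \<inter> (\<lambda>q. foot q + t *\<^sub>R fst q) -` A)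
        = {q. fst q \<noteq> 0 \<and> hits (foot q) (fst q) A}"
      by (auto simp: hits_def)
    finally show ?thesis .
  qed
  have "{q. fst q \<noteq> 0 \<and> (\<forall>A\<in>H. hits (foot q) (fst q) A)} =
     {q::(real^3)\<times>(real^2). fst q \<noteq> 0} \<inter> (\<Inter>A\<in>H. {q. fst q \<noteq> 0 \<and> hits (foot q) (fst q) A})" by auto
  moreover have "open {q::(real^3)\<times>(real^2). fst q \<noteq> 0}"
    by (intro open_Collect_neq continuous_intros)
  ultimately show ?thesis using assms o by (auto intro!: open_Int open_INT)
qed

text \<open>\<open>V \<noteq> UNIV\<close> is essential: the distance to the empty set is 0 by
  convention.\<close>

lemma infdist_compl_pos_iff:
  fixes V :: "'a::euclidean_space set"
  assumes "open V" "V \<noteq> UNIV"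
  shows "infdist q (- V) > 0 \<longleftrightarrow> q \<in> V"
proof -
  have "infdist q (- V) = 0 \<longleftrightarrow> q \<in> - V"
    using assms by (metis ComplI Compl_UNIV_eq closed_Compl in_closed_iff_infdist_zero double_compl)
  then show ?thesis using infdist_nonneg[of q "- V"] by auto
qed

section \<open>Spheres of lines\<close>

definition hitting_codes :: "(real^3) set set \<Rightarrow> ((real^3) \<times> (real^2)) set" where
  "hitting_codes H = {q. fst q \<noteq> 0 \<and> (\<forall>A\<in>H. hits (foot q) (fst q) A)}"

lemma hitting_codes_neq_UNIV: "hitting_codes H \<noteq> UNIV"
proof -
  have "(0, 0) \<notin> hitting_codes H" by (simp add: hitting_codes_def)
  then show ?thesis by blast
qed

text \<open>The faces of a simplex boundary are encoded by the set of coordinates at which \<open>ext x\<close> is minimal: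
  these are the vertices outside the face containing \<open>x\<close>.\<close>

lemma argmin_sphere_of_lines:
  fixes ext :: "'c::euclidean_space \<Rightarrow> 'k::finite \<Rightarrow> real" and e :: "'k \<Rightarrow> (real^3) set"
    and E :: "(real^3) set set \<Rightarrow> (real^3) set"
  assumes G: "finite G" "\<And>A. A \<in> G \<Longrightarrow> open A \<and> convex A"
    and AR: "\<And>H. H \<subseteq> G \<Longrightarrow> H \<noteq> {} \<Longrightarrow> H \<noteq> G \<Longrightarrow> AR (E H)"
    and anti: "\<And>H H'. H \<noteq> {} \<Longrightarrow> H \<subseteq> H' \<Longrightarrow> H' \<subseteq> G \<Longrightarrow> E H' \<subseteq> E H"
    and E: "\<And>H d. H \<subseteq> G \<Longrightarrow> H \<noteq> {} \<Longrightarrow> d \<in> E H \<Longrightarrow> d \<noteq> 0 \<and> (\<exists>z. \<forall>A\<in>H. hits z d A)"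
    and e: "inj e" "range e \<subseteq> G"
    and X: "closed X" "\<And>i. continuous_on X (\<lambda>x. ext x i)"
    and dG: "continuous_on {x \<in> X. \<forall>i j. ext x i = ext x j} dG"
      "\<And>x. x \<in> X \<Longrightarrow> \<forall>i j. ext x i = ext x j \<Longrightarrow> dG x \<in> E G"
  obtains f where "continuous_on X f" "f ` X \<subseteq> normal_codes"
    "\<And>x i. x \<in> X \<Longrightarrow> \<forall>j. ext x i \<le> ext x j \<Longrightarrow> f x \<in> hitting_codes (insert (e i) (G - range e))"
    "\<And>x. x \<in> X \<Longrightarrow> \<forall>i j. ext x i = ext x j \<Longrightarrow> \<exists>c>0. fst (f x) = c *\<^sub>R dG x"
proof -
  define M where "M x = {i. \<forall>j. ext x i \<le> ext x j}" for x
  \<comment> \<open>Members outside the range of \<open>e\<close> are active everywhere, which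
    covers families with more members than the simplex has vertices.\<close>
  define act where "act x = (G - range e) \<union> e ` M x" for x
  have M: "M x \<noteq> {}" for x
  proof -
    obtain i where "\<forall>j. ext x i \<le> ext x j"
      using ex_min_if_finite[of "range (ext x)"] by (auto simp: not_less)
    then show ?thesis by (auto simp: M_def)
  qed
  have act: "act x \<subseteq> G" "act x \<noteq> {}" for x using M[of x] e(2) by (auto simp: act_def)
  have actG: "act x = G \<longleftrightarrow> (\<forall>i j. ext x i = ext x j)" for x
  proof -
    have "i \<in> M x \<longleftrightarrow> e i \<in> act x" for i using e by (auto simp: act_def dest: injD)
    then have "M x = UNIV \<longleftrightarrow> range e \<subseteq> act x" by auto
    moreover have "act x = G \<longleftrightarrow> range e \<subseteq> act x"
      using e(2) act(1)[of x] unfolding act_def by blast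
    ultimately have "act x = G \<longleftrightarrow> M x = UNIV" by simp
    also have "\<dots> \<longleftrightarrow> (\<forall>i j. ext x i \<le> ext x j)" by (auto simp: M_def)
    also have "\<dots> \<longleftrightarrow> (\<forall>i j. ext x i = ext x j)"
    proof
      assume le: "\<forall>i j. ext x i \<le> ext x j"
      show "\<forall>i j. ext x i = ext x j" by (intro allI order_antisym le[rule_format])
    next
      assume eq: "\<forall>i j. ext x i = ext x j"
      show "\<forall>i j. ext x i \<le> ext x j" by (intro allI eq_refl) (rule eq[rule_format])
    qed
    finally show ?thesis .
  qed
  have cl: "closed {x \<in> X. A \<in> act x}" if A: "A \<in> G" for A
  proof (cases "A \<in> range e")
    case True
    then obtain i where i: "A = e i" by blast
    have "{x \<in> X. A \<in> act x} = X \<inter> (\<Inter>j. {x \<in> X. ext x i \<le> ext x j})"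
      using e(1) by (auto simp: act_def M_def i dest: injD)
    moreover have "closed {x \<in> X. ext x i \<le> ext x j}" for j
      using X by (intro continuous_on_closed_Collect_le)
    ultimately show ?thesis using X(1) by (simp add: closed_Int closed_INT)
  next
    case False
    then show ?thesis using A X by (simp add: act_def)
  qed
  \<comment> \<open>All members are active exactly where \<open>ext x\<close> is constant; there
    \<open>dG\<close> prescribes the direction.\<close>
  obtain d where d: "continuous_on X d" "\<And>x. x \<in> X \<Longrightarrow> d x \<in> E (act x)"
    "\<And>x. x \<in> X \<Longrightarrow> act x = G \<Longrightarrow> d x = dG x"
  proof (rule skeletal_extension[where G = G and X = X and act = act and Y = E and ?d0.0 = dG])
    show "continuous_on {x \<in> X. act x = G} dG" using dG(1) by (simp add: actG)
    show "dG x \<in> E G" if "x \<in> X" "act x = G" for x using dG(2) that by (simp add: actG)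
  qed (use G(1) X(1) act cl AR anti in auto)
  have dE: "d x \<noteq> 0 \<and> (\<exists>z. \<forall>A\<in>act x. hits z (d x) A)" if "x \<in> X" for x
    using E[OF act d(2)[OF that]] .
  obtain f where f: "continuous_on X f" "f ` X \<subseteq> normal_codes"
    "\<And>x. x \<in> X \<Longrightarrow> \<exists>c>0. fst (f x) = c *\<^sub>R d x"
    "\<And>x A. x \<in> X \<Longrightarrow> A \<in> act x \<Longrightarrow> hits (foot (f x)) (fst (f x)) A"
  proof (rule continuous_line_selection[where S = X and d = d and G = G and act = act])
    show "\<exists>z. \<forall>A\<in>act x. hits z (d x) A" if "x \<in> X" for x using dE[OF that] by blast
  qed (use d(1) dE G act(1) cl in auto)
  show ?thesis
  proof
    show "f x \<in> hitting_codes (insert (e i) (G - range e))"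
      if "x \<in> X" "\<forall>j. ext x i \<le> ext x j" for x i
    proof -
      have "fst (f x) \<noteq> 0" using f(3)[OF that(1)] dE[OF that(1)] by auto
      moreover have "insert (e i) (G - range e) \<subseteq> act x" using that by (auto simp: act_def M_def)
      ultimately show ?thesis using f(4)[OF that(1)] by (auto simp: hitting_codes_def)
    qed
    show "\<exists>c>0. fst (f x) = c *\<^sub>R dG x" if "x \<in> X" "\<forall>i j. ext x i = ext x j" for x
      using f(3)[OF that(1)] d(3)[OF that(1)] that(2) actG by metis
  qed (use f in auto)
qed

section \<open>Gap functions and the two sphere arguments\<close>

definition code_gap :: "((real^3) \<times> (real^2)) set \<Rightarrow> (real^3) \<times> (real^2) \<Rightarrow> real" where
  "code_gap V q = infdist q (- V)"

text \<open>Membership becomes the sign of a continuous function. The complement is nonempty because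
  codes with zero direction are excluded from \<open>hitting_codes H\<close>.\<close>

lemma code_gap_hitting:
  assumes "finite H" "\<And>A. A \<in> H \<Longrightarrow> open A"
  shows "code_gap (hitting_codes H) q > 0 \<longleftrightarrow> q \<in> hitting_codes H"
  unfolding code_gap_def
  using open_line_codes_hitting[OF assms] hitting_codes_neq_UNIV[of H]
  by (intro infdist_compl_pos_iff) (auto simp: hitting_codes_def)

lemma continuous_on_code_gap [continuous_intros]: "continuous_on S (code_gap V)"
  unfolding code_gap_def by (intro continuous_intros)

text \<open>Six members serve as the vertices of a simplex. The line \<open>f x\<close> meets those
  whose coordinate is minimal, so their gaps are positive. Without a common line the six gaps are
  never all positive, and this keeps the gap vector, and its deformation to the negated coordinates,
  away from the constant vectors.\<close>

lemma common_line_if_proper_subfamilies_AR: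
  fixes G :: "(real^3) set set" and E :: "(real^3) set set \<Rightarrow> (real^3) set"
  assumes G: "finite G" "card G \<ge> 6" "\<And>A. A \<in> G \<Longrightarrow> open A \<and> convex A"
    and AR: "\<And>H. H \<subseteq> G \<Longrightarrow> H \<noteq> {} \<Longrightarrow> H \<noteq> G \<Longrightarrow> AR (E H)"
    and anti: "\<And>H H'. H \<noteq> {} \<Longrightarrow> H \<subseteq> H' \<Longrightarrow> H' \<subseteq> G \<Longrightarrow> E H' \<subseteq> E H"
    and E: "\<And>H d. H \<subseteq> G \<Longrightarrow> H \<noteq> {} \<Longrightarrow> d \<in> E H \<Longrightarrow> d \<noteq> 0 \<and> (\<exists>z. \<forall>A\<in>H. hits z d A)"
  shows "\<exists>z d. d \<noteq> 0 \<and> (\<forall>A\<in>G. hits z d A)"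
proof (rule ccontr)
  assume no: "\<not> ?thesis"
  have "card (UNIV :: 5 option set) \<le> card G" using G(2) by (simp add: card_UNIV_option)
  then obtain e :: "5 option \<Rightarrow> (real^3) set" where e: "inj e" "range e \<subseteq> G"
    using card_le_inj[of "UNIV :: 5 option set" G] G(1) by auto
  \<comment> \<open>Six coordinates modulo constants are five coordinates: the one at
    \<open>None\<close> is normalised to 0, so \<open>ext x\<close> is constant only for
    \<open>x = 0\<close>. On the sphere the prescription \<open>dG\<close> below is therefore
    vacuous.\<close>
  define ext where "ext x i = (case i of None \<Rightarrow> 0 | Some j \<Rightarrow> x $ j)" for x :: "real^5" and i
  let ?X = "sphere (0::real^5) 1"
  have noX: "\<not> (\<forall>i j. ext x i = ext x j)" if "x \<in> ?X" for x
  proof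
    assume "\<forall>i j. ext x i = ext x j"
    then have "ext x (Some j) = ext x None" for j by blast
    then have "x = 0" by (simp add: vec_eq_iff ext_def)
    then show False using that by simp
  qed
  then have X0: "{x \<in> ?X. \<forall>i j. ext x i = ext x j} = {}" by blast
  obtain f where f: "continuous_on ?X f" "f ` ?X \<subseteq> normal_codes"
    "\<And>x i. x \<in> ?X \<Longrightarrow> \<forall>j. ext x i \<le> ext x j \<Longrightarrow> f x \<in> hitting_codes (insert (e i) (G - range e))"
  proof (rule argmin_sphere_of_lines[where X = ?X and ext = ext and dG = "\<lambda>x. 0", OF G(1,3) AR anti E e])
    show "continuous_on ?X (\<lambda>x. ext x i)" for i
      unfolding ext_def by (cases i) (auto intro!: continuous_intros)
  qed (use noX X0 in auto)
  define h where "h i = code_gap (hitting_codes (insert (e i) (G - range e)))" for i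
  have hpos: "h i q > 0 \<longleftrightarrow> q \<in> hitting_codes (insert (e i) (G - range e))" for i q
    unfolding h_def using G e by (intro code_gap_hitting) auto
  have notall: "\<exists>i. h i q \<le> 0" for q
  proof (rule ccontr)
    assume "\<not> ?thesis"
    then have *: "q \<in> hitting_codes (insert (e i) (G - range e))" for i
      using hpos by (auto simp: not_le)
    have "hits (foot q) (fst q) A" if "A \<in> G" for A
      using that * by (cases "A \<in> range e") (auto simp: hitting_codes_def)
    moreover have "fst q \<noteq> 0" using * by (simp add: hitting_codes_def)
    ultimately show False using no by blast
  qed
  \<comment> \<open>If the mixture were constant in \<open>i\<close>, then
    \<open>(1 - \<tau>) * h\<close> would be least at a minimum \<open>m\<close> of
    \<open>ext x\<close>, where it is positive. So all gaps would be positive, against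
    \<open>notall\<close>.\<close>
  have key: "\<not> (\<forall>i. (1 - \<tau>) * h i (f x) - \<tau> * ext x i = (1 - \<tau>) * h None (f x))"
    if x: "x \<in> ?X" and \<tau>: "0 \<le> \<tau>" "\<tau> \<le> 1" for x \<tau>
  proof
    assume *: "\<forall>i. (1 - \<tau>) * h i (f x) - \<tau> * ext x i = (1 - \<tau>) * h None (f x)"
    obtain m where m: "\<And>j. ext x m \<le> ext x j"
      using ex_min_if_finite[of "range (ext x)"] by (auto simp: not_less)
    have "h m (f x) > 0" using f(3)[OF x] m hpos by blast
    show False
    proof (cases "\<tau> = 1")
      case True
      then have "ext x i = 0" for i using * by (auto dest: spec[of _ i])
      then show False using noX[OF x] by simp
    next
      case False
      have "0 < (1 - \<tau>) * h j (f x)" for j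
      proof -
        have "(1 - \<tau>) * h j (f x) = (1 - \<tau>) * h m (f x) + \<tau> * (ext x j - ext x m)"
          using *[rule_format, of j] *[rule_format, of m] by (simp add: algebra_simps)
        moreover have "(1 - \<tau>) * h m (f x) > 0" using False \<tau> \<open>h m (f x) > 0\<close> by simp
        moreover have "\<tau> * (ext x j - ext x m) \<ge> 0" using m[of j] \<tau> by simp
        ultimately show ?thesis by linarith
      qed
      then have "h j (f x) > 0" for j using False \<tau> by (simp add: zero_less_mult_iff)
      then show False using notall[of "f x"] by (auto simp: not_le[symmetric])
    qed
  qed
  \<comment> \<open>Subtracting the entry at \<open>None\<close> gives coordinates modulo constants,
    in which avoiding constant vectors means avoiding 0.\<close>
  define \<phi> where "\<phi> q = (\<chi> i. h (Some i) q - h None q)" for q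
  have seg: "closed_segment (\<phi> (f x)) (- x) \<subseteq> - {0}" if x: "x \<in> ?X" for x
  proof
    fix y assume "y \<in> closed_segment (\<phi> (f x)) (- x)"
    then obtain \<tau> where \<tau>: "0 \<le> \<tau>" "\<tau> \<le> 1" "y = (1 - \<tau>) *\<^sub>R \<phi> (f x) + \<tau> *\<^sub>R (- x)"
      by (auto simp: closed_segment_def)
    show "y \<in> - {0}"
    proof
      assume "y \<in> {0}"
      then have "y $ i = 0" for i by simp
      then have "(1 - \<tau>) * h (Some i) (f x) - \<tau> * ext x (Some i) = (1 - \<tau>) * h None (f x)" for i
        by (simp add: \<tau>(3) \<phi>_def ext_def algebra_simps)
      then have "(1 - \<tau>) * h i (f x) - \<tau> * ext x i = (1 - \<tau>) * h None (f x)" for i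
        by (cases i) (auto simp: ext_def)
      then show False using key[OF x \<tau>(1,2)] by blast
    qed
  qed
  have cont\<phi>: "continuous_on S \<phi>" for S
    unfolding \<phi>_def h_def by (intro continuous_intros)
  have "homotopic_with_canon (\<lambda>x. True) ?X (- {0}) (\<lambda>x. \<phi> (f x)) uminus"
    using seg f(1) by (intro homotopic_with_linear)
      (auto intro!: continuous_on_compose2[OF cont\<phi>[of UNIV]] continuous_intros)
  moreover have "\<not> homotopic_with_canon (\<lambda>x. True) ?X (- {0}) (\<lambda>x. \<phi> (f x)) uminus"
  proof (rule no_sphere_factorization[OF f(1)])
    have "compact (f ` ?X)" by (rule compact_continuous_image[OF f(1)]) simp
    then show "\<not> bounded c" if "c \<in> components (- f ` ?X)" for c
      using f(2) that by (rule unbounded_components_compl_normal_codes)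
    show "\<phi> (f x) \<noteq> 0" if "x \<in> ?X" for x
      using subsetD[OF seg[OF that] ends_in_segment(1)] by simp
    show "linear (uminus :: real^5 \<Rightarrow> real^5)" by (simp add: linear_uminus linear_id)
  qed (auto intro: cont\<phi>)
  ultimately show False by blast
qed

text \<open>The five coordinates of \<open>real^5\<close> now belong to five members, and the
  diagonal is the suspension axis. Its two points on the sphere are the poles, where every member is
  active and the direction may be taken from \<open>P\<close> at one and from \<open>Q\<close> at
  the other. Vectors of mean 0 carry the gaps of the five members, and the axis carries a function
  \<open>t\<close> that tells \<open>P\<close> from \<open>Q\<close>.\<close>

lemma no_direction_split_if_proper_subfamilies_AR:
  fixes G :: "(real^3) set set" and E :: "(real^3) set set \<Rightarrow> (real^3) set"
  assumes G: "finite G" "card G \<ge> 5" "\<And>A. A \<in> G \<Longrightarrow> open A \<and> convex A"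
    and AR: "\<And>H. H \<subseteq> G \<Longrightarrow> H \<noteq> {} \<Longrightarrow> H \<noteq> G \<Longrightarrow> AR (E H)"
    and anti: "\<And>H H'. H \<noteq> {} \<Longrightarrow> H \<subseteq> H' \<Longrightarrow> H' \<subseteq> G \<Longrightarrow> E H' \<subseteq> E H"
    and E: "\<And>H d. H \<subseteq> G \<Longrightarrow> H \<noteq> {} \<Longrightarrow> d \<in> E H \<Longrightarrow> d \<noteq> 0 \<and> (\<exists>z. \<forall>A\<in>H. hits z d A)"
    and EG: "\<And>z d. d \<noteq> 0 \<Longrightarrow> \<forall>A\<in>G. hits z d A \<Longrightarrow> d \<in> E G \<or> - d \<in> E G"
    and asym: "\<And>d. d \<in> E G \<Longrightarrow> - d \<notin> E G"
    and PQ: "open P" "open Q" "P \<inter> Q = {}" "P \<union> Q = E G" "P \<noteq> {}" "Q \<noteq> {}"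
    and cone: "\<And>c d. c > 0 \<Longrightarrow> d \<in> P \<Longrightarrow> c *\<^sub>R d \<in> P" "\<And>c d. c > 0 \<Longrightarrow> d \<in> Q \<Longrightarrow> c *\<^sub>R d \<in> Q"
  shows False
proof -
  obtain p0 q0 where pq: "p0 \<in> P" "q0 \<in> Q" using PQ by blast
  have "card (UNIV :: 5 set) \<le> card G" using G(2) by simp
  then obtain e :: "5 \<Rightarrow> (real^3) set" where e: "inj e" "range e \<subseteq> G"
    using card_le_inj[of "UNIV :: 5 set" G] G(1) by auto
  let ?X = "sphere (0::real^5) 1"
  \<comment> \<open>Used at the poles only, where the sign of any coordinate tells which pole it
    is.\<close>
  define d0 where "d0 x = (if x $ 1 > 0 then p0 else q0)" for x :: "real^5"
  have const0: "x $ 1 \<noteq> 0" if "x \<in> ?X" "\<forall>i j. x $ i = x $ j" for x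
  proof
    assume "x $ 1 = 0"
    then have "x $ i = 0" for i using that(2)[rule_format, of i 1] by simp
    then have "x = 0" by (simp add: vec_eq_iff)
    then show False using that by simp
  qed
  obtain f where f: "continuous_on ?X f" "f ` ?X \<subseteq> normal_codes"
    "\<And>x i. x \<in> ?X \<Longrightarrow> \<forall>j. x $ i \<le> x $ j \<Longrightarrow> f x \<in> hitting_codes (insert (e i) (G - range e))"
    "\<And>x. x \<in> ?X \<Longrightarrow> \<forall>i j. x $ i = x $ j \<Longrightarrow> \<exists>c>0. fst (f x) = c *\<^sub>R d0 x"
  proof (rule argmin_sphere_of_lines[where X = ?X and ext = "\<lambda>x i. x $ i" and dG = d0, OF G(1,3) AR anti E e])
    have "continuous_on ({x. x $ 1 > 0} \<union> {x. x $ 1 < 0}) d0"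
    proof (rule continuous_on_open_Un)
      show "continuous_on {x. x $ 1 > 0} d0"
        by (rule continuous_on_eq[of _ "\<lambda>x. p0"]) (auto simp: d0_def)
      show "continuous_on {x. x $ 1 < 0} d0"
        by (rule continuous_on_eq[of _ "\<lambda>x. q0"]) (auto simp: d0_def)
    qed (auto intro!: open_Collect_less continuous_intros)
    then show "continuous_on {x \<in> ?X. \<forall>i j. x $ i = x $ j} d0"
      by (rule continuous_on_subset) (use const0 in force)
    show "d0 x \<in> E G" for x using pq PQ by (auto simp: d0_def)
  qed (auto intro!: continuous_intros)
  define h where "h i = code_gap (hitting_codes (insert (e i) (G - range e)))" for i
  have hpos: "h i q > 0 \<longleftrightarrow> q \<in> hitting_codes (insert (e i) (G - range e))" for i q
    unfolding h_def using G e by (intro code_gap_hitting) auto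
  have all: "q \<in> hitting_codes G" if "\<And>i. h i q > 0" for q
  proof -
    have *: "q \<in> hitting_codes (insert (e i) (G - range e))" for i using hpos that by auto
    have "hits (foot q) (fst q) A" if "A \<in> G" for A
      using that * by (cases "A \<in> range e") (auto simp: hitting_codes_def)
    moreover have "fst q \<noteq> 0" using * by (simp add: hitting_codes_def)
    ultimately show ?thesis by (auto simp: hitting_codes_def)
  qed
  \<comment> \<open>\<open>hits\<close> ignores orientation, so a code in
    \<open>hitting_codes G\<close> may carry the negative of a direction in \<open>E G\<close>;
    hence the reflected copy of \<open>S\<close>.\<close>
  define V where "V S = hitting_codes G \<inter> fst -` (S \<union> uminus ` S)" for S
  have openV: "open (V S)" if "open S" for S
    unfolding V_def using open_line_codes_hitting[of G] G that
    by (intro open_Int open_vimage_fst open_Un open_negations) (auto simp: hitting_codes_def)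
  have Vpos: "code_gap (V S) q > 0 \<longleftrightarrow> q \<in> V S" if "open S" for S q
    unfolding code_gap_def using openV[OF that] hitting_codes_neq_UNIV[of G]
    by (intro infdist_compl_pos_iff) (auto simp: V_def)
  have gap0: "code_gap U q \<ge> 0" for U q by (simp add: code_gap_def infdist_nonneg)
  \<comment> \<open>Positive on \<open>V P\<close>, negative on \<open>V Q\<close>, and hence
    nonzero at every code in \<open>hitting_codes G\<close>.\<close>
  define t where "t q = code_gap (V P) q - code_gap (V Q) q" for q
  have VPQ: "V P \<inter> V Q = {}"
  proof -
    have "(P \<union> uminus ` P) \<inter> (Q \<union> uminus ` Q) = {}"
    proof (rule ccontr)
      assume "\<not> ?thesis"
      then obtain d a b where "a \<in> P" "b \<in> Q" "d = a \<or> d = - a" "d = b \<or> d = - b" by blast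
      moreover from this have "a = b \<or> a = - b" by auto
      moreover have "a \<in> E G" "b \<in> E G" using calculation PQ(4) by auto
      ultimately show False using PQ(3) asym[of b] by auto
    qed
    then show ?thesis by (auto simp: V_def)
  qed
  have tP: "t q > 0" if "q \<in> V P" for q
    using that Vpos[OF PQ(1), of q] Vpos[OF PQ(2), of q] VPQ gap0[of "V Q" q]
    by (auto simp: t_def)
  have tQ: "t q < 0" if "q \<in> V Q" for q
    using that Vpos[OF PQ(1), of q] Vpos[OF PQ(2), of q] VPQ gap0[of "V P" q]
    by (auto simp: t_def)
  have t0: "t q \<noteq> 0" if "q \<in> hitting_codes G" for q
  proof -
    have "fst q \<in> E G \<or> - fst q \<in> E G"
      using that EG[of "fst q" "foot q"] by (auto simp: hitting_codes_def)
    then have "q \<in> V P \<or> q \<in> V Q"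
      using that PQ(4) image_eqI[of "fst q" uminus "- fst q"] by (auto simp: V_def)
    then show ?thesis using tP tQ by fastforce
  qed
  have pole: "x $ 1 * t (f x) > 0" if x: "x \<in> ?X" "\<forall>i j. x $ i = x $ j" for x
  proof -
    have "h i (f x) > 0" for i using f(3)[OF x(1), of i] x(2) hpos by (metis order_refl)
    then have hG: "f x \<in> hitting_codes G" by (rule all)
    obtain c where c: "c > 0" "fst (f x) = c *\<^sub>R d0 x" using f(4)[OF x] by blast
    show ?thesis
    proof (cases "x $ 1 > 0")
      case True
      then have "f x \<in> V P" using c cone pq hG by (simp add: V_def d0_def)
      then show ?thesis using tP True by simp
    next
      case False
      then have "f x \<in> V Q" using c cone pq hG by (simp add: V_def d0_def)
      then show ?thesis using tQ False const0[OF x] by (simp add: mult_neg_neg)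
    qed
  qed
  define avg where "avg a = (\<Sum>i\<in>UNIV. a i) / 5" for a :: "5 \<Rightarrow> real"
  have avg: "avg (\<lambda>i. a i + b i) = avg a + avg b" "avg (\<lambda>i. r * a i) = r * avg a"
      "avg (\<lambda>i. r) = r" for a b r
    by (simp_all add: avg_def sum.distrib add_divide_distrib sum_distrib_left)
  have avgc: "avg (\<lambda>i. a i + r) = avg a + r" "avg (\<lambda>i. a i - r) = avg a - r" for a r
    using avg(1)[of a "\<lambda>i. r"] avg(1)[of a "\<lambda>i. - r"] avg(3)[of r] avg(3)[of "- r"] by simp_all
  define \<phi> where "\<phi> q = (\<chi> i. h i q - avg (\<lambda>i. h i q) + t q)" for q
  define \<psi> where "\<psi> x = (\<chi> i. - (x $ i - avg (\<lambda>i. x $ i)) + t (f x))" for x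
  \<comment> \<open>The target of the deformation: -1 on vectors of mean 0 and +1 on the
    diagonal.\<close>
  define B where "B x = (\<chi> i. - (x $ i - avg (\<lambda>i. x $ i)) + avg (\<lambda>i. x $ i))" for x :: "real^5"
  have avgx: "avg (\<lambda>i. x $ i) = x $ 1" if "\<forall>i j. x $ i = x $ j" for x :: "real^5"
  proof -
    have "(\<lambda>i. x $ i) = (\<lambda>i. x $ 1)" using that by blast
    then have "avg (\<lambda>i. x $ i) = avg (\<lambda>i. x $ 1)" by (rule arg_cong)
    then show ?thesis unfolding avg(3) .
  qed
  txt \<open>The line \<open>f x\<close> may pass through \<open>V P\<close> and \<open>V Q\<close> away from the poles, so the sign of \<open>t (f x)\<close> is only
    controlled there; hence the transversal part is deformed first, with \<open>t (f x)\<close> kept fixed.\<close>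
  have seg1: "closed_segment (\<phi> (f x)) (\<psi> x) \<subseteq> - {0}" if x: "x \<in> ?X" for x
  proof
    fix y assume "y \<in> closed_segment (\<phi> (f x)) (\<psi> x)"
    then obtain \<tau> where \<tau>: "0 \<le> \<tau>" "\<tau> \<le> 1" "y = (1 - \<tau>) *\<^sub>R \<phi> (f x) + \<tau> *\<^sub>R \<psi> x"
      by (auto simp: closed_segment_def)
    show "y \<in> - {0}"
    proof
      assume "y \<in> {0}"
      then have "y $ i = 0" for i by simp
      moreover have "y $ i = (1 - \<tau>) * (h i (f x) - avg (\<lambda>i. h i (f x))) + (- \<tau>) * (x $ i - avg (\<lambda>i. x $ i)) + t (f x)" for i
        by (simp add: \<tau>(3) \<phi>_def \<psi>_def algebra_simps)
      ultimately have y: "(1 - \<tau>) * (h i (f x) - avg (\<lambda>i. h i (f x))) + (- \<tau>) * (x $ i - avg (\<lambda>i. x $ i)) + t (f x) = 0" for i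
        by simp
      \<comment> \<open>Averaging the five equations kills the parts of mean 0 and leaves
        \<open>t (f x) = 0\<close>; the equations then restrict those parts alone.\<close>
      have "avg (\<lambda>i. (1 - \<tau>) * (h i (f x) - avg (\<lambda>i. h i (f x))) + (- \<tau>) * (x $ i - avg (\<lambda>i. x $ i)) + t (f x)) = t (f x)"
        unfolding avg(1) avg(2) avgc by (simp add: avg(3))
      then have t: "t (f x) = 0" unfolding y by (simp add: avg(3))
      obtain m where m: "\<And>j. x $ m \<le> x $ j"
        using ex_min_if_finite[of "range (($) x)"] by (auto simp: not_less)
      have hm: "h m (f x) > 0" using f(3)[OF x] m hpos by blast
      show False
      proof (cases "\<tau> = 1")
        case True
        then have xa: "x $ i = avg (\<lambda>i. x $ i)" for i using y[of i] t by simp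
        then have "\<forall>i j. x $ i = x $ j" using trans[OF xa xa[symmetric]] by blast
        then show False using pole[OF x] t by simp
      next
        case False
        have "0 < (1 - \<tau>) * h j (f x)" for j
        proof -
          have "(1 - \<tau>) * h j (f x) = (1 - \<tau>) * h m (f x) + \<tau> * (x $ j - x $ m)"
            using y[of j] y[of m] by (simp add: algebra_simps)
          moreover have "(1 - \<tau>) * h m (f x) > 0" using False \<tau> hm by simp
          moreover have "\<tau> * (x $ j - x $ m) \<ge> 0" using m[of j] \<tau> by simp
          ultimately show ?thesis by linarith
        qed
        then have "h j (f x) > 0" for j using False \<tau> by (simp add: zero_less_mult_iff)
        then show False using t0[OF all] t by blast
      qed
    qed
  qed
  have seg2: "closed_segment (\<psi> x) (B x) \<subseteq> - {0}" if x: "x \<in> ?X" for x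
  proof
    fix y assume "y \<in> closed_segment (\<psi> x) (B x)"
    then obtain \<tau> where \<tau>: "0 \<le> \<tau>" "\<tau> \<le> 1" "y = (1 - \<tau>) *\<^sub>R \<psi> x + \<tau> *\<^sub>R B x"
      by (auto simp: closed_segment_def)
    show "y \<in> - {0}"
    proof
      assume "y \<in> {0}"
      then have "y $ i = 0" for i by simp
      moreover have "y $ i = avg (\<lambda>i. x $ i) - x $ i + ((1 - \<tau>) * t (f x) + \<tau> * avg (\<lambda>i. x $ i))" for i
        by (simp add: \<tau>(3) B_def \<psi>_def algebra_simps)
      ultimately have y0: "avg (\<lambda>i. x $ i) - x $ i + ((1 - \<tau>) * t (f x) + \<tau> * avg (\<lambda>i. x $ i)) = 0" for i
        by simp
      have y: "x $ i = avg (\<lambda>i. x $ i) + ((1 - \<tau>) * t (f x) + \<tau> * avg (\<lambda>i. x $ i))" for i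
        using y0[of i] by linarith
      have c: "\<forall>i j. x $ i = x $ j" using trans[OF y y[symmetric]] by blast
      have "(1 - \<tau>) * t (f x) + \<tau> * x $ 1 = 0" using y[of 1] unfolding avgx[OF c] by linarith
      then have "x $ 1 * ((1 - \<tau>) * t (f x) + \<tau> * x $ 1) = 0" by simp
      then have eq: "(1 - \<tau>) * (x $ 1 * t (f x)) + \<tau> * (x $ 1 * x $ 1) = 0" by (simp add: algebra_simps)
      have "x $ 1 * x $ 1 > 0" using const0[OF x c] by (auto simp: zero_less_mult_iff)
      moreover have "\<tau> = 0 \<or> \<tau> > 0" using \<tau>(1) by auto
      ultimately have "(1 - \<tau>) * (x $ 1 * t (f x)) + \<tau> * (x $ 1 * x $ 1) > 0"
        using pole[OF x c] \<tau>(2) by (auto intro: add_nonneg_pos)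
      then show False using eq by simp
    qed
  qed
  have conth: "continuous_on S (h i)" "continuous_on S t" for S i
    unfolding h_def t_def by (intro continuous_intros)+
  have cont\<phi>: "continuous_on S \<phi>" for S
    unfolding \<phi>_def avg_def by (intro continuous_intros conth) auto
  have "continuous_on ?X (\<lambda>x. \<phi> (f x))" "continuous_on ?X (\<lambda>x. t (f x))"
    using f(1) by (auto intro!: continuous_on_compose2[OF cont\<phi>[of UNIV]] continuous_on_compose2[OF conth(2)[of UNIV]])
  note cont = this
  have cont\<psi>: "continuous_on ?X \<psi>" "continuous_on ?X B"
    unfolding \<psi>_def B_def avg_def using cont by (auto intro!: continuous_intros)
  have "homotopic_with_canon (\<lambda>x. True) ?X (- {0}) (\<lambda>x. \<phi> (f x)) \<psi>"
    using seg1 cont cont\<psi> by (intro homotopic_with_linear) auto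
  moreover have "homotopic_with_canon (\<lambda>x. True) ?X (- {0}) \<psi> B"
    using seg2 cont\<psi> by (intro homotopic_with_linear) auto
  ultimately have "homotopic_with_canon (\<lambda>x. True) ?X (- {0}) (\<lambda>x. \<phi> (f x)) B"
    by (rule homotopic_with_trans)
  moreover have "\<not> homotopic_with_canon (\<lambda>x. True) ?X (- {0}) (\<lambda>x. \<phi> (f x)) B"
  proof (rule no_sphere_factorization[OF f(1)])
    have "compact (f ` ?X)" by (rule compact_continuous_image[OF f(1)]) simp
    then show "\<not> bounded c" if "c \<in> components (- f ` ?X)" for c
      using f(2) that by (rule unbounded_components_compl_normal_codes)
    show "\<phi> (f x) \<noteq> 0" if "x \<in> ?X" for x
      using subsetD[OF seg1[OF that] ends_in_segment(1)] by simp
    show lin: "linear B"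
      by (rule linearI) (simp_all add: B_def vec_eq_iff avg algebra_simps)
    show "inj B"
      unfolding linear_injective_0[OF lin]
    proof (intro allI impI)
      fix x assume "B x = 0"
      then have B0: "B x $ i = 0" for i by simp
      have x: "x $ i = 2 * avg (\<lambda>i. x $ i)" for i
        using B0[of i] unfolding B_def vec_lambda_beta by linarith
      have c: "\<forall>i j. x $ i = x $ j" using trans[OF x x[symmetric]] by blast
      have "x $ 1 = 0" using x[of 1] unfolding avgx[OF c] by linarith
      then have "x $ i = 0" for i using c[rule_format, of i 1] by simp
      then show "x = 0" by (simp add: vec_eq_iff)
    qed
  qed (auto intro: cont\<phi>)
  ultimately show False by blast
qed

section \<open>Cones of directions\<close>

lemma Helly_indexed:
  fixes f :: "'i \<Rightarrow> 'a::euclidean_space set"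
  assumes I: "finite I" and cvx: "\<And>i. i \<in> I \<Longrightarrow> convex (f i)"
    and int: "\<And>J. J \<subseteq> I \<Longrightarrow> card J \<le> DIM('a) + 1 \<Longrightarrow> (\<Inter>i\<in>J. f i) \<noteq> {}"
  shows "(\<Inter>i\<in>I. f i) \<noteq> {}"
proof -
  have small: "\<Inter>T \<noteq> {}" if T: "T \<subseteq> f ` I" "card T \<le> DIM('a) + 1" for T
  proof -
    obtain J where "J \<subseteq> I" "inj_on f J" "T = f ` J" using T(1) by (auto simp: subset_image_inj)
    then show ?thesis using int[of J] T(2) by (auto simp: card_image)
  qed
  show ?thesis
  proof (cases "card (f ` I) \<le> DIM('a) + 1")
    case True
    then show ?thesis using small[of "f ` I"] by simp
  next
    case False
    show ?thesis
    proof (rule Helly)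
      show "DIM('a) + 1 \<le> card (f ` I)" using False by simp
      show "\<forall>s\<in>f ` I. convex s" using cvx by blast
      show "\<Inter>T \<noteq> {}" if "T \<subseteq> f ` I" "card T = DIM('a) + 1" for T
        using small that by simp
    qed
  qed
qed

text \<open>\<open>L\<close> is the quotient by the line of \<open>w\<close> and \<open>M\<close>
  its section orthogonal to \<open>w\<close>. The plane is taken to be the complex numbers because
  winding numbers will be computed in it.\<close>

lemma complement_plane_coordinates:
  fixes w :: "real^3"
  assumes "w \<noteq> 0"
  obtains L :: "real^3 \<Rightarrow> complex" and M :: "complex \<Rightarrow> real^3"
  where "linear L" "linear M" "\<And>c. L (M c) = c" "\<And>c. w \<bullet> M c = 0" "L w = 0"
    "\<And>x. L x = 0 \<Longrightarrow> \<exists>t. x = t *\<^sub>R w"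
proof -
  let ?W = "{x. w \<bullet> x = 0}"
  have dim: "dim ?W = dim (UNIV :: complex set)" using dim_hyperplane[OF assms] by simp
  obtain f :: "real^3 \<Rightarrow> complex" and g where fg: "linear f" "linear g" "f ` ?W = UNIV" "g ` UNIV = ?W"
    "\<And>x. x \<in> ?W \<Longrightarrow> g (f x) = x" "\<And>y. y \<in> UNIV \<Longrightarrow> f (g y) = y"
    by (rule isometries_subspaces[OF subspace_hyperplane[of w] subspace_UNIV dim]) blast
  define p where "p x = x - ((w \<bullet> x) / (w \<bullet> w)) *\<^sub>R w" for x
  have pW: "p x \<in> ?W" for x using assms by (simp add: p_def inner_diff_right)
  have gW: "w \<bullet> g c = 0" for c using fg(4) by blast
  show ?thesis
  proof
    have "linear p"
      by (rule linearI) (simp_all add: p_def algebra_simps inner_add_right add_divide_distrib)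
    then show "linear (f \<circ> p)" using fg(1) by (rule linear_compose)
    show "(f \<circ> p) (g c) = c" for c using fg gW by (simp add: p_def)
    show "(f \<circ> p) w = 0" using assms linear_0[OF fg(1)] by (simp add: p_def)
    show "\<exists>t. x = t *\<^sub>R w" if "(f \<circ> p) x = 0" for x
    proof -
      have "p x = 0" using that fg(5)[OF pW[of x]] linear_0[OF fg(2)] by simp
      then show ?thesis by (auto simp: p_def)
    qed
  qed (use fg gW in auto)
qed

lemma Helly_parallel_lines:
  fixes d :: "real^3"
  assumes "finite H" "\<And>A. A \<in> H \<Longrightarrow> convex A" "d \<noteq> 0"
    and sub: "\<And>T. T \<subseteq> H \<Longrightarrow> card T \<le> 3 \<Longrightarrow> \<exists>z. \<forall>A\<in>T. hits z d A"
  shows "\<exists>z. \<forall>A\<in>H. hits z d A"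
proof -
  obtain L :: "real^3 \<Rightarrow> complex" and M where L: "linear L" "L d = 0" "\<And>x. L x = 0 \<Longrightarrow> \<exists>t. x = t *\<^sub>R d"
    and M: "\<And>c. L (M c) = c"
    using complement_plane_coordinates[OF assms(3)] by metis
  have hits: "hits z d A \<longleftrightarrow> L z \<in> L ` A" for z A
  proof
    assume "hits z d A"
    then obtain t where "z + t *\<^sub>R d \<in> A" by (auto simp: hits_def)
    moreover have "L (z + t *\<^sub>R d) = L z" using L by (simp add: linear_add linear_scale)
    ultimately show "L z \<in> L ` A" by (metis imageI)
  next
    assume "L z \<in> L ` A"
    then obtain a where "a \<in> A" "L (a - z) = 0" using L(1) by (auto simp: linear_diff)
    then obtain t where "a - z = t *\<^sub>R d" using L(3) by blast
    then have "z + t *\<^sub>R d = a" by (simp add: algebra_simps)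
    then show "hits z d A" using \<open>a \<in> A\<close> by (auto simp: hits_def)
  qed
  have "(\<Inter>A\<in>H. L ` A) \<noteq> {}"
  proof (rule Helly_indexed[OF assms(1)])
    show "convex (L ` A)" if "A \<in> H" for A
      using convex_linear_image[OF L(1)] assms(2) that by blast
    show "(\<Inter>A\<in>T. L ` A) \<noteq> {}" if T: "T \<subseteq> H" "card T \<le> DIM(complex) + 1" for T
    proof -
      obtain z where "\<forall>A\<in>T. L z \<in> L ` A" using sub[of T] T unfolding hits by auto
      then have "L z \<in> (\<Inter>A\<in>T. L ` A)" by blast
      then show ?thesis by blast
    qed
  qed
  then obtain c where "\<forall>A\<in>H. c \<in> L ` A" by blast
  then show ?thesis unfolding hits using M[of c] by (intro exI[of _ "M c"]) simp
qed

text \<open>The positive cone over the difference set of \<open>B\<close> and \<open>A\<close>: the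
  directions in which some oriented line passes a point of \<open>A\<close> and later a point of
  \<open>B\<close>.\<close>

definition dir_cone :: "'a::real_normed_vector set \<Rightarrow> 'a set \<Rightarrow> 'a set" where
  "dir_cone A B = {t *\<^sub>R (b - a) | t a b. t > 0 \<and> a \<in> A \<and> b \<in> B}"

lemma convex_dir_cone:
  assumes "convex A" "convex B"
  shows "convex (dir_cone A B)"
proof (rule convexI)
  fix x y :: 'a and u v :: real
  assume "x \<in> dir_cone A B" "y \<in> dir_cone A B" and uv: "0 \<le> u" "0 \<le> v" "u + v = 1"
  then obtain t a b s a' b' where x: "x = t *\<^sub>R (b - a)" "t > 0" "a \<in> A" "b \<in> B"
    and y: "y = s *\<^sub>R (b' - a')" "s > 0" "a' \<in> A" "b' \<in> B" unfolding dir_cone_def by blast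
  define r where "r = u * t + v * s"
  have r: "r > 0"
  proof (cases "u = 0")
    case True then show ?thesis using uv y by (simp add: r_def)
  next
    case False then show ?thesis using uv x y by (simp add: r_def add_pos_nonneg)
  qed
  have c: "u * t / r \<ge> 0" "v * s / r \<ge> 0" "u * t / r + v * s / r = 1"
    using r uv x y by (auto simp: r_def add_divide_distrib[symmetric])
  define b'' where "b'' = (u * t / r) *\<^sub>R b + (v * s / r) *\<^sub>R b'"
  define a'' where "a'' = (u * t / r) *\<^sub>R a + (v * s / r) *\<^sub>R a'"
  have "b'' \<in> B" "a'' \<in> A" unfolding a''_def b''_def using x y c assms by (auto intro: convexD)
  moreover have "u *\<^sub>R x + v *\<^sub>R y = r *\<^sub>R (b'' - a'')"
    using r by (simp add: x y a''_def b''_def scaleR_diff_right scaleR_add_right)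
  ultimately show "u *\<^sub>R x + v *\<^sub>R y \<in> dir_cone A B" using r unfolding dir_cone_def by blast
qed

lemma open_dir_cone: "open B \<Longrightarrow> open (dir_cone A B)"
proof -
  assume "open B"
  then have "open ((*\<^sub>R) t ` ((\<lambda>b. - a + b) ` B))" if "t > 0" for t a
    using that by (intro open_scaling open_translation) auto
  then have "open (\<Union>t\<in>{0<..}. \<Union>a\<in>A. (*\<^sub>R) t ` ((\<lambda>b. - a + b) ` B))" by auto
  also have "(\<Union>t\<in>{0<..}. \<Union>a\<in>A. (*\<^sub>R) t ` ((\<lambda>b. - a + b) ` B)) = dir_cone A B"
    by (auto simp: dir_cone_def image_iff)
  finally show ?thesis .
qed

lemma dir_cone_scale:
  assumes "c > 0" "d \<in> dir_cone A B" shows "c *\<^sub>R d \<in> dir_cone A B"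
proof -
  obtain t a b where "d = t *\<^sub>R (b - a)" "t > 0" "a \<in> A" "b \<in> B"
    using assms unfolding dir_cone_def by blast
  then show ?thesis unfolding dir_cone_def using assms(1)
    by (intro CollectI exI[of _ "c * t"] exI[of _ a] exI[of _ b]) simp
qed

lemma dir_cone_minus: "- d \<in> dir_cone A B \<longleftrightarrow> d \<in> dir_cone B A"
proof -
  have "- d \<in> dir_cone A B" if d: "d \<in> dir_cone B A" for d :: 'a and A B
  proof -
    obtain t a b where "d = t *\<^sub>R (a - b)" "t > 0" "a \<in> A" "b \<in> B"
      using d unfolding dir_cone_def by blast
    then show ?thesis unfolding dir_cone_def
      by (intro CollectI exI[of _ t] exI[of _ a] exI[of _ b]) (simp add: scaleR_diff_right)
  qed
  from this[of d B A] this[of "- d" A B] show ?thesis by auto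
qed

lemma zero_notin_dir_cone: "A \<inter> B = {} \<Longrightarrow> 0 \<notin> dir_cone A B"
  by (auto simp: dir_cone_def)

text \<open>Otherwise \<open>d\<close> and \<open>- d\<close> would lie in one convex cone, and so
  would their midpoint 0, which forces a common point of \<open>A\<close> and
  \<open>B\<close>.\<close>

lemma dir_cone_asym:
  assumes "convex A" "convex B" "A \<inter> B = {}" "d \<in> dir_cone A B"
  shows "d \<notin> dir_cone B A"
proof
  assume "d \<in> dir_cone B A"
  then have "- d \<in> dir_cone A B" by (simp add: dir_cone_minus)
  then have "(1/2) *\<^sub>R d + (1/2) *\<^sub>R (- d) \<in> dir_cone A B"
    using assms convex_dir_cone[OF assms(1,2)] by (intro convexD) auto
  then show False using zero_notin_dir_cone[OF assms(3)] by simp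
qed

lemma dir_coneI:
  assumes "z + s *\<^sub>R d \<in> A" "z + t *\<^sub>R d \<in> B" "s < t"
  shows "d \<in> dir_cone A B"
  unfolding dir_cone_def using assms
  by (intro CollectI exI[of _ "1 / (t - s)"] exI[of _ "z + s *\<^sub>R d"] exI[of _ "z + t *\<^sub>R d"])
    (simp add: scaleR_diff_left[symmetric])

lemma dir_cone_hits:
  assumes "d \<in> dir_cone A B" obtains z where "hits z d A" "hits z d B"
proof -
  obtain t a b where d: "d = t *\<^sub>R (b - a)" "t > 0" "a \<in> A" "b \<in> B"
    using assms unfolding dir_cone_def by blast
  then have "a + 0 *\<^sub>R d \<in> A" "a + (1 / t) *\<^sub>R d \<in> B" by auto
  then show ?thesis using that unfolding hits_def by blast
qed

section \<open>Lines through three sets in a given order\<close>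

definition middle_dirs :: "'a::real_normed_vector set \<Rightarrow> 'a set \<Rightarrow> 'a set \<Rightarrow> 'a set" where
  "middle_dirs X Y Z = {d. \<exists>b\<in>Y. d \<in> dir_cone X {b} \<inter> dir_cone {b} Z}"

lemma dir_cone_singleton:
  "d \<in> dir_cone {b} Z \<longleftrightarrow> (\<exists>t>0. b + t *\<^sub>R d \<in> Z)" "d \<in> dir_cone X {b} \<longleftrightarrow> (\<exists>t>0. b - t *\<^sub>R d \<in> X)"
proof -
  have 1: "d \<in> dir_cone {b} Z \<longleftrightarrow> (\<exists>t>0. b + t *\<^sub>R d \<in> Z)" for d b :: 'a and Z
  proof
    assume "d \<in> dir_cone {b} Z"
    then obtain t c where "d = t *\<^sub>R (c - b)" "t > 0" "c \<in> Z" by (auto simp: dir_cone_def)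
    then show "\<exists>t>0. b + t *\<^sub>R d \<in> Z" by (intro exI[of _ "1 / t"]) auto
  next
    assume "\<exists>t>0. b + t *\<^sub>R d \<in> Z"
    then obtain t where "t > 0" "b + t *\<^sub>R d \<in> Z" by blast
    then show "d \<in> dir_cone {b} Z" using dir_coneI[of b 0 d "{b}" t Z] by simp
  qed
  show "d \<in> dir_cone {b} Z \<longleftrightarrow> (\<exists>t>0. b + t *\<^sub>R d \<in> Z)" by (rule 1)
  show "d \<in> dir_cone X {b} \<longleftrightarrow> (\<exists>t>0. b - t *\<^sub>R d \<in> X)"
    using 1[of "- d" b X] dir_cone_minus[of d "{b}" X] by simp
qed

lemma convex_dir_cone_vertices:
  assumes "convex Z" shows "convex {b. d \<in> dir_cone {b} Z}"
proof (rule convexI, clarsimp simp: dir_cone_singleton)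
  fix x y t s and u v :: real
  assume *: "0 \<le> u" "0 \<le> v" "u + v = 1" "t > 0" "x + t *\<^sub>R d \<in> Z" "s > 0" "y + s *\<^sub>R d \<in> Z"
  have "u * t + v * s > 0"
  proof (cases "u = 0")
    case False then show ?thesis using * by (simp add: add_pos_nonneg)
  qed (use * in simp)
  moreover have "u *\<^sub>R (x + t *\<^sub>R d) + v *\<^sub>R (y + s *\<^sub>R d) \<in> Z"
    using assms * by (intro convexD) auto
  ultimately show "\<exists>r>0. u *\<^sub>R x + v *\<^sub>R y + r *\<^sub>R d \<in> Z"
    by (intro exI[of _ "u * t + v * s"]) (simp add: algebra_simps)
qed

text \<open>Such \<open>b\<close> are exactly the combinations of a point of \<open>X\<close> and a
  point of \<open>Z\<close> with positive weights. In a convex combination of two of them the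
  \<open>X\<close> parts and the \<open>Z\<close> parts are collected separately, with total weights
  \<open>P\<close> and \<open>Q\<close>.\<close>

lemma convex_open_join:
  assumes "convex X" "convex Z"
  shows "convex {b. dir_cone X {b} \<inter> dir_cone {b} Z \<noteq> {}}"
proof -
  have eq: "dir_cone X {b} \<inter> dir_cone {b} Z \<noteq> {} \<longleftrightarrow>
      (\<exists>x\<in>X. \<exists>z\<in>Z. \<exists>p>0. \<exists>q>0. p + q = 1 \<and> b = p *\<^sub>R x + q *\<^sub>R z)" for b :: 'a
  proof
    assume "dir_cone X {b} \<inter> dir_cone {b} Z \<noteq> {}"
    then obtain d s t where d: "s > 0" "b - s *\<^sub>R d \<in> X" "t > 0" "b + t *\<^sub>R d \<in> Z"
      by (auto simp: dir_cone_singleton)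
    have "b = (t / (s + t)) *\<^sub>R (b - s *\<^sub>R d) + (s / (s + t)) *\<^sub>R (b + t *\<^sub>R d)"
    proof -
      have "(t / (s + t)) *\<^sub>R (b - s *\<^sub>R d) + (s / (s + t)) *\<^sub>R (b + t *\<^sub>R d)
        = (t / (s + t) + s / (s + t)) *\<^sub>R b" by (simp add: algebra_simps)
      also have "t / (s + t) + s / (s + t) = 1"
        using d by (simp add: add_divide_distrib[symmetric])
      finally show ?thesis by simp
    qed
    moreover have "t / (s + t) + s / (s + t) = 1" "t / (s + t) > 0" "s / (s + t) > 0"
      using d by (auto simp: add_divide_distrib[symmetric])
    ultimately show "\<exists>x\<in>X. \<exists>z\<in>Z. \<exists>p>0. \<exists>q>0. p + q = 1 \<and> b = p *\<^sub>R x + q *\<^sub>R z"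
      using d by blast
  next
    assume "\<exists>x\<in>X. \<exists>z\<in>Z. \<exists>p>0. \<exists>q>0. p + q = 1 \<and> b = p *\<^sub>R x + q *\<^sub>R z"
    then obtain x z p q where *: "x \<in> X" "z \<in> Z" "p > 0" "q > 0" "p + q = 1" "b = p *\<^sub>R x + q *\<^sub>R z"
      by blast
    have p: "p = 1 - q" using * by simp
    have "b - q *\<^sub>R (z - x) = x" "b + p *\<^sub>R (z - x) = z"
      by (simp_all add: *(6) p algebra_simps)
    then have "z - x \<in> dir_cone X {b} \<inter> dir_cone {b} Z"
      using * by (auto simp: dir_cone_singleton)
    then show "dir_cone X {b} \<inter> dir_cone {b} Z \<noteq> {}" by blast
  qed
  show ?thesis
    unfolding eq
  proof (rule convexI)
    fix b b' :: 'a and u v :: real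
    assume "b \<in> {b. \<exists>x\<in>X. \<exists>z\<in>Z. \<exists>p>0. \<exists>q>0. p + q = 1 \<and> b = p *\<^sub>R x + q *\<^sub>R z}"
      "b' \<in> {b. \<exists>x\<in>X. \<exists>z\<in>Z. \<exists>p>0. \<exists>q>0. p + q = 1 \<and> b = p *\<^sub>R x + q *\<^sub>R z}"
      and uv: "0 \<le> u" "0 \<le> v" "u + v = 1"
    then obtain x z p q x' z' p' q' where
      b: "x \<in> X" "z \<in> Z" "p > 0" "q > 0" "p + q = 1" "b = p *\<^sub>R x + q *\<^sub>R z" and
      b': "x' \<in> X" "z' \<in> Z" "p' > 0" "q' > 0" "p' + q' = 1" "b' = p' *\<^sub>R x' + q' *\<^sub>R z'"
      by blast
    define P where "P = u * p + v * p'"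
    define Q where "Q = u * q + v * q'"
    have PQ: "P > 0" "Q > 0"
      unfolding P_def Q_def using uv b b'
      by (cases "u = 0"; simp add: add_pos_nonneg)+
    have sum: "P + Q = 1"
    proof -
      have "P + Q = u * (p + q) + v * (p' + q')" by (simp add: P_def Q_def algebra_simps)
      then show ?thesis using b b' uv by simp
    qed
    have "(u * p / P) *\<^sub>R x + (v * p' / P) *\<^sub>R x' \<in> X"
      using assms(1) b b' uv PQ by (intro convexD) (auto simp: add_divide_distrib[symmetric] P_def)
    moreover have "(u * q / Q) *\<^sub>R z + (v * q' / Q) *\<^sub>R z' \<in> Z"
      using assms(2) b b' uv PQ by (intro convexD) (auto simp: add_divide_distrib[symmetric] Q_def)
    moreover have "u *\<^sub>R b + v *\<^sub>R b' = P *\<^sub>R ((u * p / P) *\<^sub>R x + (v * p' / P) *\<^sub>R x')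
        + Q *\<^sub>R ((u * q / Q) *\<^sub>R z + (v * q' / Q) *\<^sub>R z')"
      using PQ by (simp add: b b' scaleR_add_right algebra_simps)
    ultimately show "u *\<^sub>R b + v *\<^sub>R b' \<in> {b. \<exists>x\<in>X. \<exists>z\<in>Z. \<exists>p>0. \<exists>q>0. p + q = 1 \<and> b = p *\<^sub>R x + q *\<^sub>R z}"
      using PQ sum by blast
  qed
qed

text \<open>In the relation between middle points \<open>b\<close> and directions \<open>d\<close>
  both fibres, \<open>Q b\<close> and \<open>C d\<close>, are convex. Selections \<beta> from
  directions to points and \<delta> back therefore exist, and \<open>d\<close> is joined to
  \<open>\<delta> (\<beta> d)\<close> by a segment inside \<open>Q (\<beta> d)\<close>. So the
  identity factors up to homotopy through the convex set \<open>B\<close> of points.\<close>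

lemma contractible_middle_dirs:
  fixes X Y Z :: "'a::euclidean_space set"
  assumes "convex X" "convex Y" "convex Z" "open X" "open Y" "open Z"
  shows "contractible (middle_dirs X Y Z)"
proof -
  define E where "E = middle_dirs X Y Z"
  define Q where "Q b = dir_cone X {b} \<inter> dir_cone {b} Z" for b
  define B where "B = Y \<inter> {b. Q b \<noteq> {}}"
  define C where "C d = {b \<in> Y. d \<in> Q b}" for d
  have "convex B" unfolding B_def Q_def using assms by (intro convex_Int convex_open_join)
  have cQ: "convex (Q b)" for b
    unfolding Q_def using assms by (intro convex_Int convex_dir_cone) auto
  have cC: "convex (C d)" for d
  proof -
    have "C d = Y \<inter> ({b. d \<in> dir_cone X {b}} \<inter> {b. d \<in> dir_cone {b} Z})" by (auto simp: C_def Q_def)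
    moreover have "{b. d \<in> dir_cone X {b}} = {b. - d \<in> dir_cone {b} X}"
      by (simp add: dir_cone_minus)
    ultimately show ?thesis using assms by (auto intro!: convex_Int convex_dir_cone_vertices)
  qed
  obtain \<beta> where \<beta>: "continuous_on E \<beta>" "\<And>d. d \<in> E \<Longrightarrow> \<beta> d \<in> C d"
  proof (rule convex_valued_selection[of E C])
    fix d assume "d \<in> E"
    then obtain b s t where b: "b \<in> Y" "s > 0" "b - s *\<^sub>R d \<in> X" "t > 0" "b + t *\<^sub>R d \<in> Z"
      by (auto simp: E_def middle_dirs_def dir_cone_singleton)
    have "open ((\<lambda>d. b - s *\<^sub>R d) -` X \<inter> (\<lambda>d. b + t *\<^sub>R d) -` Z)"
      using assms by (intro open_Int open_vimage continuous_intros) auto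
    then show "\<exists>y U. open U \<and> d \<in> U \<and> (\<forall>d'\<in>E \<inter> U. y \<in> C d')"
      using b by (intro exI[of _ b] exI[of _ "(\<lambda>d. b - s *\<^sub>R d) -` X \<inter> (\<lambda>d. b + t *\<^sub>R d) -` Z"])
        (auto simp: C_def Q_def dir_cone_singleton)
  qed (use cC in auto)
  obtain \<delta> where \<delta>: "continuous_on B \<delta>" "\<And>b. b \<in> B \<Longrightarrow> \<delta> b \<in> Q b"
  proof (rule convex_valued_selection[of B Q])
    fix b assume "b \<in> B"
    then obtain d s t where b: "b \<in> Y" "s > 0" "b - s *\<^sub>R d \<in> X" "t > 0" "b + t *\<^sub>R d \<in> Z"
      by (auto simp: B_def Q_def dir_cone_singleton)
    have "open ((\<lambda>b. b - s *\<^sub>R d) -` X \<inter> (\<lambda>b. b + t *\<^sub>R d) -` Z)"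
      using assms by (intro open_Int open_vimage continuous_intros) auto
    then show "\<exists>y U. open U \<and> b \<in> U \<and> (\<forall>b'\<in>B \<inter> U. y \<in> Q b')"
      using b by (intro exI[of _ d] exI[of _ "(\<lambda>b. b - s *\<^sub>R d) -` X \<inter> (\<lambda>b. b + t *\<^sub>R d) -` Z"])
        (auto simp: Q_def dir_cone_singleton)
  qed (use cQ in auto)
  have QE: "Q b \<subseteq> E" if "b \<in> Y" for b using that by (auto simp: Q_def E_def middle_dirs_def)
  have \<beta>B: "\<beta> d \<in> B" "d \<in> Q (\<beta> d)" if "d \<in> E" for d using \<beta>(2)[OF that] by (auto simp: B_def C_def)
  have BY: "B \<subseteq> Y" by (auto simp: B_def)
  have "homotopic_with_canon (\<lambda>x. True) E E id (\<delta> \<circ> \<beta>)"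
  proof (rule homotopic_with_linear)
    show "continuous_on E (\<delta> \<circ> \<beta>)"
      using \<beta>B by (intro continuous_on_compose[OF \<beta>(1)] continuous_on_subset[OF \<delta>(1)]) auto
    show "closed_segment (id d) ((\<delta> \<circ> \<beta>) d) \<subseteq> E" if "d \<in> E" for d
    proof -
      have "closed_segment d (\<delta> (\<beta> d)) \<subseteq> Q (\<beta> d)"
        using \<beta>B[OF that] \<delta>(2) cQ by (intro closed_segment_subset) auto
      then show ?thesis using QE \<beta>B[OF that] BY by auto
    qed
  qed (simp add: continuous_on_id)
  moreover obtain c where "homotopic_with_canon (\<lambda>x. True) E E (\<delta> \<circ> \<beta>) (\<lambda>x. c)"
  proof (rule nullhomotopic_through_contractible[of E \<beta> B \<delta> E])
    show "\<beta> \<in> E \<rightarrow> B" using \<beta>B by blast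
    show "\<delta> \<in> B \<rightarrow> E" using \<delta>(2) QE BY by blast
    show "contractible B" using \<open>convex B\<close> by (rule convex_imp_contractible)
  qed (use \<beta> \<delta> in auto)
  ultimately have "homotopic_with_canon (\<lambda>x. True) E E id (\<lambda>x. c)" by (rule homotopic_with_trans)
  then show ?thesis unfolding contractible_def E_def by blast
qed

text \<open>The cone deforms to its section \<open>P\<close> by the plane
  \<open>w \<bullet> d = 1\<close>, a connected open plane set. It is simply connected if loops have
  winding number 0 about each missing point \<open>z\<close>. A loop contracts inside the larger
  \<open>Q\<close>, and a map vanishing only on the line of the missing direction transports this
  contraction to the punctured plane. A simply connected open plane set is empty or a disc.\<close>

lemma contractible_cone_if_connected:
  fixes E :: "(real^3) set"
  assumes "open E" "connected E" and cone: "\<And>c d. c > 0 \<Longrightarrow> d \<in> E \<Longrightarrow> c *\<^sub>R d \<in> E"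
    and w: "\<And>d. d \<in> E \<Longrightarrow> w \<bullet> d > 0"
    and obst: "\<And>z. w \<bullet> z > 0 \<Longrightarrow> z \<notin> E \<Longrightarrow> \<exists>Q. E \<subseteq> Q \<and> contractible Q \<and> (\<forall>t. t *\<^sub>R z \<notin> Q)"
  shows "contractible E"
proof (cases "E = {}")
  case False
  then obtain d0 where "d0 \<in> E" by blast
  then have w0: "w \<noteq> 0" using w by force
  obtain L M where L: "linear L" "linear M" "\<And>c::complex. L (M c) = c" "\<And>c. w \<bullet> M c = 0" "L w = 0"
    and ker: "\<And>x. L x = 0 \<Longrightarrow> \<exists>t. x = t *\<^sub>R w"
    using complement_plane_coordinates[OF w0] by metis
  have contL: "continuous_on S L" "continuous_on T M" for S T
    using L by (auto simp: linear_continuous_on linear_conv_bounded_linear[symmetric])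
  have inj: "x = y" if "L x = L y" "w \<bullet> x = w \<bullet> y" for x y
  proof -
    have "L (x - y) = 0" using that L(1) by (simp add: linear_diff)
    then obtain t where t: "x - y = t *\<^sub>R w" using ker by blast
    then have "t * (w \<bullet> w) = w \<bullet> (x - y)" by simp
    also have "\<dots> = 0" using that by (simp add: inner_diff_right)
    finally have "t = 0" using w0 by simp
    then show ?thesis using t by simp
  qed
  define \<sigma> where "\<sigma> c = M c + (1 / (w \<bullet> w)) *\<^sub>R w" for c
  have \<sigma>: "L (\<sigma> c) = c" "w \<bullet> \<sigma> c = 1" for c
    using L w0 by (simp_all add: \<sigma>_def linear_add linear_scale inner_add_right)
  have cont\<sigma>: "continuous_on S \<sigma>" for S unfolding \<sigma>_def by (intro continuous_intros contL)
  define k where "k d = (1 / (w \<bullet> d)) *\<^sub>R L d" for d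
  have contk: "continuous_on E k"
    unfolding k_def using w by (intro continuous_intros contL) force
  have \<sigma>k: "\<sigma> (k d) = (1 / (w \<bullet> d)) *\<^sub>R d" if "d \<in> E" for d
    using w[OF that] L(1) by (intro inj) (simp_all add: \<sigma> k_def linear_scale)
  have \<sigma>kE: "\<sigma> (k d) \<in> E" if "d \<in> E" for d using \<sigma>k[OF that] cone w that by simp
  define P where "P = \<sigma> -` E"
  have openP: "open P" unfolding P_def using \<open>open E\<close> cont\<sigma> by (intro open_vimage) auto
  have kE: "k ` E = P"
  proof
    show "k ` E \<subseteq> P" using \<sigma>kE by (auto simp: P_def)
    show "P \<subseteq> k ` E"
    proof
      fix c assume "c \<in> P"
      then have "\<sigma> c \<in> E" by (simp add: P_def)
      moreover have "k (\<sigma> c) = c" by (simp add: k_def \<sigma>)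
      ultimately show "c \<in> k ` E" by (metis imageI)
    qed
  qed
  have "simply_connected P"
    unfolding simply_connected_eq_winding_number_zero[OF openP]
  proof (intro conjI allI impI)
    show "connected P" using connected_continuous_image[OF contk \<open>connected E\<close>] kE by simp
    fix g z assume g: "path g \<and> path_image g \<subseteq> P \<and> pathfinish g = pathstart g \<and> z \<notin> P"
    obtain Q where Q: "E \<subseteq> Q" "contractible Q" "\<And>t. t *\<^sub>R \<sigma> z \<notin> Q"
      using obst[of "\<sigma> z"] g \<sigma>(2)[of z] by (auto simp: P_def)
    define \<psi> where "\<psi> d = L d - (w \<bullet> d) *\<^sub>R z" for d
    have cont\<psi>: "continuous_on S \<psi>" for S unfolding \<psi>_def by (intro continuous_intros contL)
    have \<psi>0: "\<psi> d \<noteq> 0" if "d \<in> Q" for d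
    proof
      assume "\<psi> d = 0"
      then have "d = (w \<bullet> d) *\<^sub>R \<sigma> z"
        using L(1) by (intro inj) (simp_all add: \<psi>_def linear_scale \<sigma>)
      then show False using Q(3) that by metis
    qed
    have g': "path (\<sigma> \<circ> g)" "path_image (\<sigma> \<circ> g) \<subseteq> Q" "pathfinish (\<sigma> \<circ> g) = pathstart (\<sigma> \<circ> g)"
      using g cont\<sigma> Q(1) by (auto simp: path_image_compose pathfinish_compose pathstart_compose P_def
          intro!: path_continuous_image)
    obtain a where a: "a \<in> Q" using Q(1) False by blast
    have "homotopic_loops Q (\<sigma> \<circ> g) (linepath a a)"
      using contractible_imp_simply_connected[OF Q(2)] g' a
      unfolding simply_connected_eq_contractible_loop_any by blast
    then have "homotopic_loops (- {0}) (\<psi> \<circ> (\<sigma> \<circ> g)) (\<psi> \<circ> linepath a a)"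
      by (rule homotopic_loops_continuous_image[OF _ cont\<psi>]) (use \<psi>0 in auto)
    then have "winding_number (\<psi> \<circ> (\<sigma> \<circ> g)) 0 = winding_number (\<psi> \<circ> linepath a a) 0"
      by (rule winding_number_homotopic_loops)
    also have "\<psi> \<circ> linepath a a = linepath (\<psi> a) (\<psi> a)" by (auto simp: linepath_refl)
    also have "winding_number (linepath (\<psi> a) (\<psi> a)) 0 = 0"
      using \<psi>0[OF a] by (intro winding_number_trivial) auto
    also have "\<psi> \<circ> (\<sigma> \<circ> g) = (\<lambda>t. g t - z)" by (auto simp: \<psi>_def \<sigma>)
    finally show "winding_number g z = 0" by (simp add: winding_number_offset[of g z])
  qed
  then have "P = {} \<or> P homeomorphic ball (0::complex) 1"
    using simply_connected_eq_homeomorphic_to_disc[OF openP] by blast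
  then have cP: "contractible P"
    using homeomorphic_contractible convex_imp_contractible[OF convex_ball] homeomorphic_sym
      contractible_empty by metis
  have "homotopic_with_canon (\<lambda>x. True) E E id (\<sigma> \<circ> k)"
  proof (rule homotopic_with_linear)
    show "continuous_on E (\<sigma> \<circ> k)" by (intro continuous_on_compose contk cont\<sigma>)
    fix d assume d: "d \<in> E"
    show "closed_segment (id d) ((\<sigma> \<circ> k) d) \<subseteq> E"
    proof
      fix y assume "y \<in> closed_segment (id d) ((\<sigma> \<circ> k) d)"
      then obtain u where u: "0 \<le> u" "u \<le> 1" "y = (1 - u) *\<^sub>R d + u *\<^sub>R ((1 / (w \<bullet> d)) *\<^sub>R d)"
        using \<sigma>k[OF d] by (auto simp: closed_segment_def)
      have "(1 - u) + u / (w \<bullet> d) > 0"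
      proof (cases "u = 1")
        case False then show ?thesis using u w[OF d] by (simp add: add_pos_nonneg)
      qed (use w[OF d] in simp)
      moreover have "y = ((1 - u) + u / (w \<bullet> d)) *\<^sub>R d" by (simp add: u scaleR_add_left)
      ultimately show "y \<in> E" using cone d by simp
    qed
  qed (simp add: continuous_on_id)
  moreover obtain c where "homotopic_with_canon (\<lambda>x. True) E E (\<sigma> \<circ> k) (\<lambda>x. c)"
  proof (rule nullhomotopic_through_contractible[OF contk _ cont\<sigma> _ cP, of E])
    show "k \<in> E \<rightarrow> P" "\<sigma> \<in> P \<rightarrow> E" using kE by (auto simp: P_def)
  qed auto
  ultimately have "homotopic_with_canon (\<lambda>x. True) E E id (\<lambda>x. c)" by (rule homotopic_with_trans)
  then show ?thesis unfolding contractible_def by blast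
qed simp

section \<open>Coherently oriented families\<close>

lemma hits_minus: "hits z (- d) A \<longleftrightarrow> hits z d A"
  using hits_scale[of "- 1" z d A] by simp

lemma hits_point: "a \<in> A \<Longrightarrow> hits a d A"
  unfolding hits_def by (rule exI[of _ 0]) simp

text \<open>For \<open>u \<noteq> 0\<close> the excluded equation says that \<open>d\<close> is a
  nonpositive multiple of \<open>u\<close>, so a closed ray is removed. The result is star-shaped
  about \<open>u\<close>.\<close>

definition punctured_by_ray :: "real^3 \<Rightarrow> (real^3) set" where
  "punctured_by_ray u = {d. norm d *\<^sub>R u + norm u *\<^sub>R d \<noteq> 0}"

lemma open_punctured_by_ray: "open (punctured_by_ray u)"
  unfolding punctured_by_ray_def by (intro open_Collect_neq continuous_intros)

lemma zero_notin_punctured_by_ray: "0 \<notin> punctured_by_ray u"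
  by (simp add: punctured_by_ray_def)

text \<open>If \<open>d\<close> were opposite to \<open>u\<close>, a positive combination of the two
  would put 0 into the convex cone \<open>C\<close>.\<close>

lemma mem_punctured_by_ray:
  assumes "convex C" and cone: "\<And>c d. c > 0 \<Longrightarrow> d \<in> C \<Longrightarrow> c *\<^sub>R d \<in> C"
    and "0 \<notin> C" "u \<in> C" "d \<in> C"
  shows "d \<in> punctured_by_ray u"
proof -
  have "u \<noteq> 0" "d \<noteq> 0" using assms by auto
  then have "(1/2) *\<^sub>R ((2 * norm d) *\<^sub>R u) + (1/2) *\<^sub>R ((2 * norm u) *\<^sub>R d) \<in> C"
    using assms by (intro convexD[OF assms(1)] cone) auto
  then show ?thesis using assms(3) by (auto simp: punctured_by_ray_def)
qed

lemma AR_punctured_by_ray: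
  assumes "u \<noteq> 0"
  shows "AR (punctured_by_ray u)"
proof -
  have u: "u \<in> punctured_by_ray u" using assms by (simp add: punctured_by_ray_def scaleR_2[symmetric])
  have "closed_segment u x \<subseteq> punctured_by_ray u" if x: "x \<in> punctured_by_ray u" for x
  proof
    fix y assume "y \<in> closed_segment u x"
    then obtain s where s: "0 \<le> s" "s \<le> 1" "y = (1 - s) *\<^sub>R u + s *\<^sub>R x"
      by (auto simp: closed_segment_def)
    show "y \<in> punctured_by_ray u"
    proof (cases "s = 0")
      case True then show ?thesis using s u by simp
    next
      case False
      show ?thesis
      proof (rule ccontr)
        assume "\<not> ?thesis"
        then have "norm y *\<^sub>R u + norm u *\<^sub>R y = 0" by (simp add: punctured_by_ray_def)
        then have "(norm u * s) *\<^sub>R x = - ((norm y + norm u * (1 - s)) *\<^sub>R u)"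
          unfolding s(3) by (simp add: algebra_simps eq_neg_iff_add_eq_0)
        then have "(1 / (norm u * s)) *\<^sub>R ((norm u * s) *\<^sub>R x) =
            (1 / (norm u * s)) *\<^sub>R (- ((norm y + norm u * (1 - s)) *\<^sub>R u))" by simp
        then have "x = - (((norm y + norm u * (1 - s)) / (norm u * s)) *\<^sub>R u)"
          using False assms by simp
        moreover define c where "c = (norm y + norm u * (1 - s)) / (norm u * s)"
        ultimately have xc: "x = - (c *\<^sub>R u)" by simp
        have "c \<ge> 0" using s by (simp add: c_def)
        then have "norm x *\<^sub>R u + norm u *\<^sub>R x = 0" by (simp add: xc)
        then show False using x by (simp add: punctured_by_ray_def)
      qed
    qed
  qed
  then have "contractible (punctured_by_ray u)"
    using u by (intro starlike_imp_contractible) (auto simp: starlike_def)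
  then show ?thesis using u open_punctured_by_ray[of u] by (auto simp: AR_ANR open_imp_ENR ENR_imp_ANR)
qed

lemma AR_open_contractible: "open S \<Longrightarrow> contractible S \<Longrightarrow> S \<noteq> {} \<Longrightarrow> AR S"
  for S :: "'a::euclidean_space set"
  by (simp add: AR_ANR open_imp_ENR ENR_imp_ANR)

lemma open_convex_cone_strict_support:
  fixes C :: "(real^3) set"
  assumes "open C" "convex C" "0 \<notin> C"
  obtains w where "\<And>d. d \<in> C \<Longrightarrow> w \<bullet> d > 0"
proof -
  obtain a where a: "a \<noteq> 0" "\<And>x. x \<in> C \<Longrightarrow> 0 \<le> a \<bullet> x"
    using separating_hyperplane_set_0[OF assms(2,3)] by auto
  have "a \<bullet> d \<noteq> 0" if d: "d \<in> C" for d
  proof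
    assume ad: "a \<bullet> d = 0"
    obtain e where e: "e > 0" "ball d e \<subseteq> C" using assms(1) d open_contains_ball by blast
    \<comment> \<open>Openness leaves room for a small step against \<open>a\<close>, which would
      make the inner product negative.\<close>
    have "d - (e / (2 * norm a)) *\<^sub>R a \<in> ball d e" using a e by (simp add: dist_norm)
    then have "0 \<le> a \<bullet> (d - (e / (2 * norm a)) *\<^sub>R a)" using a e by blast
    then have "(e / (2 * norm a)) * (a \<bullet> a) \<le> 0" by (simp add: inner_diff_right ad)
    moreover have "(e / (2 * norm a)) * (a \<bullet> a) > 0" using a e by simp
    ultimately show False by linarith
  qed
  then show ?thesis using a(2) that[of a] by (simp add: less_le)
qed

text \<open>The cone \<open>E H\<close> of the overview, with \<open>R\<close> as the order of the
  sets. Constraining \<open>d\<close> alone suffices: if \<open>A\<close> and \<open>B\<close> are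
  disjoint and convex and \<open>d \<in> dir_cone A B\<close>, every line of direction
  \<open>d\<close> meeting both meets \<open>A\<close> first.\<close>

definition dirs :: "((real^3) set \<Rightarrow> (real^3) set \<Rightarrow> bool) \<Rightarrow> (real^3) set set \<Rightarrow> (real^3) set" where
  "dirs R H = {d. d \<noteq> 0 \<and> (\<exists>z. \<forall>A\<in>H. hits z d A) \<and> (\<forall>A\<in>H. \<forall>B\<in>H. R A B \<longrightarrow> d \<in> dir_cone A B)}"

lemma dirs_anti: "H \<subseteq> H' \<Longrightarrow> dirs R H' \<subseteq> dirs R H"
  unfolding dirs_def by blast

lemma dirs_scale: "c > 0 \<Longrightarrow> d \<in> dirs R H \<Longrightarrow> c *\<^sub>R d \<in> dirs R H"
  unfolding dirs_def by (auto simp: hits_scale dir_cone_scale)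

lemma open_dirs:
  assumes "finite H" "\<And>A. A \<in> H \<Longrightarrow> open A"
  shows "open (dirs R H)"
proof -
  have "open (- {0::real^3})" by blast
  moreover have "open {d. \<exists>z. \<forall>A\<in>H. hits z d A}"
    unfolding open_subopen[of "{d. \<exists>z. \<forall>A\<in>H. hits z d A}"]
  proof clarify
    fix d z assume "\<forall>A\<in>H. hits z d A"
    then obtain t where t: "\<And>A. A \<in> H \<Longrightarrow> z + t A *\<^sub>R d \<in> A" unfolding hits_def by metis
    let ?T = "\<Inter>A\<in>H. (\<lambda>d. z + t A *\<^sub>R d) -` A"
    have "open ?T" using assms by (intro open_INT) (auto intro!: open_vimage continuous_intros)
    moreover have "?T \<subseteq> {d. \<exists>z. \<forall>A\<in>H. hits z d A}" unfolding hits_def by blast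
    ultimately show "\<exists>T. open T \<and> d \<in> T \<and> T \<subseteq> {d. \<exists>z. \<forall>A\<in>H. hits z d A}"
      using t by (intro exI[of _ ?T]) auto
  qed
  moreover have "open (\<Inter>(A, B)\<in>{(A, B) \<in> H \<times> H. R A B}. dir_cone A B)"
    using assms by (intro open_INT) (auto intro!: open_dir_cone intro: finite_subset[of _ "H \<times> H"])
  moreover have "dirs R H = - {0} \<inter> {d. \<exists>z. \<forall>A\<in>H. hits z d A} \<inter>
      (\<Inter>(A, B)\<in>{(A, B) \<in> H \<times> H. R A B}. dir_cone A B)"
    by (auto simp: dirs_def)
  ultimately show ?thesis by (simp only: open_Int)
qed

text \<open>The open ray through \<open>d\<close> is connected and lies in \<open>S\<close>, so it
  cannot pass from \<open>P\<close> to \<open>Q\<close>.\<close>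

lemma cone_clopen_part:
  fixes S :: "'a::real_normed_vector set"
  assumes "\<And>c d. c > 0 \<Longrightarrow> d \<in> S \<Longrightarrow> c *\<^sub>R d \<in> S"
    and "open P" "open Q" "P \<inter> Q = {}" "P \<union> Q = S" "d \<in> P" "c > 0"
  shows "c *\<^sub>R d \<in> P"
proof (rule ccontr)
  assume "c *\<^sub>R d \<notin> P"
  then have cQ: "c *\<^sub>R d \<in> Q" using assms by blast
  let ?r = "(\<lambda>s. s *\<^sub>R d) ` {0<..}"
  have "connected ?r" by (intro connected_continuous_image continuous_intros) auto
  moreover have "?r \<subseteq> P \<union> Q" using assms by auto
  moreover have "c *\<^sub>R d \<in> ?r" "1 *\<^sub>R d \<in> ?r" using assms(7) by (intro imageI; simp)+
  ultimately show False
    using connectedD[of ?r P Q] assms cQ by (metis IntI empty_iff inf_bot_left scaleR_one)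
qed

text \<open>\<open>R\<close> tells which of two sets coherently oriented lines meet first.
  Transitivity is not an axiom; the order of three sets is read off a line that meets them.
  \<open>four\<close> is already stated for cones of directions instead of spaces of unoriented
  lines.\<close>

locale oriented_family =
  fixes F :: "(real^3) set set" and R :: "(real^3) set \<Rightarrow> (real^3) set \<Rightarrow> bool"
  assumes finF: "finite F" and cardF: "card F \<ge> 5"
    and disj: "\<And>A B. A \<in> F \<Longrightarrow> B \<in> F \<Longrightarrow> A \<noteq> B \<Longrightarrow> A \<inter> B = {}"
    and ocx: "\<And>A. A \<in> F \<Longrightarrow> A \<noteq> {} \<and> open A \<and> convex A"
    and total: "\<And>A B. A \<in> F \<Longrightarrow> B \<in> F \<Longrightarrow> A \<noteq> B \<Longrightarrow> R A B \<or> R B A"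
    and irrefl: "\<And>A. \<not> R A A"
    and orient: "\<And>G z d. G \<subseteq> F \<Longrightarrow> 4 \<le> card G \<Longrightarrow> d \<noteq> 0 \<Longrightarrow> \<forall>A\<in>G. hits z d A \<Longrightarrow>
      (\<forall>A\<in>G. \<forall>B\<in>G. R A B \<longrightarrow> d \<in> dir_cone A B) \<or> (\<forall>A\<in>G. \<forall>B\<in>G. R A B \<longrightarrow> - d \<in> dir_cone A B)"
    and five: "\<And>G. G \<subseteq> F \<Longrightarrow> card G = 5 \<Longrightarrow> \<exists>z d. d \<noteq> 0 \<and> (\<forall>A\<in>G. hits z d A)"
    and four: "\<And>G. G \<subseteq> F \<Longrightarrow> card G = 4 \<Longrightarrow> connected (dirs R G)"
begin

lemma finite_sub: "H \<subseteq> F \<Longrightarrow> finite H"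
  using finF finite_subset by blast

lemma cone_asym: "A \<in> F \<Longrightarrow> B \<in> F \<Longrightarrow> A \<noteq> B \<Longrightarrow> d \<in> dir_cone A B \<Longrightarrow> d \<notin> dir_cone B A"
  using dir_cone_asym[of A B d] disj ocx by blast

lemma cone_nonzero: "A \<in> F \<Longrightarrow> B \<in> F \<Longrightarrow> A \<noteq> B \<Longrightarrow> 0 \<notin> dir_cone A B"
  using zero_notin_dir_cone disj by blast

lemma line_dirs:
  assumes "G \<subseteq> F" "4 \<le> card G" "d \<noteq> 0" "\<forall>A\<in>G. hits z d A"
  shows "d \<in> dirs R G \<or> - d \<in> dirs R G"
proof -
  have "\<forall>A\<in>G. hits z (- d) A" using assms(4) by (simp add: hits_minus)
  then show ?thesis using orient[OF assms] assms(3,4) unfolding dirs_def by auto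
qed

text \<open>The line comes from five sets containing \<open>H\<close>. It can be oriented there by
  \<open>line_dirs\<close>, which would not apply to \<open>H\<close> itself when it has fewer than
  four members.\<close>

lemma small_dirs_nonempty:
  assumes "H \<subseteq> F" "card H \<le> 5" shows "dirs R H \<noteq> {}"
proof -
  obtain G where G: "H \<subseteq> G" "G \<subseteq> F" "card G = 5"
    using exists_subset_between[of H 5 F] assms cardF finF by auto
  then obtain z d where "d \<noteq> 0" "\<forall>A\<in>G. hits z d A" using five by blast
  then have "d \<in> dirs R G \<or> - d \<in> dirs R G" using line_dirs G by simp
  then show ?thesis using dirs_anti[OF G(1)] by blast
qed

lemma dirs_asym:
  assumes "H \<subseteq> F" "2 \<le> card H" "d \<in> dirs R H" shows "- d \<notin> dirs R H"
proof -
  have "\<not> card H \<le> Suc 0" using assms(2) by simp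
  then obtain A B where AB: "A \<in> H" "B \<in> H" "A \<noteq> B"
    using finite_sub[OF assms(1)] by (auto simp: card_le_Suc0_iff_eq)
  then have "R A B \<or> R B A" using total assms(1) by blast
  then obtain A B where AB: "A \<in> H" "B \<in> H" "A \<noteq> B" "R A B" using AB by blast
  then have "d \<in> dir_cone A B" using assms(3) by (simp add: dirs_def)
  then have "d \<notin> dir_cone B A" using cone_asym[of A B d] AB assms(1) by blast
  then show ?thesis using AB dir_cone_minus[of d A B] by (auto simp: dirs_def)
qed

lemma dirs_pair:
  assumes "A \<in> F" "B \<in> F" "A \<noteq> B" "R A B" "\<not> R B A"
  shows "dirs R {A, B} = dir_cone A B"
  using assms irrefl cone_nonzero[OF assms(1-3)]
  by (auto simp: dirs_def elim: dir_cone_hits)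

lemma R_asym:
  assumes "A \<in> F" "B \<in> F" "R A B" shows "\<not> R B A"
proof
  assume "R B A"
  have "A \<noteq> B" using assms irrefl by blast
  have "dirs R {A, B} \<noteq> {}"
    using small_dirs_nonempty[of "{A, B}"] assms(1,2) by (simp add: card_insert_if)
  then obtain d where "d \<in> dirs R {A, B}" by blast
  then show False using cone_asym[OF assms(1,2) \<open>A \<noteq> B\<close>] assms(3) \<open>R B A\<close> by (auto simp: dirs_def)
qed

lemma hits_order:
  assumes "A \<in> F" "B \<in> F" "A \<noteq> B" "z + s *\<^sub>R d \<in> A" "z + t *\<^sub>R d \<in> B" "d \<in> dir_cone A B"
  shows "s < t"
proof (rule ccontr)
  assume "\<not> s < t"
  then consider "s = t" | "t < s" by linarith
  then show False
  proof cases
    case 1 then show ?thesis using assms disj by blast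
  next
    case 2 then show ?thesis using dir_coneI[OF assms(5,4)] cone_asym assms by blast
  qed
qed

lemma dirs_ordered_triple:
  assumes F: "X \<in> F" "Y \<in> F" "Z \<in> F" and ne: "X \<noteq> Y" "Y \<noteq> Z" "X \<noteq> Z"
    and R: "R X Y" "R Y Z" "R X Z"
  shows "dirs R {X, Y, Z} = middle_dirs X Y Z"
proof (intro equalityI subsetI)
  fix d assume d: "d \<in> dirs R {X, Y, Z}"
  then obtain z s t r where st: "z + s *\<^sub>R d \<in> X" "z + t *\<^sub>R d \<in> Y" "z + r *\<^sub>R d \<in> Z"
    by (auto simp: dirs_def hits_def)
  have c: "d \<in> dir_cone X Y" "d \<in> dir_cone Y Z" using d R by (auto simp: dirs_def)
  have "s < t" using hits_order[OF F(1,2) ne(1) st(1,2) c(1)] .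
  moreover have "t < r" using hits_order[OF F(2,3) ne(2) st(2,3) c(2)] .
  ultimately have "d \<in> dir_cone X {z + t *\<^sub>R d} \<inter> dir_cone {z + t *\<^sub>R d} Z"
    using st dir_coneI[of z s d X t "{z + t *\<^sub>R d}"] dir_coneI[of z t d "{z + t *\<^sub>R d}" r Z] by simp
  then show "d \<in> middle_dirs X Y Z" using st(2) unfolding middle_dirs_def by blast
next
  fix d assume "d \<in> middle_dirs X Y Z"
  then obtain b s t where b: "b \<in> Y" "s > 0" "b - s *\<^sub>R d \<in> X" "t > 0" "b + t *\<^sub>R d \<in> Z"
    by (auto simp: middle_dirs_def dir_cone_singleton)
  then have b': "b + (- s) *\<^sub>R d \<in> X" "b + 0 *\<^sub>R d \<in> Y" "b + t *\<^sub>R d \<in> Z" by auto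
  have "d \<in> dir_cone X Y" "d \<in> dir_cone Y Z" "d \<in> dir_cone X Z"
    using b dir_coneI[OF b'(1,2)] dir_coneI[OF b'(2,3)] dir_coneI[OF b'(1,3)] by auto
  moreover have "d \<noteq> 0" using calculation(1) cone_nonzero[OF F(1,2) ne(1)] by blast
  moreover have "hits b d X" "hits b d Y" "hits b d Z" using b' unfolding hits_def by blast+
  ultimately show "d \<in> dirs R {X, Y, Z}"
    using R F irrefl R_asym unfolding dirs_def by blast
qed

text \<open>A single line meeting the three sets sorts them by parameter, which reduces the claim to
  \<open>middle_dirs\<close>.\<close>

lemma contractible_dirs_triple:
  assumes H: "H \<subseteq> F" "card H = 3"
  shows "contractible (dirs R H)"
proof -
  obtain d where d: "d \<in> dirs R H" using small_dirs_nonempty[of H] H by auto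
  then obtain z t where t: "\<And>A. A \<in> H \<Longrightarrow> z + t A *\<^sub>R d \<in> A" by (auto simp: dirs_def hits_def) metis
  have R_t: "R A B \<Longrightarrow> t A < t B" if "A \<in> H" "B \<in> H" for A B
    using hits_order[of A B z "t A" d "t B"] t that H(1) d irrefl by (auto simp: dirs_def subset_iff)
  have R_iff: "R A B \<longleftrightarrow> t A < t B" if "A \<in> H" "B \<in> H" "A \<noteq> B" for A B
    using R_t[OF that(1,2)] R_t[OF that(2,1)] total[of A B] that H(1) by (auto simp: subset_iff)
  obtain A B C where ABC: "H = {A, B, C}" "A \<noteq> B" "B \<noteq> C" "A \<noteq> C"
    using H(2) by (auto simp: card_3_iff)
  have "t A \<noteq> t B" "t B \<noteq> t C" "t A \<noteq> t C" using R_iff total ABC H(1) by (metis insert_iff insert_subset less_irrefl)+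
  then consider "t A < t B \<and> t B < t C" | "t A < t C \<and> t C < t B" | "t B < t A \<and> t A < t C"
    | "t B < t C \<and> t C < t A" | "t C < t A \<and> t A < t B" | "t C < t B \<and> t B < t A" by linarith
  then obtain X Y Z where XYZ: "{X, Y, Z} = H" "t X < t Y" "t Y < t Z"
  proof cases
    case 1 then show ?thesis using that[of A B C] ABC(1) by auto
  next
    case 2 then show ?thesis using that[of A C B] ABC(1) by auto
  next
    case 3 then show ?thesis using that[of B A C] ABC(1) by auto
  next
    case 4 then show ?thesis using that[of B C A] ABC(1) by auto
  next
    case 5 then show ?thesis using that[of C A B] ABC(1) by auto
  next
    case 6 then show ?thesis using that[of C B A] ABC(1) by auto
  qed
  have "X \<noteq> Y" "Y \<noteq> Z" "X \<noteq> Z" "X \<in> H" "Y \<in> H" "Z \<in> H" using XYZ by auto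
  then have "dirs R H = middle_dirs X Y Z"
    using dirs_ordered_triple[of X Y Z] R_iff XYZ H(1) by auto
  then show ?thesis
    using contractible_middle_dirs[of X Y Z] ocx \<open>X \<in> H\<close> \<open>Y \<in> H\<close> \<open>Z \<in> H\<close> H(1) by auto
qed

text \<open>A direction can be missing for two reasons. If it violates the order of a pair, a convex
  cone containing \<open>dirs R H\<close> avoids it. If no parallel line meets all of
  \<open>H\<close>, planar Helly names three sets \<open>T\<close> with the same defect, and
  \<open>dirs R T\<close> is the contractible set avoiding it.\<close>

lemma contractible_dirs_if_connected:
  assumes H: "H \<subseteq> F" "4 \<le> card H" and conn: "connected (dirs R H)"
  shows "contractible (dirs R H)"
proof -
  have "\<not> card H \<le> Suc 0" using H(2) by simp
  then obtain A B where AB: "A \<in> H" "B \<in> H" "A \<noteq> B"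
    using finite_sub[OF H(1)] by (auto simp: card_le_Suc0_iff_eq)
  then have "R A B \<or> R B A" using total H(1) by blast
  then obtain A B where AB: "A \<in> H" "B \<in> H" "A \<noteq> B" "R A B" using AB by blast
  have ABF: "A \<in> F" "B \<in> F" using AB H by auto
  obtain w where w: "\<And>d. d \<in> dir_cone A B \<Longrightarrow> w \<bullet> d > 0"
    using open_convex_cone_strict_support[of "dir_cone A B"] open_dir_cone[of B A] convex_dir_cone[of A B]
      cone_nonzero[of A B] ABF AB(3) ocx by blast
  have sub: "dirs R H \<subseteq> dir_cone A B" using AB by (auto simp: dirs_def)
  show ?thesis
  proof (rule contractible_cone_if_connected[OF _ conn, where w = w])
    show "open (dirs R H)" using finite_sub[OF H(1)] ocx H(1) by (intro open_dirs) auto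
    show "c *\<^sub>R d \<in> dirs R H" if "c > 0" "d \<in> dirs R H" for c d using dirs_scale that by blast
    show "w \<bullet> d > 0" if "d \<in> dirs R H" for d using w sub that by blast
    fix z assume wz: "w \<bullet> z > 0" and z: "z \<notin> dirs R H"
    then have z0: "z \<noteq> 0" by auto
    show "\<exists>Q. dirs R H \<subseteq> Q \<and> contractible Q \<and> (\<forall>t. t *\<^sub>R z \<notin> Q)"
    proof (cases "\<exists>X\<in>H. \<exists>Y\<in>H. R X Y \<and> z \<notin> dir_cone X Y")
      case True
      then obtain X Y where XY: "X \<in> H" "Y \<in> H" "R X Y" "z \<notin> dir_cone X Y" by blast
      \<comment> \<open>The half-space excludes the multiples \<open>t *\<^sub>R z\<close> with
        \<open>t \<le> 0\<close>, since \<open>w \<bullet> z > 0\<close>.\<close>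
      let ?Q = "dir_cone X Y \<inter> {d. w \<bullet> d > 0}"
      have "convex ?Q" using XY(1,2) H(1) ocx
        by (intro convex_Int convex_dir_cone convex_halfspace_gt) auto
      moreover have "dirs R H \<subseteq> ?Q" using sub w XY by (auto simp: dirs_def)
      moreover have "t *\<^sub>R z \<notin> ?Q" for t
      proof
        assume tz: "t *\<^sub>R z \<in> ?Q"
        then have "t > 0" using wz by (simp add: zero_less_mult_iff)
        then show False using dir_cone_scale[of "1 / t" "t *\<^sub>R z" X Y] tz XY(4) by simp
      qed
      ultimately show ?thesis using convex_imp_contractible by blast
    next
      case False
      then have zc: "\<And>X Y. X \<in> H \<Longrightarrow> Y \<in> H \<Longrightarrow> R X Y \<Longrightarrow> z \<in> dir_cone X Y" by blast
      then have "\<not> (\<exists>y. \<forall>A\<in>H. hits y z A)" using z z0 by (auto simp: dirs_def)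
      then obtain T where T: "T \<subseteq> H" "card T \<le> 3" "\<not> (\<exists>y. \<forall>A\<in>T. hits y z A)"
        using Helly_parallel_lines[OF finite_sub[OF H(1)] _ z0] ocx H(1) by blast
      have TF: "T \<subseteq> F" "finite T" using T H finite_sub by auto
      \<comment> \<open>One set is met by lines of every direction, and two sets by a line of
        direction \<open>z\<close> because of \<open>zc\<close>; only a triple can obstruct.\<close>
      have "card T = 3"
      proof (rule ccontr)
        assume "card T \<noteq> 3"
        then have "card T \<in> {0, 1, 2}" using T(2) by auto
        then show False
        proof (elim insertE emptyE)
          assume "card T = 0" then show False using T TF by simp
        next
          assume "card T = 1"
          then obtain X where X: "T = {X}" by (auto simp: card_1_singleton_iff)
          then obtain x where "x \<in> X" using TF ocx by blast
          then have "hits x z X" using hits_point by blast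
          then show False using T(3) X by blast
        next
          assume "card T = 2"
          then obtain X Y where XY: "T = {X, Y}" "X \<noteq> Y" by (auto simp: card_2_iff)
          then have "z \<in> dir_cone X Y \<or> z \<in> dir_cone Y X" using zc total[of X Y] T TF by auto
          then have "\<exists>y. hits y z X \<and> hits y z Y" by (meson dir_cone_hits)
          then show False using T(3) XY(1) by blast
        qed
      qed
      then have "\<not> card T \<le> Suc 0" by simp
      then obtain X Y where XY: "X \<in> T" "Y \<in> T" "X \<noteq> Y"
        using TF by (auto simp: card_le_Suc0_iff_eq)
      then have "R X Y \<or> R Y X" using total TF(1) by blast
      then obtain X Y where XY: "X \<in> T" "Y \<in> T" "X \<noteq> Y" "R X Y" using XY by blast
      have XYF: "X \<in> F" "Y \<in> F" using XY TF by auto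
      have zXY: "z \<in> dir_cone X Y" using zc XY T(1) by blast
      have "t *\<^sub>R z \<notin> dirs R T" for t
      proof
        assume tz: "t *\<^sub>R z \<in> dirs R T"
        then have "t *\<^sub>R z \<noteq> 0" "\<exists>y. \<forall>A\<in>T. hits y (t *\<^sub>R z) A" by (auto simp: dirs_def)
        then show False using T(3) by (auto simp: hits_scale)
      qed
      then show ?thesis
        using contractible_dirs_triple[OF TF(1) \<open>card T = 3\<close>] dirs_anti[OF T(1)] by blast
    qed
  qed
qed

section \<open>Replacing the directions through a single set by a contractible space\<close>

definition odir :: "(real^3) set \<Rightarrow> (real^3) set \<Rightarrow> (real^3) set" where
  "odir A B = (if R A B then dir_cone A B else dir_cone B A)"

text \<open>Helly's theorem in dimension 3 asks for four of the cones at a time; their four sets and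
  \<open>A\<close> are five sets, which have a common line.\<close>

lemma common_odir:
  assumes A: "A \<in> F"
  shows "\<exists>u. \<forall>B\<in>F. B \<noteq> A \<longrightarrow> u \<in> odir A B"
proof -
  have "(\<Inter>B\<in>F - {A}. odir A B) \<noteq> {}"
  proof (rule Helly_indexed)
    show "convex (odir A B)" if "B \<in> F - {A}" for B
      using that A ocx by (auto simp: odir_def intro!: convex_dir_cone)
    show "(\<Inter>B\<in>J. odir A B) \<noteq> {}" if J: "J \<subseteq> F - {A}" "card J \<le> DIM(real^3) + 1" for J
    proof -
      have "finite J" using J(1) finF by (meson finite_Diff finite_subset)
      then have "card (insert A J) \<le> 5" using J(2) by (simp add: card_insert_if)
      then obtain d where d: "d \<in> dirs R (insert A J)"
        using small_dirs_nonempty[of "insert A J"] J(1) A by blast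
      have "d \<in> odir A B" if "B \<in> J" for B
        using d that total[of A B] J(1) A by (auto simp: dirs_def odir_def)
      then show ?thesis by blast
    qed
  qed (use finF in simp)
  then show ?thesis by blast
qed

definition pivot :: "(real^3) set \<Rightarrow> real^3" where
  "pivot A = (SOME u. \<forall>B\<in>F. B \<noteq> A \<longrightarrow> u \<in> odir A B)"

lemma pivot: "A \<in> F \<Longrightarrow> B \<in> F \<Longrightarrow> B \<noteq> A \<Longrightarrow> pivot A \<in> odir A B"
  unfolding pivot_def using someI_ex[OF common_odir] by blast

text \<open>The lines through a single set carry all directions, which do not form a contractible
  space; it suffices to keep those not opposite to the common direction \<open>pivot A\<close>.\<close>

definition dirs1 :: "(real^3) set set \<Rightarrow> (real^3) set" where
  "dirs1 H = (if card H = 1 then punctured_by_ray (pivot (the_elem H)) else dirs R H)"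

lemma pivot_nonzero: assumes "A \<in> F" shows "pivot A \<noteq> 0"
proof -
  have "\<not> F \<subseteq> {A}" using cardF card_mono[of "{A}" F] by auto
  then obtain B where B: "B \<in> F" "B \<noteq> A" by blast
  then have "0 \<notin> odir A B" using cone_nonzero[of A B] cone_nonzero[of B A] assms by (auto simp: odir_def)
  then show ?thesis using pivot[OF assms B] by metis
qed

text \<open>The delicate case is a singleton \<open>{A}\<close> inside a larger family:
  \<open>d\<close> and \<open>pivot A\<close> then lie in the same convex cone
  \<open>odir A B\<close> without 0, so \<open>d\<close> avoids the removed ray.\<close>

lemma dirs1_anti:
  assumes "H \<noteq> {}" "H \<subseteq> H'" "H' \<subseteq> F"
  shows "dirs1 H' \<subseteq> dirs1 H"
proof (cases "card H' = 1")
  case True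
  then have "H = H'" using assms by (auto simp: card_1_singleton_iff)
  then show ?thesis by simp
next
  case F: False
  show ?thesis
  proof (cases "card H = 1")
    case True
    then obtain A where A: "H = {A}" by (auto simp: card_1_singleton_iff)
    then have "H' \<noteq> {A}" "A \<in> H'" using F assms(2) by auto
    then obtain B where B: "B \<in> H'" "B \<noteq> A" by blast
    have AB: "A \<in> F" "B \<in> F" "A \<in> H'" using A B assms by auto
    show ?thesis
    proof
      fix d assume "d \<in> dirs1 H'"
      then have d: "d \<in> dirs R H'" using F by (simp add: dirs1_def)
      then have "d \<in> odir A B" using AB B total[of A B] by (auto simp: dirs_def odir_def)
      moreover have "pivot A \<in> odir A B" using pivot AB B by blast
      moreover have "convex (odir A B)" "0 \<notin> odir A B" "\<And>c d. c > 0 \<Longrightarrow> d \<in> odir A B \<Longrightarrow> c *\<^sub>R d \<in> odir A B"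
        using AB B ocx cone_nonzero[of A B] cone_nonzero[of B A]
        by (auto simp: odir_def intro!: convex_dir_cone dir_cone_scale)
      ultimately show "d \<in> dirs1 H" using mem_punctured_by_ray[of "odir A B"] by (simp add: dirs1_def A)
    qed
  next
    case False
    then show ?thesis using F dirs_anti[OF assms(2)] by (simp add: dirs1_def)
  qed
qed

lemma dirs1_line:
  assumes "H \<subseteq> F" "d \<in> dirs1 H"
  shows "d \<noteq> 0 \<and> (\<exists>z. \<forall>A\<in>H. hits z d A)"
proof (cases "card H = 1")
  case True
  then obtain A where A: "H = {A}" by (auto simp: card_1_singleton_iff)
  then obtain a where "a \<in> A" using assms(1) ocx by blast
  then have "hits a d A" by (rule hits_point)
  moreover have "d \<noteq> 0" using assms(2) zero_notin_punctured_by_ray by (auto simp: dirs1_def True)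
  ultimately show ?thesis using A by blast
next
  case False
  then show ?thesis using assms(2) by (auto simp: dirs1_def dirs_def)
qed

lemma AR_dirs1:
  assumes H: "H \<subseteq> F" "H \<noteq> {}" and big: "4 \<le> card H \<Longrightarrow> connected (dirs R H) \<and> dirs R H \<noteq> {}"
  shows "AR (dirs1 H)"
proof (cases "card H = 1")
  case True
  then obtain A where A: "H = {A}" by (auto simp: card_1_singleton_iff)
  then show ?thesis using AR_punctured_by_ray[OF pivot_nonzero[of A]] H by (simp add: dirs1_def)
next
  case False
  have ne: "dirs R H \<noteq> {}" using big small_dirs_nonempty[OF H(1)] by linarith
  have "open (dirs R H)" using finite_sub[OF H(1)] ocx H(1) by (intro open_dirs) auto
  moreover have "contractible (dirs R H)"
  proof -
    have "card H > 0" using H finite_sub by (simp add: card_gt_0_iff)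
    then consider "card H = 2" | "card H = 3" | "4 \<le> card H" using False by linarith
    then show ?thesis
    proof cases
      case 1
      then obtain X Y where XY: "H = {X, Y}" "X \<noteq> Y" by (auto simp: card_2_iff)
      then have "R X Y \<or> R Y X" using total H(1) by auto
      then obtain X Y where XY: "H = {X, Y}" "X \<noteq> Y" "R X Y" using XY by (metis insert_commute)
      then have "X \<in> F" "Y \<in> F" using H by auto
      then have "dirs R H = dir_cone X Y" using dirs_pair[of X Y] R_asym[of X Y] XY by simp
      then show ?thesis
        using \<open>X \<in> F\<close> \<open>Y \<in> F\<close> ocx by (simp add: convex_imp_contractible convex_dir_cone)
    next
      case 2 then show ?thesis using contractible_dirs_triple H by blast
    next
      case 3 then show ?thesis using contractible_dirs_if_connected H big by blast
    qed
  qed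
  ultimately have "AR (dirs R H)" using ne by (rule AR_open_contractible)
  then show ?thesis using False by (simp add: dirs1_def)
qed

text \<open>The two claims need each other, since an absolute retract has to be contractible and
  nonempty. The hypotheses settle connectedness for four sets and nonemptiness up to five; the
  sphere arguments take over at five and six.\<close>

lemma dirs_connected_nonempty:
  assumes "H \<subseteq> F" "4 \<le> card H"
  shows "connected (dirs R H) \<and> dirs R H \<noteq> {}"
  using assms
proof (induction "card H" arbitrary: H rule: less_induct)
  case less
  have fin: "finite H" using finite_sub less.prems by blast
  have HF: "\<And>A. A \<in> H \<Longrightarrow> open A \<and> convex A" using ocx less.prems by blast
  have AR: "AR (dirs1 H')" if "H' \<subseteq> H" "H' \<noteq> {}" "H' \<noteq> H" for H'
  proof (rule AR_dirs1)
    have "card H' < card H" using that fin by (simp add: psubset_card_mono psubset_eq)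
    then show "connected (dirs R H') \<and> dirs R H' \<noteq> {}" if "4 \<le> card H'"
      using less.hyps[of H'] that \<open>H' \<subseteq> H\<close> less.prems by auto
  qed (use that less.prems in auto)
  have anti: "dirs1 H'' \<subseteq> dirs1 H'" if "H' \<noteq> {}" "H' \<subseteq> H''" "H'' \<subseteq> H" for H' H''
    using dirs1_anti[of H' H''] that less.prems by auto
  have line: "d \<noteq> 0 \<and> (\<exists>z. \<forall>A\<in>H'. hits z d A)" if "H' \<subseteq> H" "H' \<noteq> {}" "d \<in> dirs1 H'" for H' d
    using dirs1_line[of H' d] that less.prems by auto
  have H1: "dirs1 H = dirs R H" using less.prems by (simp add: dirs1_def)
  have ne: "dirs R H \<noteq> {}"
  proof (cases "card H \<le> 5")
    case True
    then show ?thesis using small_dirs_nonempty less.prems by blast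
  next
    case False
    then have "\<exists>z d. d \<noteq> 0 \<and> (\<forall>A\<in>H. hits z d A)"
      using common_line_if_proper_subfamilies_AR[of H dirs1] fin HF AR anti line by simp
    then show ?thesis using line_dirs[OF less.prems] by blast
  qed
  have "connected (dirs R H)"
  proof (cases "card H = 4")
    case True then show ?thesis using four less.prems by blast
  next
    case False
    then have card5: "5 \<le> card H" using less.prems by simp
    show ?thesis
    proof (rule ccontr)
      assume "\<not> connected (dirs R H)"
      then obtain A B where AB: "open A" "open B" "dirs R H \<subseteq> A \<union> B" "A \<inter> B \<inter> dirs R H = {}"
          "A \<inter> dirs R H \<noteq> {}" "B \<inter> dirs R H \<noteq> {}" unfolding connected_def by blast
      define P where "P = A \<inter> dirs R H"
      define Q where "Q = B \<inter> dirs R H"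
      have oD: "open (dirs R H)" using fin HF by (intro open_dirs) auto
      have PQ: "open P" "open Q" "P \<inter> Q = {}" "P \<union> Q = dirs R H" "P \<noteq> {}" "Q \<noteq> {}"
        using AB oD by (auto simp: P_def Q_def)
      show False
      proof (rule no_direction_split_if_proper_subfamilies_AR[of H dirs1 P Q, OF fin card5 HF AR anti line])
        show "d \<in> dirs1 H \<or> - d \<in> dirs1 H" if "d \<noteq> 0" "\<forall>A\<in>H. hits z d A" for z d
          using line_dirs[OF less.prems that] by (simp add: H1)
        show "- d \<notin> dirs1 H" if "d \<in> dirs1 H" for d
          using dirs_asym[of H d] less.prems that by (simp add: H1)
        show "P \<union> Q = dirs1 H" using PQ(4) by (simp add: H1)
        show "c *\<^sub>R d \<in> P" if "c > 0" "d \<in> P" for c d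
          using cone_clopen_part[OF dirs_scale PQ(1-4) that(2,1)] .
        show "c *\<^sub>R d \<in> Q" if "c > 0" "d \<in> Q" for c d
          using cone_clopen_part[OF dirs_scale PQ(2,1) _ _ that(2,1), of R H] PQ(3,4) by blast
      qed (use PQ in auto)
    qed
  qed
  then show ?case using ne by blast
qed

lemma common_line: "\<exists>z d. d \<noteq> 0 \<and> (\<forall>A\<in>F. hits z d A)"
  using dirs_connected_nonempty[of F] cardF by (auto simp: dirs_def)

end

section \<open>Transversal spaces\<close>

text \<open>For points \<open>x\<close>, \<open>y\<close> in the two parts of a separation, the
  cycle \<open>c\<close> with coefficient \<open>g\<close> at \<open>x\<close> and
  \<open>- g\<close> at \<open>y\<close> would bound. Each 1-simplex lies in one part, so the
  simplices in \<open>E1\<close> would alone have boundary \<open>g\<close> at \<open>x\<close>,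
  although boundaries have augmentation 0.\<close>

lemma connected_space_if_homologically_connected:
  fixes X :: "'a topology"
  assumes nz: "(UNIV :: 'g::ab_group_add set) \<noteq> {0}"
    and hc: "homologically_connected TYPE('g) X"
  shows "connected_space X"
  unfolding connected_space_def
proof clarify
  fix E1 E2
  assume E: "openin X E1" "openin X E2" "topspace X \<subseteq> E1 \<union> E2" "E1 \<inter> E2 = {}" "E1 \<noteq> {}" "E2 \<noteq> {}"
  obtain g :: 'g where g: "g \<noteq> 0" using nz by blast
  obtain x y where xy: "x \<in> E1" "y \<in> E2" using E by blast
  then have xyX: "x \<in> topspace X" "y \<in> topspace X" using E openin_subset by blast+
  \<comment> \<open>The restriction is needed because singular simplices are extensional functions
    on the standard simplex.\<close>
  define pt where "pt a = restrict (\<lambda>_. a) (standard_simplex 0)" for a :: 'a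
  define K where "K S = {f :: (nat \<Rightarrow> real) \<Rightarrow> 'a. f ` standard_simplex 0 \<subseteq> S}" for S
  have pt: "singular_simplex 0 X (pt a)" if "a \<in> topspace X" for a
    unfolding singular_simplex_def pt_def
    by (auto intro!: continuous_map_eq[of _ _ "\<lambda>_. a"] simp: that)
  have ptK: "pt x \<in> K E1" "pt y \<in> K E2" using xy by (auto simp: pt_def K_def)
  have disj: "f \<notin> K E2" if "f \<in> K E1" for f
    using that E(4) nonempty_standard_simplex[of 0] by (fastforce simp: K_def)
  define c :: "('a, 'g) coeff_chain" where "c = Poly_Mapping.single (pt x) g + Poly_Mapping.single (pt y) (- g)"
  have "c \<in> coeff_chains 0 X"
    unfolding c_def using pt xyX by (intro coeff_chains_closed) (auto simp: coeff_chains_def)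
  moreover have "augmentation c = 0" by (simp add: c_def augmentation_add augmentation_single)
  ultimately have "c \<in> reduced_cycles 0 X" by (simp add: reduced_cycles_def)
  then have "c \<in> coeff_boundaries 0 X"
    using hc unfolding homologically_connected_def trivial_reduced_coeff_homology_group_iff by blast
  then obtain b :: "('a, 'g) coeff_chain" where b: "b \<in> coeff_chains 1 X" "c = coeff_boundary 1 b"
    by (auto simp: coeff_boundaries_def)
  define T where "T f = (\<Sum>k\<le>1. Poly_Mapping.single (singular_face 1 k f)
    (if even k then Poly_Mapping.lookup b f else - Poly_Mapping.lookup b f))" for f
  define B where "B S = {f \<in> Poly_Mapping.keys b. f ` standard_simplex 1 \<subseteq> S}" for S
  define e where "e S = (\<Sum>f\<in>B S. T f)" for S
  have bs: "singular_simplex 1 X f" if "f \<in> Poly_Mapping.keys b" for f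
    using b(1) that by (auto simp: coeff_chains_def)
  have keysB: "Poly_Mapping.keys b = B E1 \<union> B E2"
  proof -
    have "f \<in> B E1 \<or> f \<in> B E2" if f: "f \<in> Poly_Mapping.keys b" for f
    proof -
      have "continuous_map (subtopology (powertop_real UNIV) (standard_simplex 1)) X f"
        using bs[OF f] by (simp add: singular_simplex_def)
      moreover have "connectedin (subtopology (powertop_real UNIV) (standard_simplex 1)) (standard_simplex 1)"
        using connectedin_standard_simplex[of 1] by (simp add: connectedin_subtopology)
      ultimately have conn: "connectedin X (f ` standard_simplex 1)" by (rule connectedin_continuous_map_image)
      then have "f ` standard_simplex 1 \<subseteq> E1 \<union> E2" using E(3) connectedin_subset_topspace by blast
      then show ?thesis
        using connectedinD[OF conn E(1,2)] E(4) f unfolding B_def by blast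
    qed
    then show ?thesis by (auto simp: B_def)
  qed
  have disjB: "B E1 \<inter> B E2 = {}"
    using E(4) nonempty_standard_simplex[of 1] by (fastforce simp: B_def)
  have finB: "finite (B S)" for S by (simp add: B_def)
  have c: "c = e E1 + e E2"
    unfolding b(2) coeff_boundary_def e_def T_def[symmetric] keysB
    using disjB finB by (intro sum.union_disjoint) auto
  have aug: "augmentation (e S) = 0" for S
    by (simp add: e_def T_def augmentation_sum augmentation_add augmentation_single)
  have supp: "Poly_Mapping.lookup (e S) f = 0" if f: "f \<notin> K S" for f S
  proof -
    have "singular_face 1 k h \<noteq> f" if "h \<in> B S" "k \<le> 1" for h k
    proof -
      have "singular_simplex 1 (subtopology X S) h"
        using that(1) bs by (auto simp: B_def singular_simplex_subtopology)
      then have "singular_simplex 0 (subtopology X S) (singular_face 1 k h)"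
        using singular_simplex_singular_face[of 1 "subtopology X S" h k] that(2) by simp
      then show ?thesis using f by (auto simp: singular_simplex_subtopology K_def)
    qed
    then show ?thesis
      unfolding e_def T_def lookup_sum by (intro sum.neutral ballI) (simp add: lookup_single when_def)
  qed
  \<comment> \<open>This difference is supported in \<open>K E1\<close>, and by \<open>c\<close> it
    equals one supported in \<open>K E2\<close>; the two sets are disjoint.\<close>
  have "Poly_Mapping.single (pt x) g - e E1 = 0"
  proof (rule poly_mapping_eqI)
    fix f
    have eq: "Poly_Mapping.single (pt x) g - e E1 = e E2 - Poly_Mapping.single (pt y) (- g)"
      using c by (simp add: c_def algebra_simps)
    show "Poly_Mapping.lookup (Poly_Mapping.single (pt x) g - e E1) f = Poly_Mapping.lookup 0 f"
    proof (cases "f \<in> K E1")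
      case True
      then have "f \<notin> K E2" "f \<noteq> pt y" using disj ptK by auto
      then show ?thesis unfolding eq using supp[of f E2] by (simp add: lookup_minus lookup_single when_def)
    next
      case False
      then have "f \<noteq> pt x" using ptK by auto
      then show ?thesis using supp[OF False] by (simp add: lookup_minus lookup_single when_def)
    qed
  qed
  then have "Poly_Mapping.single (pt x) g = e E1" by simp
  then have "g = 0" using aug[of E1] augmentation_single[of "pt x" g] by simp
  then show False using g by simp
qed

section \<open>Lines and their directions in the topology of affine planes\<close>

lemma affine_planes_1:
  fixes L :: "'a::euclidean_space set"
  shows "L \<in> affine_planes 1 \<longleftrightarrow> (\<exists>z d. d \<noteq> 0 \<and> L = range (\<lambda>t. z + t *\<^sub>R d))"
proof
  assume "L \<in> affine_planes 1"
  then have L: "affine L" "aff_dim L = 1" by (auto simp: affine_planes_def)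
  then have "L \<noteq> {}" by auto
  then obtain a where a: "a \<in> L" by blast
  moreover have "L \<noteq> {a}" using L by auto
  ultimately obtain b where b: "b \<in> L" "b \<noteq> a" by blast
  have "affine hull {a, b} = L"
    using a b L by (intro affine_dim_equal) (auto simp: hull_minimal subset_hull aff_dim_affine_hull)
  then show "\<exists>z d. d \<noteq> 0 \<and> L = range (\<lambda>t. z + t *\<^sub>R d)"
    using b by (intro exI[of _ a] exI[of _ "b - a"]) (auto simp: affine_hull_2_alt)
next
  assume "\<exists>z d. d \<noteq> 0 \<and> L = range (\<lambda>t. z + t *\<^sub>R d)"
  then obtain z d where d: "d \<noteq> 0" "L = range (\<lambda>t. z + t *\<^sub>R d)" by blast
  then have "L = affine hull {z, z + d}" by (simp add: affine_hull_2_alt)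
  then show "L \<in> affine_planes 1" using d(1) by (simp add: affine_planes_def aff_dim_affine_hull)
qed

lemma transversals_1:
  "L \<in> transversals 1 G \<longleftrightarrow> (\<exists>z d. d \<noteq> 0 \<and> L = range (\<lambda>t. z + t *\<^sub>R d) \<and> (\<forall>A\<in>G. hits z d A))"
  for G :: "(real^3) set set"
proof -
  have "range (\<lambda>t. z + t *\<^sub>R d) \<inter> A = {} \<longleftrightarrow> \<not> hits z d A" for z d and A :: "(real^3) set"
    unfolding hits_def by blast
  note [simp] = this
  show ?thesis
  proof
    assume "L \<in> transversals 1 G"
    then have "L \<in> affine_planes 1" "\<forall>A\<in>G. L \<inter> A \<noteq> {}" unfolding transversals_def by blast+
    then obtain z d where d: "d \<noteq> 0" "L = range (\<lambda>t. z + t *\<^sub>R d)" "\<forall>A\<in>G. L \<inter> A \<noteq> {}"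
      unfolding affine_planes_1 by blast
    then have "\<forall>A\<in>G. hits z d A" by simp
    then show "\<exists>z d. d \<noteq> 0 \<and> L = range (\<lambda>t. z + t *\<^sub>R d) \<and> (\<forall>A\<in>G. hits z d A)" using d by blast
  next
    assume "\<exists>z d. d \<noteq> 0 \<and> L = range (\<lambda>t. z + t *\<^sub>R d) \<and> (\<forall>A\<in>G. hits z d A)"
    then obtain z d where d: "d \<noteq> 0" "L = range (\<lambda>t. z + t *\<^sub>R d)" "\<forall>A\<in>G. hits z d A" by blast
    then have "\<forall>A\<in>G. L \<inter> A \<noteq> {}" by simp
    moreover have "L \<in> affine_planes 1" using d affine_planes_1 by blast
    ultimately show "L \<in> transversals 1 G" by (simp add: transversals_def)
  qed
qed

definition direction_planes :: "'a::euclidean_space set \<Rightarrow> 'a set set" where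
  "direction_planes P = {L \<in> affine_planes 1. \<exists>x\<in>L. \<exists>y\<in>L. y - x \<in> P}"

text \<open>Height 1 of the linear span is \<open>L\<close> itself, so height 0 consists of the
  differences of its points.\<close>

lemma direction_in_cone_span:
  assumes "affine L" "L \<noteq> {}"
  shows "(d, 0) \<in> cone_span L \<longleftrightarrow> (\<exists>x\<in>L. \<exists>y\<in>L. y - x = d)"
proof
  assume d: "(d, 0) \<in> cone_span L"
  obtain x where x: "x \<in> L" using assms(2) by blast
  then have "(x, 1) \<in> cone_span L" by (auto simp: cone_span_def span_base)
  then have "(x, 1) + (d, 0) \<in> cone_span L" using d unfolding cone_span_def by (rule span_add)
  then have "x + d \<in> L" using cone_span_slice[OF assms(1)] by auto
  then show "\<exists>x\<in>L. \<exists>y\<in>L. y - x = d" using x by (intro bexI[of _ x] bexI[of _ "x + d"]) auto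
next
  assume "\<exists>x\<in>L. \<exists>y\<in>L. y - x = d"
  then obtain x y where xy: "x \<in> L" "y \<in> L" "y - x = d" by blast
  then have "(y, 1) - (x, 1) \<in> cone_span L"
    unfolding cone_span_def by (intro span_diff span_base) auto
  then show "(d, 0) \<in> cone_span L" using xy by simp
qed

text \<open>In the quotient topology openness is tested on frames. The span of a frame that
  represents a line has a one-dimensional slice at height 0, spanned by \<delta>, which depends
  continuously on the frame. Closure of \<open>P\<close> under nonzero factors makes the choice of
  spanning vector irrelevant.\<close>

lemma openin_direction_planes:
  fixes P :: "'a::euclidean_space set"
  assumes P: "open P" "0 \<notin> P" "\<And>c d. c \<noteq> 0 \<Longrightarrow> d \<in> P \<Longrightarrow> c *\<^sub>R d \<in> P"
  shows "openin (affine_plane_space 1) (direction_planes P)"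
proof -
  let ?X = "frame_space (Suc 1) :: (nat \<Rightarrow> 'a \<times> real) topology"
  let ?W = "cone_span ` affine_planes 1 :: ('a \<times> real) set set"
  define U where "U = {V \<in> ?W. \<exists>d\<in>P. (d, 0) \<in> V}"
  have eq: "direction_planes P = cone_span -` U \<inter> affine_planes 1"
  proof -
    have "(\<exists>x\<in>L. \<exists>y\<in>L. y - x \<in> P) \<longleftrightarrow> (\<exists>d\<in>P. (d, 0) \<in> cone_span L)" if "L \<in> affine_planes 1" for L
    proof -
      have "affine L" "L \<noteq> {}" using that by (auto simp: affine_planes_def)
      then show ?thesis by (auto simp: direction_in_cone_span)
    qed
    then show ?thesis by (auto simp: direction_planes_def U_def)
  qed
  define \<delta> where "\<delta> v = snd (v 1) *\<^sub>R fst (v 0) - snd (v 0) *\<^sub>R fst (v 1)" for v :: "nat \<Rightarrow> 'a \<times> real"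
  have span2: "span (v ` {..<Suc 1}) = {a *\<^sub>R v 0 + b *\<^sub>R v 1 | a b. True}" for v :: "nat \<Rightarrow> 'a \<times> real"
  proof -
    have "v ` {..<Suc 1} = {v 0, v 1}" by (auto simp: lessThan_Suc)
    then have "u \<in> span (v ` {..<Suc 1}) \<longleftrightarrow> (\<exists>a b. u = a *\<^sub>R v 0 + b *\<^sub>R v 1)" for u
      by (simp add: span_breakdown_eq) (metis add.commute diff_add_cancel diff_eq_eq)
    then show ?thesis by blast
  qed
  have iff: "span (v ` {..<Suc 1}) \<in> U \<longleftrightarrow> span (v ` {..<Suc 1}) \<in> ?W \<and> \<delta> v \<in> P" for v
  proof -
    have "(\<exists>d\<in>P. (d, 0) \<in> span (v ` {..<Suc 1})) \<longleftrightarrow> \<delta> v \<in> P" if W: "span (v ` {..<Suc 1}) \<in> ?W"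
    proof
      assume "\<delta> v \<in> P"
      moreover have "(\<delta> v, 0) = snd (v 1) *\<^sub>R v 0 + (- snd (v 0)) *\<^sub>R v 1"
        by (simp add: \<delta>_def prod_eq_iff)
      then have "(\<delta> v, 0) \<in> span (v ` {..<Suc 1})" unfolding span2 by blast
      ultimately show "\<exists>d\<in>P. (d, 0) \<in> span (v ` {..<Suc 1})" by blast
    next
      assume "\<exists>d\<in>P. (d, 0) \<in> span (v ` {..<Suc 1})"
      then obtain d a b where d: "d \<in> P" "(d, 0) = a *\<^sub>R v 0 + b *\<^sub>R v 1" unfolding span2 by blast
      then have d1: "d = a *\<^sub>R fst (v 0) + b *\<^sub>R fst (v 1)" and d2: "a * snd (v 0) + b * snd (v 1) = 0"
        by (auto simp: prod_eq_iff)
      have "\<exists>u\<in>span (v ` {..<Suc 1}). snd u \<noteq> 0" using W by (auto simp: cone_span_image)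
      then obtain a' b' where "snd (a' *\<^sub>R v 0 + b' *\<^sub>R v 1) \<noteq> 0" unfolding span2 by blast
      then have s: "snd (v 0) \<noteq> 0 \<or> snd (v 1) \<noteq> 0" by auto
      have d0: "d \<noteq> 0" using d(1) P(2) by auto
      \<comment> \<open>By \<open>d2\<close> the pair \<open>(a, b)\<close> is proportional to
        \<open>(snd (v 1), - snd (v 0))\<close>, which is nonzero by \<open>s\<close>.\<close>
      have "\<exists>k. d = k *\<^sub>R \<delta> v"
      proof (cases "snd (v 1) = 0")
        case True
        then have "a = 0" using s d2 by simp
        then show ?thesis using s True
          by (intro exI[of _ "- b / snd (v 0)"]) (simp add: \<delta>_def d1)
      next
        case False
        then have "b = - a / snd (v 1) * snd (v 0)" using d2 by (simp add: field_simps)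
        then show ?thesis using False
          by (intro exI[of _ "a / snd (v 1)"]) (simp add: \<delta>_def d1 scaleR_diff_right)
      qed
      then obtain k where k: "d = k *\<^sub>R \<delta> v" by blast
      then have "k \<noteq> 0" using d0 by auto
      then show "\<delta> v \<in> P" using P(3)[of "1 / k" d] d(1) k by simp
    qed
    then show ?thesis by (auto simp: U_def)
  qed
  have "continuous_map ?X euclidean (\<lambda>v. v i)" if "i < Suc 1" for i
    unfolding frame_space_def using that
    by (intro continuous_map_from_subtopology continuous_map_product_projection) auto
  then have c01: "continuous_map ?X euclidean (\<lambda>v. v 0)" "continuous_map ?X euclidean (\<lambda>v. v 1)" by auto
  have "continuous_map ?X euclidean (\<lambda>v. (v 0, v 1))"
    using continuous_map_pairedI[OF c01] by (simp only: prod_topology_euclidean)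
  moreover have "continuous_map euclidean euclidean
      (\<lambda>(p :: 'a \<times> real, q :: 'a \<times> real). snd q *\<^sub>R fst p - snd p *\<^sub>R fst q)"
    by (auto simp: case_prod_unfold intro!: continuous_intros)
  ultimately have "continuous_map ?X euclidean
     ((\<lambda>(p :: 'a \<times> real, q :: 'a \<times> real). snd q *\<^sub>R fst p - snd p *\<^sub>R fst q) \<circ> (\<lambda>v. (v 0, v 1)))"
    by (rule continuous_map_compose)
  then have "continuous_map ?X euclidean \<delta>" by (simp add: o_def \<delta>_def[abs_def])
  then have "openin ?X {v \<in> topspace ?X. \<delta> v \<in> P}"
    using P(1) by (intro openin_continuous_map_preimage) auto
  moreover have "openin ?X {v \<in> topspace ?X. span (v ` {..<Suc 1}) \<in> ?W}"
    using openin_cone_span_image[of 1, where 'a = 'a] by (simp add: grassmannian_def openin_quotient_topology)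
  ultimately have "openin ?X ({v \<in> topspace ?X. \<delta> v \<in> P} \<inter> {v \<in> topspace ?X. span (v ` {..<Suc 1}) \<in> ?W})"
    by (rule openin_Int)
  also have "{v \<in> topspace ?X. \<delta> v \<in> P} \<inter> {v \<in> topspace ?X. span (v ` {..<Suc 1}) \<in> ?W}
      = {v \<in> topspace ?X. span (v ` {..<Suc 1}) \<in> U}"
    using iff by blast
  finally have "openin ?X {v \<in> topspace ?X. span (v ` {..<Suc 1}) \<in> U}" .
  moreover have "U \<subseteq> topspace (grassmannian (Suc 1))"
    by (auto simp: topspace_grassmannian cone_span_image U_def)
  ultimately have "openin (grassmannian (Suc 1)) U"
    by (simp add: grassmannian_def openin_quotient_topology topspace_quotient_topology)
  then show ?thesis
    unfolding affine_plane_space_def openin_pullback_topology eq by blast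
qed

lemma mem_direction_planes:
  assumes P: "0 \<notin> P" "\<And>c d. c \<noteq> 0 \<Longrightarrow> d \<in> P \<Longrightarrow> c *\<^sub>R d \<in> P" and d: "d \<noteq> 0"
  shows "range (\<lambda>t. z + t *\<^sub>R d) \<in> direction_planes P \<longleftrightarrow> d \<in> P"
proof
  assume "range (\<lambda>t. z + t *\<^sub>R d) \<in> direction_planes P"
  then obtain s t where "(z + t *\<^sub>R d) - (z + s *\<^sub>R d) \<in> P" by (auto simp: direction_planes_def)
  then have st: "(t - s) *\<^sub>R d \<in> P" by (simp add: scaleR_diff_left)
  then have "t - s \<noteq> 0" using P(1) by auto
  then show "d \<in> P" using P(2)[of "1 / (t - s)", OF _ st] by simp
next
  assume "d \<in> P"
  then have "(z + 1 *\<^sub>R d) - (z + 0 *\<^sub>R d) \<in> P" by simp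
  then show "range (\<lambda>t. z + t *\<^sub>R d) \<in> direction_planes P"
    using d unfolding direction_planes_def affine_planes_1 by blast
qed

text \<open>Points of the transversal space are unoriented, so only direction sets closed under
  negative factors define sets of lines. The witnesses \<open>p\<close> and \<open>q\<close> make
  both open parts nonempty.\<close>

lemma no_symmetric_direction_split:
  fixes G :: "(real^3) set set"
  assumes conn: "connected_space (transversal_space 1 G)"
    and P: "open P" "0 \<notin> P" "\<And>c d. c \<noteq> 0 \<Longrightarrow> d \<in> P \<Longrightarrow> c *\<^sub>R d \<in> P"
    and Q: "open Q" "0 \<notin> Q" "\<And>c d. c \<noteq> 0 \<Longrightarrow> d \<in> Q \<Longrightarrow> c *\<^sub>R d \<in> Q"
    and cover: "\<And>z d. d \<noteq> 0 \<Longrightarrow> \<forall>A\<in>G. hits z d A \<Longrightarrow> (d \<in> P) \<noteq> (d \<in> Q)"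
    and p: "\<forall>A\<in>G. hits z p A" "p \<in> P" and q: "\<forall>A\<in>G. hits y q A" "q \<in> Q"
  shows False
proof -
  let ?X = "transversal_space 1 G"
  let ?E1 = "direction_planes P \<inter> transversals 1 G"
  let ?E2 = "direction_planes Q \<inter> transversals 1 G"
  have top: "topspace ?X = transversals 1 G"
    by (auto simp: transversal_space_def topspace_affine_plane_space transversals_def)
  have o: "openin ?X ?E1" "openin ?X ?E2"
    unfolding transversal_space_def using openin_direction_planes P Q by (blast intro: openin_subtopology_Int)+
  have pq: "p \<noteq> 0" "q \<noteq> 0" using P(2) Q(2) p q by auto
  have 1: "range (\<lambda>t. z + t *\<^sub>R p) \<in> ?E1"
    using mem_direction_planes[OF P(2,3) pq(1), of z] p pq(1) transversals_1[of _ G] by blast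
  have 2: "range (\<lambda>t. y + t *\<^sub>R q) \<in> ?E2"
    using mem_direction_planes[OF Q(2,3) pq(2), of y] q pq(2) transversals_1[of _ G] by blast
  have 3: "L \<in> direction_planes P \<longleftrightarrow> L \<notin> direction_planes Q" if L: "L \<in> transversals 1 G" for L
  proof -
    obtain z d where d: "d \<noteq> 0" "L = range (\<lambda>t. z + t *\<^sub>R d)" "\<forall>A\<in>G. hits z d A"
      using L unfolding transversals_1 by blast
    show ?thesis
      unfolding d(2) using cover[OF d(1,3)]
        mem_direction_planes[OF P(2,3) d(1), of z] mem_direction_planes[OF Q(2,3) d(1), of z] by blast
  qed
  have "\<exists>E1 E2. openin ?X E1 \<and> openin ?X E2 \<and> topspace ?X \<subseteq> E1 \<union> E2 \<and> E1 \<inter> E2 = {} \<and> E1 \<noteq> {} \<and> E2 \<noteq> {}"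
  proof (rule exI[of _ ?E1], rule exI[of _ ?E2], intro conjI o)
    show "topspace ?X \<subseteq> ?E1 \<union> ?E2" "?E1 \<inter> ?E2 = {}" using 3 unfolding top by blast+
    show "?E1 \<noteq> {}" "?E2 \<noteq> {}" using 1 2 by blast+
  qed
  then show False using conn unfolding connected_space_def by blast
qed

definition sym_hull :: "'a::real_vector set \<Rightarrow> 'a set" where
  "sym_hull P = P \<union> uminus ` P"

lemma mem_sym_hull: "d \<in> sym_hull P \<longleftrightarrow> d \<in> P \<or> - d \<in> P"
  by (auto simp: sym_hull_def image_iff) (metis minus_minus)

lemma sym_hull_props:
  fixes P :: "'a::real_normed_vector set"
  assumes "open P" "0 \<notin> P" "\<And>c d. c > 0 \<Longrightarrow> d \<in> P \<Longrightarrow> c *\<^sub>R d \<in> P"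
  shows "open (sym_hull P)" "0 \<notin> sym_hull P" "\<And>c d. c \<noteq> 0 \<Longrightarrow> d \<in> sym_hull P \<Longrightarrow> c *\<^sub>R d \<in> sym_hull P"
proof -
  show "open (sym_hull P)" unfolding sym_hull_def using assms(1) by (intro open_Un open_negations)
  show "0 \<notin> sym_hull P" using assms(2) by (simp add: mem_sym_hull)
  fix c :: real and d assume c: "c \<noteq> 0" "d \<in> sym_hull P"
  then consider "c > 0" "d \<in> P" | "c > 0" "- d \<in> P" | "- c > 0" "d \<in> P" | "- c > 0" "- d \<in> P"
    unfolding mem_sym_hull by linarith
  then show "c *\<^sub>R d \<in> sym_hull P"
    unfolding mem_sym_hull by cases (use assms(3)[of c d] assms(3)[of c "- d"] assms(3)[of "- c" d] assms(3)[of "- c" "- d"] in auto)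
qed

section \<open>Coherent orientation from families of four and five sets\<close>

locale four_connected_family =
  fixes F :: "(real^3) set set"
  assumes finF: "finite F" and cardF: "card F \<ge> 5"
    and disj: "\<And>A B. A \<in> F \<Longrightarrow> B \<in> F \<Longrightarrow> A \<noteq> B \<Longrightarrow> A \<inter> B = {}"
    and ocx: "\<And>A. A \<in> F \<Longrightarrow> A \<noteq> {} \<and> open A \<and> convex A"
    and five: "\<And>G. G \<subseteq> F \<Longrightarrow> card G = 5 \<Longrightarrow> \<exists>z d. d \<noteq> 0 \<and> (\<forall>A\<in>G. hits z d A)"
    and four: "\<And>G. G \<subseteq> F \<Longrightarrow> card G = 4 \<Longrightarrow> connected_space (transversal_space 1 G)"
begin

lemma cone_cases:
  assumes "A \<in> F" "B \<in> F" "A \<noteq> B" "hits z d A" "hits z d B"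
  shows "(d \<in> dir_cone A B) \<noteq> (d \<in> dir_cone B A)"
proof -
  obtain s t where st: "z + s *\<^sub>R d \<in> A" "z + t *\<^sub>R d \<in> B" using assms(4,5) by (auto simp: hits_def)
  then have "s \<noteq> t" using disj assms by blast
  then have "d \<in> dir_cone A B \<or> d \<in> dir_cone B A"
    using dir_coneI[OF st] dir_coneI[OF st(2,1)] by linarith
  moreover have "d \<notin> dir_cone B A" if "d \<in> dir_cone A B"
    using dir_cone_asym[of A B d] that disj ocx assms by blast
  ultimately show ?thesis by blast
qed

text \<open>Agreement in sense of the ordered pairs \<open>(A, B)\<close> and \<open>(C, D)\<close>
  along one line. The line has to meet at least four sets because connectedness is known for
  quadruples; this makes the outcome independent of the line.\<close>

definition same :: "(real^3) set \<Rightarrow> (real^3) set \<Rightarrow> (real^3) set \<Rightarrow> (real^3) set \<Rightarrow> bool" where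
  "same A B C D \<longleftrightarrow> (\<exists>G z d. G \<subseteq> F \<and> 4 \<le> card G \<and> {A, B, C, D} \<subseteq> G \<and> d \<noteq> 0 \<and>
     (\<forall>X\<in>G. hits z d X) \<and> d \<in> dir_cone A B \<and> d \<in> dir_cone C D)"

lemma sameI:
  assumes "G \<subseteq> F" "4 \<le> card G" "{A, B, C, D} \<subseteq> G" "d \<noteq> 0" "\<forall>X\<in>G. hits z d X"
    "d \<in> dir_cone A B" "d \<in> dir_cone C D"
  shows "same A B C D"
  unfolding same_def using assms by blast

lemma sameE:
  assumes "same A B C D"
  obtains G z d where "G \<subseteq> F" "4 \<le> card G" "{A, B, C, D} \<subseteq> G" "d \<noteq> 0" "\<forall>X\<in>G. hits z d X"
    "d \<in> dir_cone A B" "d \<in> dir_cone C D"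
  using assms unfolding same_def by (elim exE conjE) (rule that)

lemma same_sym: "same A B C D \<Longrightarrow> same C D A B"
  unfolding same_def by (auto simp: insert_commute)

lemma five_line:
  assumes "H \<subseteq> F" "card H \<le> 5"
  obtains G z d where "H \<subseteq> G" "G \<subseteq> F" "4 \<le> card G" "d \<noteq> 0" "\<forall>X\<in>G. hits z d X"
proof -
  obtain G where G: "H \<subseteq> G" "G \<subseteq> F" "card G = 5"
    using exists_subset_between[of H 5 F] assms cardF finF by auto
  obtain z d where "d \<noteq> 0" "\<forall>A\<in>G. hits z d A" using five[OF G(2,3)] by blast
  then show ?thesis using that[of G d z] G by simp
qed

lemma five_line_oriented:
  assumes "H \<subseteq> F" "card H \<le> 5" "A \<in> H" "B \<in> H" "A \<noteq> B"
  obtains G z d where "H \<subseteq> G" "G \<subseteq> F" "4 \<le> card G" "d \<noteq> 0" "\<forall>X\<in>G. hits z d X" "d \<in> dir_cone A B"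
proof -
  obtain G z d where G: "H \<subseteq> G" "G \<subseteq> F" "4 \<le> card G" "d \<noteq> 0" "\<forall>X\<in>G. hits z d X"
    using five_line[OF assms(1,2)] .
  show ?thesis
  proof (cases "d \<in> dir_cone A B")
    case True then show ?thesis using that G by blast
  next
    case False
    then have "d \<in> dir_cone B A" using cone_cases[of A B z d] G assms by blast
    then have "- d \<in> dir_cone A B" by (simp add: dir_cone_minus)
    moreover have "\<forall>X\<in>G. hits z (- d) X" using G(5) by (simp add: hits_minus)
    ultimately show ?thesis using that[of G "- d" z] G by simp
  qed
qed

text \<open>Every line meeting the four sets passes the two pairs either in the same sense or in
  opposite senses. Both conditions are open, so lines of both kinds would disconnect the transversal
  space.\<close>

lemma four_sign_constant:
  assumes G: "G \<subseteq> F" "card G = 4" and m: "A \<in> G" "B \<in> G" "C \<in> G" "D \<in> G" and ne: "A \<noteq> B" "C \<noteq> D"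
    and p: "\<forall>X\<in>G. hits z p X" "p \<in> dir_cone A B" "p \<in> dir_cone C D"
    and q: "\<forall>X\<in>G. hits y q X" "q \<in> dir_cone A B" "q \<in> dir_cone D C"
  shows False
proof -
  have F: "A \<in> F" "B \<in> F" "C \<in> F" "D \<in> F" using m G by auto
  have 0: "0 \<notin> dir_cone A B" using zero_notin_dir_cone[of A B] disj F ne by blast
  let ?P = "sym_hull (dir_cone A B \<inter> dir_cone C D)" and ?Q = "sym_hull (dir_cone A B \<inter> dir_cone D C)"
  have P: "open ?P" "0 \<notin> ?P" "\<And>c d. c \<noteq> 0 \<Longrightarrow> d \<in> ?P \<Longrightarrow> c *\<^sub>R d \<in> ?P"
    using ocx F 0 by (intro sym_hull_props; auto intro: open_dir_cone dir_cone_scale)+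
  have Q: "open ?Q" "0 \<notin> ?Q" "\<And>c d. c \<noteq> 0 \<Longrightarrow> d \<in> ?Q \<Longrightarrow> c *\<^sub>R d \<in> ?Q"
    using ocx F 0 by (intro sym_hull_props; auto intro: open_dir_cone dir_cone_scale)+
  show False
  proof (rule no_symmetric_direction_split[OF four[OF G] P Q _ p(1) _ q(1)])
    fix w d assume "d \<noteq> 0" "\<forall>A\<in>G. hits w d A"
    then have "(d \<in> dir_cone A B) \<noteq> (d \<in> dir_cone B A)" "(d \<in> dir_cone C D) \<noteq> (d \<in> dir_cone D C)"
      using cone_cases F ne m by blast+
    then show "(d \<in> ?P) \<noteq> (d \<in> ?Q)" by (auto simp: mem_sym_hull dir_cone_minus)
  qed (use p q in \<open>auto simp: mem_sym_hull\<close>)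
qed

text \<open>If the two pairs have the same members, asymmetry of the cones suffices. Otherwise at
  least three sets occur, and the witnessing lines restrict to quadruples \<open>H1\<close> and
  \<open>H2\<close> sharing three members. A line meeting their union, at most five sets, passes
  \<open>C\<close> and \<open>D\<close> in one of the two senses and so contradicts one of the
  quadruples.\<close>

lemma same_unique:
  assumes F: "A \<in> F" "B \<in> F" "C \<in> F" "D \<in> F" and ne: "A \<noteq> B" "C \<noteq> D"
    and 1: "same A B C D" and 2: "same A B D C"
  shows False
proof -
  let ?S = "{A, B, C, D}"
  obtain G1 z1 d1 where G1: "G1 \<subseteq> F" "4 \<le> card G1" "?S \<subseteq> G1" "d1 \<noteq> 0" "\<forall>X\<in>G1. hits z1 d1 X"
    "d1 \<in> dir_cone A B" "d1 \<in> dir_cone C D" using sameE[OF 1] .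
  obtain G2 z2 d2 where G2: "G2 \<subseteq> F" "4 \<le> card G2" "{A, B, D, C} \<subseteq> G2" "d2 \<noteq> 0" "\<forall>X\<in>G2. hits z2 d2 X"
    "d2 \<in> dir_cone A B" "d2 \<in> dir_cone D C" using sameE[OF 2] .
  have sub: "?S \<subseteq> G1" "?S \<subseteq> G2" using G1(3) G2(3) by auto
  show False
  proof (cases "C \<in> {A, B} \<and> D \<in> {A, B}")
    case True
    then have 1: "C = A \<and> D = B \<or> C = B \<and> D = A" using ne by auto
    have "hits z1 d1 A" "hits z1 d1 B" "hits z2 d2 A" "hits z2 d2 B"
      using sub G1(5) G2(5) by auto
    then show ?thesis
      using 1 G1(6,7) G2(6,7) cone_cases[OF F(1,2) ne(1), of z1 d1] cone_cases[OF F(1,2) ne(1), of z2 d2]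
      by auto
  next
    case False
    then have "{A, B} \<subset> ?S" by blast
    then have "card {A, B} < card ?S" by (intro psubset_card_mono) auto
    then have c3: "3 \<le> card ?S" using ne by simp
    have c4: "card ?S \<le> 4" using card_length[of "[A, B, C, D]"] by simp
    have fG: "finite G1" "finite G2" using finite_subset[OF G1(1) finF] finite_subset[OF G2(1) finF] by blast+
    obtain H1 where H1: "?S \<subseteq> H1" "H1 \<subseteq> G1" "card H1 = 4"
      using exists_subset_between[OF c4 G1(2) sub(1) fG(1)] by (elim exE conjE)
    obtain H2 where H2: "?S \<subseteq> H2" "H2 \<subseteq> G2" "card H2 = 4"
      using exists_subset_between[OF c4 G2(2) sub(2) fG(2)] by (elim exE conjE)
    have fH: "finite H1" "finite H2" using finite_subset[OF H1(2) fG(1)] finite_subset[OF H2(2) fG(2)] by blast+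
    have m: "A \<in> H1" "B \<in> H1" "C \<in> H1" "D \<in> H1" "A \<in> H2" "B \<in> H2" "C \<in> H2" "D \<in> H2"
      using H1(1) H2(1) by simp_all
    have "3 \<le> card (H1 \<inter> H2)" using c3 card_mono[of "H1 \<inter> H2" ?S] H1(1) H2(1) fH by auto
    then have "card (H1 \<union> H2) \<le> 5" using card_Un_Int[OF fH] H1(3) H2(3) by simp
    moreover have "H1 \<union> H2 \<subseteq> F" using H1(2) H2(2) G1(1) G2(1) by blast
    moreover have "A \<in> H1 \<union> H2" "B \<in> H1 \<union> H2" using m by auto
    ultimately obtain G z d where G: "H1 \<union> H2 \<subseteq> G" "G \<subseteq> F" "4 \<le> card G" "d \<noteq> 0" "\<forall>X\<in>G. hits z d X" "d \<in> dir_cone A B"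
      using five_line_oriented[OF _ _ _ _ ne(1)] by metis
    have hF: "H1 \<subseteq> F" "H2 \<subseteq> F" using H1(2) H2(2) G1(1) G2(1) by blast+
    show False
    proof (cases "d \<in> dir_cone C D")
      case True
      show ?thesis
        by (rule four_sign_constant[OF hF(2) H2(3) m(5-8) ne, of z d z2 d2])
          (use G(1,5,6) G2(5-7) H2(2) True in blast)+
    next
      case False
      moreover have "hits z d C" "hits z d D" using m G(1,5) by auto
      ultimately have "d \<in> dir_cone D C" using cone_cases[OF F(3,4) ne(2)] by blast
      then show ?thesis
        by (intro four_sign_constant[OF hF(1) H1(3) m(1-4) ne, of z1 d1 z d])
          (use G(1,5,6) G1(5-7) H1(2) in blast)+
    qed
  qed
qed

text \<open>A line meeting all the sets involved compares all three pairs at once, and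
  \<open>same_unique\<close> dictates its senses. Such a line is available for at most five sets,
  hence the cardinality bound.\<close>

lemma same_trans:
  assumes F: "{A, B, C, D, X, Y} \<subseteq> F" and card: "card {A, B, C, D, X, Y} \<le> 5"
    and ne: "A \<noteq> B" "C \<noteq> D" "X \<noteq> Y" and 1: "same A B C D" and 2: "same C D X Y"
  shows "same A B X Y"
proof -
  let ?S = "{A, B, C, D, X, Y}"
  have "A \<in> ?S" "B \<in> ?S" by simp_all
  then obtain G z d where G: "?S \<subseteq> G" "G \<subseteq> F" "4 \<le> card G" "d \<noteq> 0" "\<forall>X\<in>G. hits z d X" "d \<in> dir_cone A B"
    by (rule five_line_oriented[OF F card _ _ ne(1)])
  have m: "C \<in> F" "D \<in> F" "X \<in> F" "Y \<in> F" "A \<in> F" "B \<in> F" using F by simp_all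
  have mG: "C \<in> G" "D \<in> G" "X \<in> G" "Y \<in> G" "A \<in> G" "B \<in> G" using G(1) by simp_all
  have h: "hits z d C" "hits z d D" "hits z d X" "hits z d Y" using mG G(5) by blast+
  have "d \<in> dir_cone C D"
  proof (rule ccontr)
    assume "d \<notin> dir_cone C D"
    then have "d \<in> dir_cone D C" using cone_cases[OF m(1,2) ne(2) h(1,2)] by simp
    then have "same A B D C" using G(2-6) mG by (intro sameI[OF G(2,3) _ G(4,5)]) simp_all
    then show False using same_unique[OF m(5,6,1,2) ne(1,2) 1] by simp
  qed
  moreover have "d \<in> dir_cone X Y"
  proof (rule ccontr)
    assume "d \<notin> dir_cone X Y"
    then have "d \<in> dir_cone Y X" using cone_cases[OF m(3,4) ne(3) h(3,4)] by simp
    then have "same C D Y X"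
      using \<open>d \<in> dir_cone C D\<close> mG by (intro sameI[OF G(2,3) _ G(4,5)]) simp_all
    then show False using same_unique[OF m(1-4) ne(2,3) 2] by simp
  qed
  ultimately show ?thesis using G(6) mG by (intro sameI[OF G(2,3) _ G(4,5)]) simp_all
qed

lemma same_total:
  assumes F: "{A, B, C, D} \<subseteq> F" and ne: "A \<noteq> B" "C \<noteq> D"
  shows "same A B C D \<or> same A B D C"
proof -
  have "card {A, B, C, D} \<le> 5" "A \<in> {A, B, C, D}" "B \<in> {A, B, C, D}"
    using card_length[of "[A, B, C, D]"] by simp_all
  then obtain G z d where G: "{A, B, C, D} \<subseteq> G" "G \<subseteq> F" "4 \<le> card G" "d \<noteq> 0" "\<forall>X\<in>G. hits z d X" "d \<in> dir_cone A B"
    by (rule five_line_oriented[OF F _ _ _ ne(1)])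
  have m: "C \<in> F" "D \<in> F" using F by simp_all
  have mG: "C \<in> G" "D \<in> G" "A \<in> G" "B \<in> G" using G(1) by simp_all
  have h: "hits z d C" "hits z d D" using mG G(5) by blast+
  have "d \<in> dir_cone C D \<or> d \<in> dir_cone D C" using cone_cases[OF m ne(2) h] by simp
  then show ?thesis
    using G(6) mG sameI[OF G(2,3) _ G(4,5), of A B C D] sameI[OF G(2,3) _ G(4,5), of A B D C] by auto
qed

text \<open>Six sets may occur, too many for a direct use of \<open>same_trans\<close>. The detour
  through the pair formed by \<open>X\<close> and \<open>X'\<close>, suitably ordered as
  \<open>U\<close>, \<open>V\<close>, involves at most five sets in each step.\<close>

lemma same_through_pair:
  assumes F: "A \<in> F" "B \<in> F" "{X, Y, X', Y'} \<subseteq> F" and ne: "A \<noteq> B" "X \<noteq> Y" "X' \<noteq> Y'"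
    and XY: "same A B X Y" and XY': "same A B X' Y'"
  shows "same X Y X' Y'"
proof (cases "X = X'")
  case True
  show ?thesis
  proof (rule same_trans[OF _ _ ne(2,1,3) same_sym[OF XY] XY'])
    have "{X, Y, A, B, X', Y'} = {X, Y, A, B, Y'}" using True by auto
    then show "card {X, Y, A, B, X', Y'} \<le> 5" using card_length[of "[X, Y, A, B, Y']"] by simp
  qed (use F in auto)
next
  case False
  have "\<exists>U V. {U, V} = {X, X'} \<and> same A B U V"
    using same_total[of A B X X'] F ne False by auto
  then obtain U V where UV: "{U, V} = {X, X'}" "same A B U V" by blast
  then have UV': "U \<in> {X, X'}" "V \<in> {X, X'}" "U \<noteq> V" using False by (auto simp: doubleton_eq_iff)
  have a: "same X Y U V"
  proof (rule same_trans[OF _ _ ne(2,1) UV'(3) same_sym[OF XY] UV(2)])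
    have "{X, Y, A, B, U, V} = {X, Y, A, B, X'}" using UV' UV(1) by auto
    then show "card {X, Y, A, B, U, V} \<le> 5" using card_length[of "[X, Y, A, B, X']"] by simp
  qed (use F UV' in auto)
  have b: "same U V X' Y'"
  proof (rule same_trans[OF _ _ UV'(3) ne(1,3) same_sym[OF UV(2)] XY'])
    have "{U, V, A, B, X', Y'} = {X, A, B, X', Y'}" using UV' UV(1) by auto
    then show "card {U, V, A, B, X', Y'} \<le> 5" using card_length[of "[X, A, B, X', Y']"] by simp
  qed (use F UV' in auto)
  show ?thesis
  proof (rule same_trans[OF _ _ ne(2) UV'(3) ne(3) a b])
    have "{X, Y, U, V, X', Y'} = {X, Y, X', Y'}" using UV' by auto
    then show "card {X, Y, U, V, X', Y'} \<le> 5" using card_length[of "[X, Y, X', Y']"] by simp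
  qed (use F UV' in auto)
qed

lemma common_line: "\<exists>z d. d \<noteq> 0 \<and> (\<forall>A\<in>F. hits z d A)"
proof -
  have "\<not> card F \<le> Suc 0" using cardF by simp
  then obtain A0 B0 where AB: "A0 \<in> F" "B0 \<in> F" "A0 \<noteq> B0"
    using finF by (auto simp: card_le_Suc0_iff_eq)
  \<comment> \<open>The pair \<open>(A0, B0)\<close> fixes one of the two global orientations. Lines
    missing \<open>A0\<close> or \<open>B0\<close> still obey \<open>R\<close>, because
    \<open>same_through_pair\<close> compares any two pairs of \<open>R\<close> directly.\<close>
  define R where "R X Y \<longleftrightarrow> X \<in> F \<and> Y \<in> F \<and> X \<noteq> Y \<and> same A0 B0 X Y" for X Y
  have coherent: "d \<in> dir_cone X' Y'"
    if G: "G \<subseteq> F" "4 \<le> card G" and d: "d \<noteq> 0" "\<forall>A\<in>G. hits z d A"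
      and XY: "X \<in> G" "Y \<in> G" "R X Y" "d \<in> dir_cone X Y" and XY': "X' \<in> G" "Y' \<in> G" "R X' Y'"
    for G z d X Y X' Y'
  proof (rule ccontr)
    have R: "X \<noteq> Y" "X' \<noteq> Y'" "same A0 B0 X Y" "same A0 B0 X' Y'" "{X, Y, X', Y'} \<subseteq> F"
      using XY XY' G by (auto simp: R_def)
    assume "d \<notin> dir_cone X' Y'"
    then have "d \<in> dir_cone Y' X'" using cone_cases[of X' Y' z d] R d XY' by auto
    then have "same X Y Y' X'" using G d XY XY' by (intro sameI[of G]) auto
    moreover have "same X Y X' Y'" using same_through_pair[OF AB(1,2) R(5) AB(3) R(1-4)] .
    ultimately show False using same_unique[of X Y X' Y'] R by auto
  qed
  have orient: "(\<forall>A\<in>G. \<forall>B\<in>G. R A B \<longrightarrow> d \<in> dir_cone A B) \<or> (\<forall>A\<in>G. \<forall>B\<in>G. R A B \<longrightarrow> - d \<in> dir_cone A B)"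
    if G: "G \<subseteq> F" "4 \<le> card G" and d: "d \<noteq> 0" "\<forall>A\<in>G. hits z d A" for G z d
  proof (cases "\<exists>X\<in>G. \<exists>Y\<in>G. R X Y \<and> d \<in> dir_cone X Y")
    case True
    then show ?thesis using coherent[OF G d] by blast
  next
    case False
    have "- d \<in> dir_cone X Y" if "X \<in> G" "Y \<in> G" "R X Y" for X Y
      using False that cone_cases[of X Y z d] d by (auto simp: R_def dir_cone_minus)
    then show ?thesis by blast
  qed
  have R_cases: "R X Y \<or> R Y X" if "X \<in> F" "Y \<in> F" "X \<noteq> Y" for X Y
    using same_total[of A0 B0 X Y] AB that by (auto simp: R_def)
  have line_dirs: "d \<in> dirs R G \<or> - d \<in> dirs R G"
    if G: "G \<subseteq> F" "4 \<le> card G" and d: "d \<noteq> 0" "\<forall>A\<in>G. hits z d A" for G z d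
    using orient[OF G d] d by (auto simp: dirs_def hits_minus)
  \<comment> \<open>Connectedness passes from unoriented lines to oriented directions: a splitting
    of the cone yields, after adding opposite directions, a splitting of the transversal
    space.\<close>
  have "connected (dirs R G)" if G: "G \<subseteq> F" "card G = 4" for G
  proof (rule ccontr)
    assume "\<not> connected (dirs R G)"
    then obtain A B where AB: "open A" "open B" "dirs R G \<subseteq> A \<union> B" "A \<inter> B \<inter> dirs R G = {}"
      "A \<inter> dirs R G \<noteq> {}" "B \<inter> dirs R G \<noteq> {}" unfolding connected_def by blast
    define P where "P = A \<inter> dirs R G"
    define Q where "Q = B \<inter> dirs R G"
    have oD: "open (dirs R G)"
      using G finF ocx by (intro open_dirs) (auto intro: finite_subset)
    have PQ: "open P" "open Q" "P \<inter> Q = {}" "P \<union> Q = dirs R G" "P \<noteq> {}" "Q \<noteq> {}"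
      using AB oD by (auto simp: P_def Q_def)
    have cone: "c *\<^sub>R d \<in> P" if "c > 0" "d \<in> P" for c d
      using cone_clopen_part[OF dirs_scale PQ(1-4) that(2,1)] .
    have cone': "c *\<^sub>R d \<in> Q" if "c > 0" "d \<in> Q" for c d
      using cone_clopen_part[OF dirs_scale PQ(2,1) _ _ that(2,1), of R G] PQ(3,4) by blast
    have 0: "0 \<notin> P" "0 \<notin> Q" by (auto simp: P_def Q_def dirs_def)
    \<comment> \<open>This keeps the symmetric hulls of \<open>P\<close> and \<open>Q\<close>
      disjoint on the directions of common lines.\<close>
    have asym: "- d \<notin> dirs R G" if "d \<in> dirs R G" for d
    proof -
      have "\<not> card G \<le> Suc 0" "finite G" using G finF finite_subset by auto
      then obtain X Y where XY: "X \<in> G" "Y \<in> G" "X \<noteq> Y" by (auto simp: card_le_Suc0_iff_eq)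
      then have "R X Y \<or> R Y X" using R_cases G by blast
      then obtain X Y where XY: "X \<in> G" "Y \<in> G" "X \<noteq> Y" "R X Y" using XY by blast
      then have "d \<in> dir_cone X Y" using that by (simp add: dirs_def)
      then have "d \<notin> dir_cone Y X" using dir_cone_asym[of X Y d] disj[of X Y] ocx XY G by blast
      then show ?thesis using XY dir_cone_minus[of d X Y] by (auto simp: dirs_def)
    qed
    obtain p q where pq: "p \<in> P" "q \<in> Q" using PQ by blast
    then have "p \<in> dirs R G" "q \<in> dirs R G" using PQ(4) by auto
    then obtain z y where zy: "\<forall>A\<in>G. hits z p A" "\<forall>A\<in>G. hits y q A" by (auto simp: dirs_def)
    show False
    proof (rule no_symmetric_direction_split[OF four[OF G] sym_hull_props[OF PQ(1) 0(1) cone]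
          sym_hull_props[OF PQ(2) 0(2) cone'] _ zy(1) _ zy(2)])
      fix w d assume "d \<noteq> 0" "\<forall>A\<in>G. hits w d A"
      then have "d \<in> dirs R G \<or> - d \<in> dirs R G" using line_dirs[of G d w] G by simp
      then show "(d \<in> sym_hull P) \<noteq> (d \<in> sym_hull Q)"
        using asym[of d] PQ(3,4) unfolding mem_sym_hull by blast
    qed (use pq in \<open>auto simp: mem_sym_hull\<close>)
  qed
  then interpret oriented_family F R
    using finF cardF disj ocx five orient R_cases by unfold_locales (auto simp: R_def)
  show ?thesis by (rule common_line)
qed

end

theorem theorem3p3p1:
  fixes F :: "(real ^ 3) set set"
  assumes "finite F" and "card F \<ge> 6"
    and "pairwise disjnt F"
    and "\<And>A. A \<in> F \<Longrightarrow> A \<noteq> {} \<and> open A \<and> convex A"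
    and "(UNIV :: 'g::ab_group_add set) \<noteq> {0}"
    and "\<And>F'. F' \<subseteq> F \<Longrightarrow> card F' = 5 \<Longrightarrow> transversals 1 F' \<noteq> {}"
    and "\<And>F'. F' \<subseteq> F \<Longrightarrow> card F' = 4 \<Longrightarrow>
           homologically_connected TYPE('g) (transversal_space 1 F')"
  shows "transversals 1 F \<noteq> {}"
proof -
  interpret four_connected_family F
  proof
    show "finite F" "5 \<le> card F" using assms(1,2) by auto
    show "A \<inter> B = {}" if "A \<in> F" "B \<in> F" "A \<noteq> B" for A B
      using assms(3) that by (auto simp: pairwise_def disjnt_def)
    show "A \<noteq> {} \<and> open A \<and> convex A" if "A \<in> F" for A using assms(4) that .
    show "\<exists>z d. d \<noteq> 0 \<and> (\<forall>A\<in>G. hits z d A)" if "G \<subseteq> F" "card G = 5" for G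
      using assms(6)[OF that] transversals_1[of _ G] by blast
    show "connected_space (transversal_space 1 G)" if "G \<subseteq> F" "card G = 4" for G
      using connected_space_if_homologically_connected[OF assms(5) assms(7)[OF that]] .
  qed
  show ?thesis using common_line transversals_1[of _ F] by blast
qed

end
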